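(* Let $G$ be an abelian group with no elements of order $2$, and let $A,B$ be finite multisets of $G$. Write $\mu := \mu_A-\mu_B$. Then the following are equivalent: (i) $\mathrm{FS}(A)=\mathrm{FS}(B)$. (ii) $\mu\in V(G)$ and $\sum_{g\in G}\mu(g)g=0$. (iii) There is a sequence of multisets $A=E_0,E_1,E_2,\dots,E_m=B$ of $G$ such that each $E_i$ can be transformed into $E_{i+1}$ by applying one of the two types of moves defined in the context. Moreover, for each $i$ we have $\mathrm{FS}(E_{i+1})=\mathrm{FS}(E_i)+s_i$ for some $s_i\in G$, and $s_0+s_1+\cdots+s_{m-1}=0$.
   Context: All multisets are finite. The multiplicity function $\mu_S:G\to\mathbb{N}$ of a finite multiset $S$ of $G$ assigns to $g$ its multiplicity in $S$. Unions add multiplicities, $S\setminus T$ (for $T\subseteq S$) subtracts them, and inclusion is with multiplicity. For a finite multiset $A$ of an abelian group $G$, $\sum A$ is the sum of its elements with multiplicity, and $\mathrm{FS}(A):=\{\sum A' : A'\subseteq A\}$ is the multiset of its $2^{|A|}$ subset sums (repeated elements of $A$ are treated as distinguishable, so one sum per sub-collection). $S+s$ denotes the translate of the multiset $S$ by $s$. For an odd integer $n\ge 3$, let $k\ge 1$ be the smallest integer such that $2^k\equiv 1$ or $2^k\equiv -1 \pmod n$, and set $U_n:=\{1,2,4,\dots,2^{k-1}\}\subseteq \mathbb{Z}/n\mathbb{Z}$. Moves on a finite multiset $A$ of $G$ (an abelian group with no elements of order $2$): (1) for an element $g\in A$, replace $g$ with $-g$, i.e. $A$ becomes $(A\setminus\{g\})\cup\{-g\}$;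 (2) for an odd integer $n\ge 3$, $\alpha,\beta\in(\mathbb{Z}/n\mathbb{Z})^\times$, and an injective group homomorphism $\iota:\mathbb{Z}/n\mathbb{Z}\to G$ with $\iota(\alpha U_n)\subseteq A$, replace the subset $\iota(\alpha U_n)$ of $A$ by $\iota(\beta U_n)$, i.e. $A$ becomes $(A\setminus\iota(\alpha U_n))\cup\iota(\beta U_n)$. $V(G)$ is the $\mathbb{Z}$-module of all functions $\mu:G\to\mathbb{Z}$ with finite support such that $\mu(g)+\mu(-g)=\mu(2g)+\mu(-2g)$ for all $g\in G$, and $\sum_{g\in H}\mu(g)=0$ for all subgroups $H\le G$. *)

theory Defs
  imports "HOL-Library.Multiset" "HOL-Algebra.Elementary_Groups" "HOL-Number_Theory.Residues"
begin

text \<open>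
  The ambient abelian group is a type of class \<open>ab_group_add\<close>. The record below presents it as an
  object of HOL-Algebra (whose operation is written multiplicatively), so that subgroups,
  homomorphisms and integer multiples are those of the library. In particular
  \<open>g [^]\<^bsub>add_grp\<^esub> (k::int)\<close> is the integer multiple \<open>k g\<close>.
\<close>

definition add_grp :: "'a::ab_group_add monoid"
  where "add_grp = \<lparr>carrier = UNIV, monoid.mult = (+), one = 0\<rparr>"

text \<open>
  Repeated elements of \<open>A\<close> are distinguishable: the copies of \<open>g\<close> in \<open>A\<close> are the pairs \<open>(g, i)\<close>
  with \<open>i < count A g\<close>, and there is one subset sum for every set of copies.
\<close>

definition copies :: "'a multiset \<Rightarrow> ('a \<times> nat) set"
  where "copies A = {(g, i). i < count A g}"

definition FS :: "'a::ab_group_add multiset \<Rightarrow> 'a multiset"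
  where "FS A = image_mset (\<lambda>S. \<Sum>p\<in>S. fst p) (mset_set (Pow (copies A)))"

definition translate :: "'a::ab_group_add multiset \<Rightarrow> 'a \<Rightarrow> 'a multiset"
  where "translate S s = image_mset (\<lambda>x. x + s) S"

text \<open>
  \<open>\<int>/n\<int>\<close> is \<open>residue_ring n\<close>, with carrier \<open>{0..n-1}\<close>. The exponent \<open>U_exp n\<close> is only meaningful
  for odd \<open>n\<close>, where a suitable \<open>k\<close> exists.
\<close>

definition U_exp :: "int \<Rightarrow> nat"
  where "U_exp n = (LEAST k. 1 \<le> k \<and> ([2 ^ k = 1] (mod n) \<or> [2 ^ k = - 1] (mod n)))"

definition U_set :: "int \<Rightarrow> int set"
  where "U_set n = {2 ^ i mod n | i. i < U_exp n}"

definition unit_U :: "int \<Rightarrow> int \<Rightarrow> int set"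
  where "unit_U n \<alpha> = {\<alpha> \<otimes>\<^bsub>residue_ring n\<^esub> u | u. u \<in> U_set n}"

definition move_neg :: "'a::ab_group_add multiset \<Rightarrow> 'a multiset \<Rightarrow> bool"
  where "move_neg A A' \<longleftrightarrow> (\<exists>g. g \<in># A \<and> A' = (A - {#g#}) + {#- g#})"

definition move_U :: "'a::ab_group_add multiset \<Rightarrow> 'a multiset \<Rightarrow> bool"
  where "move_U A A' \<longleftrightarrow>
    (\<exists>(n::int) \<alpha> \<beta> \<iota>. odd n \<and> 3 \<le> n \<and>
       \<alpha> \<in> Units (residue_ring n) \<and> \<beta> \<in> Units (residue_ring n) \<and>
       \<iota> \<in> hom (add_monoid (residue_ring n)) add_grp \<and>
       inj_on \<iota> (carrier (residue_ring n)) \<and>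
       mset_set (\<iota> ` unit_U n \<alpha>) \<subseteq># A \<and>
       A' = (A - mset_set (\<iota> ` unit_U n \<alpha>)) + mset_set (\<iota> ` unit_U n \<beta>))"

definition V :: "('a::ab_group_add \<Rightarrow> int) set"
  where "V = {\<mu>. finite {g. \<mu> g \<noteq> 0} \<and>
    (\<forall>g. \<mu> g + \<mu> (- g) = \<mu> (g + g) + \<mu> (- (g + g))) \<and>
    (\<forall>H. subgroup H add_grp \<longrightarrow> (\<Sum>g | g \<in> H \<and> \<mu> g \<noteq> 0. \<mu> g) = 0)}"

end

(*
  A homomorphism \<psi> from G to the complex numbers whose values are roots of unity of odd order turns
  FS(A) = FS(B) + s into a relation between sums of log |1 + \<psi>(x)|, weighted by \<mu>. Averaging it over
  the Galois conjugates of \<psi> kills all terms with \<psi>(x) \<noteq> 1, because doubling permutes the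
  units modulo an odd n; so \<mu> has sum 0 on every kernel, and then on every subgroup.

  Writing log |1 + z| = log |1 - z^2| - log |1 - z| as a series, the rest of the relation says that
  h(m) = \<Sum> \<mu>(x) Re(\<psi>(x)^m - \<psi>(x)^(2m)) satisfies \<Sum> h(jm)/m = 0 for all j. A periodic function with this
  property vanishes: the space of such functions is stable under dilations, so otherwise it would contain
  a Dirichlet character with L(1, \<psi>) = 0. This is excluded by Monsky's Lambert series argument for real
  characters and by the 3-4-1 inequality for complex ones. Since the characters \<psi> separate points, h(1) = 0
  for all of them yields \<nu>(2g) = \<nu>(g) for \<nu>(g) = \<mu>(g) + \<mu>(-g).

  Conversely, for \<mu> in V the function \<nu> is constant on the orbits of multiplication by -1 and 2, and its
  sum over the generators of each cyclic subgroup is 0. If \<nu> is not 0, some orbit with \<nu> > 0 can thus be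
  exchanged for one with \<nu> < 0 generating the same cyclic subgroup, which decreases the sum of |\<nu>|; if
  \<nu> = 0, sign changes suffice.
*)
theory Submission
  imports Defs "HOL-Analysis.Analysis"
begin

section \<open>Abel summation\<close>

text \<open>Odd order of the values serves two purposes: 1 + \<psi>(x) never vanishes, so its
  logarithm exists, and the group of all such roots of unity is divisible, so characters extend from
  subgroups by Zorn's lemma. They separate points because G has no element of order 2, and they
  separate a point from a subgroup that is closed under halving. A general subgroup is therefore
  reduced to its elements of odd order, outside of which \<nu> vanishes: \<nu>(2g) = \<nu>(g) and
  finite support force the points 2^i g to repeat.

  Necessity is proved for FS(A) = FS(B) + s, since absolute values do not see s. The converse
  depends on this: an exchange leads to some A' with FS(A') = FS(A) + s, hence the difference of the
  multiplicities of A' and A lies in V, and the induction continues from A'. The condition on \<Sum>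
  \<mu>(g) g is what makes the shifts cancel: the sums of all elements of FS(A) and FS(B) differ by
  2^|A| times the total shift, and doubling is injective.

  In the 3-4-1 argument a sieve by finitely many primes, on the real axis s > 1, takes the place of
  Euler products.\<close>

lemma summation_by_parts:
  fixes a :: "nat \<Rightarrow> 'a::comm_ring_1"
  shows "(\<Sum>k<n. a k * b k) = (\<Sum>k<n. a k) * b n + (\<Sum>k<n. (\<Sum>i<Suc k. a i) * (b k - b (Suc k)))"
  by (induction n) (simp_all add: algebra_simps)

lemma norm_sum_mult_antimono_le:
  fixes a :: "nat \<Rightarrow> 'a::{real_normed_field,banach}" and b :: "nat \<Rightarrow> real"
  assumes M: "\<And>n. norm (\<Sum>k<n. a k) \<le> M"
    and dec: "\<And>k. b (Suc k) \<le> b k" and pos: "\<And>k. 0 \<le> b k"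
  shows "norm (\<Sum>k<n. a k * of_real (b k)) \<le> M * b 0"
proof -
  define S where "S = (\<lambda>n. \<Sum>k<n. a k)"
  have M': "norm (S n) \<le> M" for n using M by (simp add: S_def)
  have M0: "0 \<le> M" using M[of 0] by simp
  have eq: "(\<Sum>k<n. a k * of_real (b k)) =
      S n * of_real (b n) + (\<Sum>k<n. S (Suc k) * of_real (b k - b (Suc k)))" for n
    using summation_by_parts[of a "\<lambda>k. of_real (b k)" n] by (simp add: S_def)
  have "norm (\<Sum>k<n. a k * of_real (b k)) \<le>
      norm (S n) * b n + (\<Sum>k<n. norm (S (Suc k) * of_real (b k - b (Suc k))))"
    unfolding eq by (rule order_trans[OF norm_triangle_ineq])
      (intro add_mono norm_sum, simp add: norm_mult pos)
  also have "\<dots> \<le> M * b n + (\<Sum>k<n. M * (b k - b (Suc k)))"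
    by (intro add_mono mult_right_mono sum_mono M' pos)
       (auto simp: norm_mult abs_of_nonneg dec simp flip: of_real_diff intro!: mult_right_mono M')
  also have "\<dots> = M * b 0"
    by (simp only: sum_distrib_left[symmetric] sum_lessThan_telescope') (simp add: algebra_simps)
  finally show ?thesis .
qed

text \<open>A block of terms of \<open>a\<close> is a difference of two partial sums, whence the
  factor 2. The bound does not depend on \<open>n\<close>, so it controls the tails of the
  series.\<close>

lemma norm_sum_shift_mult_antimono_le:
  fixes a :: "nat \<Rightarrow> 'a::{real_normed_field,banach}" and b :: "nat \<Rightarrow> real"
  assumes M: "\<And>n. norm (\<Sum>k<n. a k) \<le> M"
    and dec: "\<And>k. b (Suc k) \<le> b k" and pos: "\<And>k. 0 \<le> b k"
  shows "norm (\<Sum>k<n. a (k + m) * of_real (b (k + m))) \<le> 2 * M * b m"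
proof -
  have "norm (\<Sum>k<n. a (k + m)) \<le> 2 * M" for n
  proof -
    have "(\<Sum>k<n. a (k + m)) = (\<Sum>k<n+m. a k) - (\<Sum>k<m. a k)"
      by (induction n) (simp_all add: algebra_simps)
    then show ?thesis using M[of "n+m"] M[of m]
      by (metis (no_types, lifting) add_mono mult_2 norm_triangle_ineq4 order_trans)
  qed
  from norm_sum_mult_antimono_le[of "\<lambda>k. a (k+m)" "2*M" "\<lambda>k. b (k+m)" n, OF this]
  show ?thesis using dec pos by simp
qed

lemma summable_mult_antimono:
  fixes a :: "nat \<Rightarrow> 'a::{real_normed_field,banach}" and b :: "nat \<Rightarrow> real"
  assumes M: "\<And>n. norm (\<Sum>k<n. a k) \<le> M"
    and dec: "\<And>k. b (Suc k) \<le> b k" and lim: "b \<longlonglongrightarrow> 0"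
  shows "summable (\<lambda>k. a k * of_real (b k))"
proof -
  have pos: "0 \<le> b k" for k
    using decseq_ge[OF decseq_SucI[of b] lim] dec by blast
  have M0: "0 \<le> M" using M[of 0] by simp
  have "(\<lambda>m. 2 * M * b m) \<longlonglongrightarrow> 0" using tendsto_mult_left[OF lim, of "2*M"] by simp
  show ?thesis unfolding summable_Cauchy
  proof (intro allI impI)
    fix e :: real assume "e > 0"
    from \<open>(\<lambda>m. 2 * M * b m) \<longlonglongrightarrow> 0\<close> \<open>e > 0\<close> obtain N where N: "\<And>m. m \<ge> N \<Longrightarrow> 2 * M * b m < e"
      by (metis (no_types, lifting) LIMSEQ_D abs_less_iff diff_zero real_norm_def)
    show "\<exists>N. \<forall>m\<ge>N. \<forall>n. norm (\<Sum>k=m..<n. a k * of_real (b k)) < e"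
    proof (intro exI[of _ N] allI impI)
      fix m n assume "m \<ge> N"
      have "norm (\<Sum>k=m..<n. a k * of_real (b k)) \<le> 2 * M * b m"
      proof (cases "m \<le> n")
        case True
        have "(\<Sum>k=m..<n. a k * of_real (b k)) = (\<Sum>k<n-m. a (k+m) * of_real (b (k+m)))"
          using True sum.shift_bounds_nat_ivl[of "\<lambda>k. a k * of_real (b k)" 0 m "n-m"]
          by (simp add: lessThan_atLeast0)
        then show ?thesis using norm_sum_shift_mult_antimono_le[of a M b m "n-m", OF M dec pos] by simp
      next
        case False then show ?thesis using M0 pos by simp
      qed
      then show "norm (\<Sum>k=m..<n. a k * of_real (b k)) < e" using N[OF \<open>m \<ge> N\<close>] by linarith
    qed
  qed
qed

lemma norm_suminf_mult_antimono_le: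
  fixes a :: "nat \<Rightarrow> 'a::{real_normed_field,banach}" and b :: "nat \<Rightarrow> real"
  assumes M: "\<And>n. norm (\<Sum>k<n. a k) \<le> M"
    and dec: "\<And>k. b (Suc k) \<le> b k" and lim: "b \<longlonglongrightarrow> 0"
  shows "norm (\<Sum>k. a k * of_real (b k)) \<le> M * b 0"
proof -
  have pos: "0 \<le> b k" for k
    using decseq_ge[OF decseq_SucI[of b] lim] dec by blast
  show ?thesis
    by (rule LIMSEQ_le_const2[OF tendsto_norm[OF summable_LIMSEQ[OF summable_mult_antimono]]])
       (use assms pos norm_sum_mult_antimono_le[of a M b] in auto)
qed

lemma norm_suminf_shift_mult_antimono_le:
  fixes a :: "nat \<Rightarrow> 'a::{real_normed_field,banach}" and b :: "nat \<Rightarrow> real"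
  assumes M: "\<And>n. norm (\<Sum>k<n. a k) \<le> M"
    and dec: "\<And>k. b (Suc k) \<le> b k" and lim: "b \<longlonglongrightarrow> 0"
  shows "norm (\<Sum>k. a (k + m) * of_real (b (k + m))) \<le> 2 * M * b m"
proof -
  have pos: "0 \<le> b k" for k
    using decseq_ge[OF decseq_SucI[of b] lim] dec by blast
  have "summable (\<lambda>k. a (k + m) * of_real (b (k + m)))"
    using summable_mult_antimono[OF assms] by (subst summable_iff_shift[where f="\<lambda>k. a k * of_real (b k)"])
  show ?thesis
    by (rule LIMSEQ_le_const2[OF tendsto_norm[OF summable_LIMSEQ]], fact)
       (use assms pos norm_sum_shift_mult_antimono_le[of a M b] in auto)
qed

lemma sum_power_bounded:
  fixes z :: complex
  assumes "norm z = 1" "z \<noteq> 1"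
  shows "norm (\<Sum>k<n. z ^ Suc k) \<le> 2 / norm (1 - z)"
proof -
  have "(\<Sum>k<n. z ^ Suc k) = z * ((1 - z^n) / (1 - z))"
    using assms(2) by (simp add: sum_distrib_left[symmetric] geometric_sum[OF assms(2)] divide_simps)
       (simp add: algebra_simps)
  then have "norm (\<Sum>k<n. z ^ Suc k) = norm (1 - z^n) / norm (1 - z)"
    by (simp add: norm_mult norm_divide assms)
  also have "norm (1 - z^n) \<le> 2"
    using norm_triangle_ineq4[of 1 "z^n"] by (simp add: norm_power assms)
  finally show ?thesis by (simp add: divide_right_mono)
qed

text \<open>Abel's limit theorem on the unit circle. The partial sums of the powers of
  \<open>z\<close> are bounded, so summation by parts against x^k / k makes the series converge
  uniformly for x in [0,1]. Its sum \<open>F\<close> is continuous there, and equals - Ln (1 - z x)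
  for x < 1.\<close>

lemma log_series_boundary:
  fixes z :: complex
  assumes z: "norm z = 1" "z \<noteq> 1"
  shows "(\<lambda>k. z ^ Suc k / of_nat (Suc k)) sums (- Ln (1 - z))"
proof -
  define M where "M = 2 / norm (1 - z)"
  define b where "b = (\<lambda>(x::real) k. x ^ Suc k / real (Suc k))"
  have M: "norm (\<Sum>k<n. z ^ Suc k) \<le> M" for n using sum_power_bounded[OF z] by (simp add: M_def)
  have M0: "M \<ge> 0" by (simp add: M_def)
  have dec: "b x (Suc k) \<le> b x k" if "x \<in> {0..1}" for x k
    unfolding b_def using that by (intro frac_le power_decreasing) auto
  have ble: "b x k \<le> 1 / real (Suc k)" if "x \<in> {0..1}" for x k
    unfolding b_def using that by (intro divide_right_mono power_le_one) auto
  have bpos: "b x k \<ge> 0" if "x \<in> {0..1}" for x k using that by (simp add: b_def)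
  have lim: "b x \<longlonglongrightarrow> 0" if "x \<in> {0..1}" for x
    by (rule tendsto_sandwich[OF _ _ tendsto_const LIMSEQ_inverse_real_of_nat])
       (use ble[OF that] bpos[OF that] in \<open>auto simp: inverse_eq_divide\<close>)
  define F where "F = (\<lambda>x. \<Sum>k. z ^ Suc k * of_real (b x k))"
  have sm: "summable (\<lambda>k. z ^ Suc k * of_real (b x k))" if "x \<in> {0..1}" for x
    using summable_mult_antimono[OF M dec lim] that by blast
  have ul: "uniform_limit {0..1} (\<lambda>n x. \<Sum>k<n. z ^ Suc k * of_real (b x k)) F sequentially"
  proof (rule uniform_limitI)
    fix e :: real assume "e > 0"
    have "(\<lambda>n. 2 * M * (1 / real (Suc n))) \<longlonglongrightarrow> 0"
      using tendsto_mult_left[OF LIMSEQ_inverse_real_of_nat, of "2*M"] by (simp add: inverse_eq_divide)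
    from order_tendstoD(2)[OF this \<open>e > 0\<close>]
    have "\<forall>\<^sub>F n in sequentially. 2 * M * (1 / real (Suc n)) < e" .
    then show "\<forall>\<^sub>F n in sequentially. \<forall>x\<in>{0..1}. dist (\<Sum>k<n. z ^ Suc k * of_real (b x k)) (F x) < e"
    proof eventually_elim
      case (elim n)
      show ?case
      proof
        fix x :: real assume x: "x \<in> {0..1}"
        have "F x - (\<Sum>k<n. z ^ Suc k * of_real (b x k)) = (\<Sum>k. z ^ Suc (k+n) * of_real (b x (k+n)))"
          unfolding F_def using suminf_split_initial_segment[OF sm[OF x], of n] by simp
        then have "dist (\<Sum>k<n. z ^ Suc k * of_real (b x k)) (F x) = norm (\<Sum>k. z ^ Suc (k+n) * of_real (b x (k+n)))"
          by (metis dist_commute dist_norm)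
        also have "\<dots> \<le> 2 * M * b x n"
          using norm_suminf_shift_mult_antimono_le[OF M dec[OF x] lim[OF x]] .
        also have "\<dots> \<le> 2 * M * (1 / real (Suc n))" using ble[OF x, of n] M0 by (intro mult_left_mono) auto
        finally show "dist (\<Sum>k<n. z ^ Suc k * of_real (b x k)) (F x) < e" using elim by simp
      qed
    qed
  qed
  have contF: "continuous_on {0..1} F"
    by (rule uniform_limit_theorem[OF _ ul]) (auto intro!: always_eventually continuous_intros simp: b_def simp del: of_nat_Suc)
  have Feq: "F x = - Ln (1 - z * of_real x)" if x: "x \<in> {0..<1}" for x
  proof -
    have "norm (- (z * of_real x)) < 1" using x z by (simp add: norm_mult)
    from Ln_series'[OF this]
    have "(\<lambda>n. - ((z * of_real x) ^ n / of_nat n)) sums Ln (1 - z * of_real x)" by (simp add: )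
    from sums_minus[OF this] have "(\<lambda>n. (z * of_real x) ^ n / of_nat n) sums - Ln (1 - z * of_real x)" by simp
    then have "(\<lambda>n. (z * of_real x) ^ Suc n / of_nat (Suc n)) sums - Ln (1 - z * of_real x)"
      by (subst sums_Suc_iff) simp
    then have "(\<Sum>n. (z * of_real x) ^ Suc n / of_nat (Suc n)) = - Ln (1 - z * of_real x)" by (rule sums_unique[symmetric])
    then show ?thesis unfolding F_def b_def by (simp only: power_mult_distrib of_real_divide of_real_power of_real_of_nat_eq times_divide_eq_right)
  qed
  \<comment> \<open>Keeps 1 - z x, for x near 1, off the branch cut of \<open>Ln\<close>.\<close>
  have re: "Re z < 1"
  proof (rule ccontr)
    assume "\<not> Re z < 1"
    with complex_Re_le_cmod[of z] z have "Re z = 1" by simp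
    with z(1) have "Im z = 0" by (simp add: cmod_def)
    with \<open>Re z = 1\<close> z(2) show False by (simp add: complex_eq_iff)
  qed
  have "isCont (\<lambda>x. - Ln (1 - z * of_real x)) (1::real)"
    using re by (intro continuous_intros) (auto simp: complex_nonpos_Reals_iff)
  then have "((\<lambda>x. - Ln (1 - z * of_real x)) \<longlongrightarrow> - Ln (1 - z)) (at_left (1::real))"
    by (metis (no_types, lifting) filterlim_at_split isCont_def mult.right_neutral of_real_1)
  moreover have "\<forall>\<^sub>F x in at_left (1::real). - Ln (1 - z * of_real x) = F x"
    by (rule eventually_mono[OF eventually_at_left_real[of 0 1]]) (auto simp: Feq)
  ultimately have l1: "(F \<longlongrightarrow> - Ln (1 - z)) (at_left 1)" by (rule Lim_transform_eventually)
  have l2: "(F \<longlongrightarrow> F 1) (at_left 1)"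
    using contF by (auto simp: continuous_on_def at_within_Icc_at_left dest: bspec[of _ _ 1])
  have "F 1 = - Ln (1 - z)" by (rule tendsto_unique[OF _ l2 l1]) simp
  then show ?thesis using summable_sums[OF sm[of 1]] by (simp add: F_def b_def mult_ac)
qed

section \<open>Real characters\<close>

lemma sum_divisors_coprime_mult:
  fixes r :: "nat \<Rightarrow> real"
  assumes "coprime a b" "a > 0" "b > 0" and mult: "\<And>m n. r (m * n) = r m * r n"
  shows "(\<Sum>d | d dvd a * b. r d) = (\<Sum>d | d dvd a. r d) * (\<Sum>d | d dvd b. r d)"
proof -
  have "(\<Sum>d | d dvd a. r d) * (\<Sum>d | d dvd b. r d)
      = (\<Sum>(d, e)\<in>{d. d dvd a} \<times> {e. e dvd b}. r (d * e))"
    by (simp add: sum_product sum.cartesian_product mult)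
  also have "\<dots> = (\<Sum>d | d dvd a * b. r d)"
    unfolding case_prod_beta'
  proof (rule sum.reindex_bij_betw[where h = "\<lambda>p. fst p * snd p" and g = r])
    show "bij_betw (\<lambda>p. fst p * snd p) ({d. d dvd a} \<times> {e. e dvd b}) {d. d dvd a * b}"
      unfolding bij_betw_def
    proof
      show "inj_on (\<lambda>p. fst p * snd p) ({d. d dvd a} \<times> {e. e dvd b})"
      proof (rule inj_onI, clarsimp)
        fix d e d' e' assume d: "d dvd a" "e dvd b" "d' dvd a" "e' dvd b" and eq: "d * e = d' * e'"
        have "coprime d e'" "coprime d' e" "coprime e d'" "coprime e' d"
          using d \<open>coprime a b\<close> by (meson coprime_commute coprime_divisors)+
        then have "d dvd d'" "d' dvd d"
          using eq by (metis coprime_dvd_mult_left_iff dvd_triv_left)+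
        then have "d = d'" by (rule dvd_antisym)
        moreover have "d > 0" using d assms by (metis dvd_pos_nat)
        ultimately show "d = d' \<and> e = e'" using eq by simp
      qed
      show "(\<lambda>p. fst p * snd p) ` ({d. d dvd a} \<times> {e. e dvd b}) = {d. d dvd a * b}"
        by (auto simp: image_iff mult_dvd_mono) (metis division_decomp)
    qed
  qed
  finally show ?thesis by simp
qed

lemma sum_divisors_prime_power:
  fixes r :: "nat \<Rightarrow> real"
  assumes "prime p" and mult: "\<And>m n. r (m * n) = r m * r n" and "r 1 = 1"
  shows "(\<Sum>d | d dvd p ^ k. r d) = (\<Sum>i\<le>k. r p ^ i)"
proof -
  have pow: "r (p ^ i) = r p ^ i" for i by (induction i) (use assms in auto)
  have "{d. d dvd p ^ k} = (\<lambda>i. p ^ i) ` {..k}"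
    using divides_primepow_nat[OF \<open>prime p\<close>] by auto
  moreover have "inj_on (\<lambda>i. p ^ i) {..k}"
    using prime_gt_1_nat[OF \<open>prime p\<close>] by (auto simp: inj_on_def)
  ultimately show ?thesis by (simp add: sum.reindex pow)
qed

text \<open>The divisor sum is multiplicative, and its factor at p^k is 1 + r(p) + ... + r(p)^k,
  which is never negative for r(p) in {-1, 0, 1} and at least 1 for even k. The extra 1 at squares
  is what makes the Lambert series below unbounded near 1.\<close>

lemma sum_divisors_nonneg:
  fixes r :: "nat \<Rightarrow> real"
  assumes mult: "\<And>m n. r (m * n) = r m * r n" and one: "r 1 = 1"
    and vals: "\<And>m. r m \<in> {-1, 0, 1}" and "n > 0"
  shows "(\<Sum>d | d dvd n. r d) \<ge> (if \<exists>m. n = m\<^sup>2 then 1 else 0)"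
  using \<open>n > 0\<close>
proof (induction n rule: less_induct)
  case (less n)
  show ?case
  proof (cases "n = 1")
    case True then show ?thesis by (simp add: one[simplified])
  next
    case False
    then obtain p where p: "prime p" "p dvd n" using prime_factor_nat by blast
    define k where "k = multiplicity p n"
    have "\<not> is_unit p" using prime_gt_1_nat[OF p(1)] by simp
    obtain m where m: "n = p ^ k * m" "\<not> p dvd m"
      using multiplicity_decompose'[of n p] less.prems \<open>\<not> is_unit p\<close> unfolding k_def by auto
    have "m > 0" using less.prems m by (cases m) auto
    have "k \<noteq> 0" using m p(2) by (cases k) auto
    then have "1 < p ^ k" using one_less_power[OF prime_gt_1_nat[OF p(1)], of k] by blast
    then have "m < n" using m \<open>m > 0\<close> by simp
    have cop: "coprime (p ^ k) m" using p m by (simp add: prime_imp_coprime)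
    let ?c = "\<lambda>n. \<Sum>d | d dvd n. r d"
    have eq: "?c n = (\<Sum>i\<le>k. r p ^ i) * ?c m"
      unfolding m(1) using sum_divisors_coprime_mult[OF cop _ \<open>m > 0\<close>, of r] prime_gt_0_nat[OF p(1)] mult
        sum_divisors_prime_power[OF p(1), of r k] one by simp
    have geo: "(\<Sum>i\<le>k. r p ^ i) \<ge> (if even k then 1 else 0)"
    proof -
      have *: "(\<Sum>i\<le>k. (-1::real) ^ i) = (if even k then 1 else 0)" for k by (induction k) auto
      have **: "(\<Sum>i\<le>k. (0::real) ^ i) = 1" for k by (induction k) auto
      consider "r p = -1" | "r p = 0" | "r p = 1" using vals by blast
      then show ?thesis by cases (simp_all add: * **)
    qed
    have IH: "?c m \<ge> (if \<exists>j. m = j\<^sup>2 then 1 else 0)" using less.IH[OF \<open>m < n\<close> \<open>m > 0\<close>] .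
    show ?thesis
    proof (cases "\<exists>j. n = j\<^sup>2")
      case True
      then obtain j where j: "n = j\<^sup>2" by blast
      have "j \<noteq> 0" using j less.prems by auto
      have k2: "k = 2 * multiplicity p j"
        unfolding k_def j using p(1) \<open>j \<noteq> 0\<close> by (simp add: prime_elem_multiplicity_power_distrib prime_imp_prime_elem)
      then have "even k" by simp
      moreover have "\<exists>i. m = i\<^sup>2"
      proof -
        obtain i where i: "j = p ^ multiplicity p j * i"
          using multiplicity_dvd[of p j] by (auto simp: dvd_def)
        have "p ^ k * m = p ^ k * i\<^sup>2"
          using j m(1) k2 by (subst (asm) i) (simp add: power_mult_distrib power_mult[symmetric] mult.commute)
        then have "m = i\<^sup>2" using prime_gt_0_nat[OF p(1)] by simp
        then show ?thesis by blast
      qed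
      ultimately have "(\<Sum>i\<le>k. r p ^ i) \<ge> 1" "?c m \<ge> 1" using geo IH by auto
      then have "1 * 1 \<le> (\<Sum>i\<le>k. r p ^ i) * ?c m" by (intro mult_mono) auto
      then show ?thesis using True eq by simp
    next
      case False
      have "(\<Sum>i\<le>k. r p ^ i) \<ge> 0" "?c m \<ge> 0" using geo IH by (auto split: if_splits)
      then show ?thesis using False eq by simp
    qed
  qed
qed

text \<open>The terms x^i and x^(n-i) have the geometric mean x^(n/2); the inequality of means is
  summed over all such pairs.\<close>

lemma geometric_mean_le_sum:
  fixes x :: real assumes x: "0 < x"
  shows "real (Suc n) * x powr (real n / 2) \<le> (\<Sum>i<Suc n. x ^ i)"
proof -
  have "(\<Sum>i<Suc n. 2 * x powr (real n / 2)) \<le> (\<Sum>i<Suc n. x ^ i + x ^ (n - i))"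
  proof (rule sum_mono)
    fix i assume "i \<in> {..<Suc n}"
    define u v where "u = x powr (real i / 2)" and "v = x powr (real (n - i) / 2)"
    have uv: "u^2 = x^i" "v^2 = x ^ (n - i)"
      using x by (simp_all add: u_def v_def powr_realpow[symmetric] powr_powr[symmetric] power2_eq_square powr_add[symmetric])
    have "real n / 2 = real i / 2 + real (n - i) / 2" using \<open>i \<in> _\<close> by (simp add: field_simps of_nat_diff)
    then have "x powr (real n / 2) = u * v" by (simp only: u_def v_def powr_add)
    moreover have "2 * (u * v) \<le> u^2 + v^2" using sum_squares_bound[of u v] by simp
    ultimately show "2 * x powr (real n / 2) \<le> x ^ i + x ^ (n - i)" using uv by simp
  qed
  also have "\<dots> = 2 * (\<Sum>i<Suc n. x ^ i)"
    using sum.nat_diff_reindex[of "\<lambda>i. x^i" "Suc n"] by (simp add: sum.distrib del: sum.lessThan_Suc)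
  finally show ?thesis by (simp del: sum.lessThan_Suc)
qed

text \<open>With S_n = 1 + x + ... + x^(n-1), the weight times 1 - x is 1/n - x^n/S_n. Its decrease
  amounts to x^n / (S_n S_(n+1)) <= 1 / (n (n+1)), which follows by multiplying the lower bounds for
  S_n and S_(n+1) by geometric means.\<close>

lemma lambert_weight_antimono:
  fixes x :: real assumes x: "0 < x" "x < 1" and "n > 0"
  shows "1 / (real (Suc n) * (1 - x)) - x ^ Suc n / (1 - x ^ Suc n) \<le> 1 / (real n * (1 - x)) - x ^ n / (1 - x ^ n)"
proof -
  define S where "S = (\<lambda>n. \<Sum>i<n. x ^ i)"
  have S: "(1 - x) * S n = 1 - x ^ n" for n
    using sum_gp_strict[of x n] x by (simp add: S_def)
  have Spos: "S n > 0" if "n > 0" for n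
    using that x by (auto simp: S_def intro!: sum_pos)
  have sp: "S n > 0" "S (Suc n) > 0" using Spos \<open>n > 0\<close> by auto
  have SS: "S (Suc n) = S n + x ^ n" by (simp add: S_def)
  have SS': "S (Suc n) = 1 + x * S n" unfolding S_def by (subst sum.lessThan_Suc_shift) (simp add: sum_distrib_left)
  have "x ^ n = x powr (real n / 2) * x powr (real n / 2)"
    using x by (simp add: powr_add[symmetric] powr_realpow)
  moreover have "real n * x powr (real n / 2) \<le> S n"
  proof -
    obtain m where m: "n = Suc m" using \<open>n > 0\<close> gr0_implies_Suc by blast
    have "real n * x powr (real n / 2) \<le> real n * x powr (real m / 2)"
      using x m by (intro mult_left_mono powr_mono') auto
    also have "\<dots> \<le> S n" unfolding S_def m using geometric_mean_le_sum[of x m] x by simp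
    finally show ?thesis .
  qed
  moreover have "real (Suc n) * x powr (real n / 2) \<le> S (Suc n)"
    unfolding S_def using geometric_mean_le_sum x by blast
  ultimately have key: "real n * real (Suc n) * x ^ n \<le> S n * S (Suc n)"
    using x mult_mono[of "real n * x powr (real n / 2)" "S n" "real (Suc n) * x powr (real n / 2)" "S (Suc n)"] sp
    by (simp add: algebra_simps)
  \<comment> \<open>The numerator is x^n (S_(n+1) - x S_n), and the bracket is 1.\<close>
  have "x ^ n / S n - x ^ Suc n / S (Suc n) = x ^ n / (S n * S (Suc n))"
    using sp by (simp add: field_simps) (simp add: SS' algebra_simps)
  also have "\<dots> \<le> 1 / (real n * real (Suc n))"
    using key sp \<open>n > 0\<close> by (simp only: divide_le_eq le_divide_eq mult_pos_pos of_nat_0_less_iff zero_less_Suc if_True times_divide_eq_left) (simp add: field_simps)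
  also have "\<dots> = 1 / real n - 1 / real (Suc n)" using \<open>n > 0\<close> by (simp add: field_simps)
  finally have "1 / real (Suc n) - x ^ Suc n / S (Suc n) \<le> 1 / real n - x ^ n / S n" by simp
  then have "(1 / real (Suc n) - x ^ Suc n / S (Suc n)) / (1 - x) \<le> (1 / real n - x ^ n / S n) / (1 - x)"
    using x by (intro divide_right_mono) auto
  then show ?thesis unfolding S[symmetric] by (simp add: diff_divide_distrib mult.commute)
qed

text \<open>The rearrangement of a Lambert series with m = n k, cut off at m <= L so that only
  finite sums occur.\<close>

lemma sum_divisor_sums_swap:
  fixes r :: "nat \<Rightarrow> real"
  shows "(\<Sum>m\<in>{1..L}. (\<Sum>d | d dvd m. r d) * x ^ m) = (\<Sum>n\<in>{1..L}. r n * (\<Sum>k\<in>{1..L div n}. x ^ (n * k)))"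
proof -
  have "(\<Sum>m\<in>{1..L}. (\<Sum>d | d dvd m. r d) * x ^ m) = (\<Sum>m\<in>{1..L}. \<Sum>d | d dvd m. r d * x ^ m)"
    by (simp add: sum_distrib_right)
  also have "\<dots> = (\<Sum>(m,d)\<in>(SIGMA m:{1..L}. {d. d dvd m}). r d * x ^ m)"
    by (subst sum.Sigma) auto
  also have "\<dots> = (\<Sum>(n,k)\<in>(SIGMA n:{1..L}. {1..L div n}). r n * x ^ (n * k))"
    by (rule sum.reindex_bij_witness[where i = "\<lambda>(n,k). (n * k, n)" and j = "\<lambda>(m,d). (d, m div d)"])
       (auto simp: dvd_imp_le div_le_mono less_eq_div_iff_mult_less_eq mult.commute Suc_le_eq
             intro: dvd_pos_nat elim!: dvdE, metis le_trans mult_le_mono2 nat_mult_1_right Suc_leI One_nat_def)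
  also have "\<dots> = (\<Sum>n\<in>{1..L}. \<Sum>k\<in>{1..L div n}. r n * x ^ (n * k))"
    by (subst sum.Sigma) auto
  finally show ?thesis by (simp add: sum_distrib_left)
qed

text \<open>Suppose that r(n)/n sums to 0. With the divisor sums c(m) and the weights b(n) =
  1/(n(1-x)) - x^n/(1-x^n), the series of c(m) x^m equals that of r(n) x^n/(1-x^n), hence minus that
  of r(n) b(n). Summation by parts bounds the latter by M b(1) = M for every x < 1. The former is at
  least the sum of x^(m^2), which exceeds every bound as x tends to 1.\<close>

lemma real_character_series_nonzero:
  fixes r :: "nat \<Rightarrow> real"
  assumes mult: "\<And>m n. r (m * n) = r m * r n" and one: "r 1 = 1"
    and vals: "\<And>m. r m \<in> {-1, 0, 1}" and M: "\<And>n. norm (\<Sum>k<n. r (Suc k)) \<le> M"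
  shows "\<not> (\<lambda>k. r (Suc k) / real (Suc k)) sums 0"
proof
  assume S: "(\<lambda>k. r (Suc k) / real (Suc k)) sums 0"
  define c where "c = (\<lambda>n. \<Sum>d | d dvd n. r d)"
  have c: "c n \<ge> (if \<exists>m. n = m\<^sup>2 then 1 else 0)" if "n > 0" for n
    unfolding c_def using sum_divisors_nonneg[OF mult one vals that] .
  have c0: "c n \<ge> 0" if "n > 0" for n using c[OF that] by (auto split: if_splits)
  have bound: "(\<Sum>m\<in>{1..K}. x ^ (m^2)) \<le> M" if x: "0 < x" "x < 1" for x K
  proof -
    define b where "b = (\<lambda>n. 1 / (real n * (1 - x)) - x ^ n / (1 - x ^ n))"
    have xn: "x ^ n < 1" if "n > 0" for n using that x by (simp add: power_less_one_iff)
    have bdec: "b (Suc (Suc k)) \<le> b (Suc k)" for k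
      unfolding b_def by (rule lambert_weight_antimono[OF x]) simp
    have blim: "(\<lambda>k. b (Suc k)) \<longlonglongrightarrow> 0"
    proof -
      have 1: "(\<lambda>k. x ^ Suc k) \<longlonglongrightarrow> 0" using x by (intro LIMSEQ_Suc LIMSEQ_power_zero) auto
      have 2: "(\<lambda>k. x ^ Suc k / (1 - x ^ Suc k)) \<longlonglongrightarrow> 0 / (1 - 0)"
        by (intro tendsto_divide 1 tendsto_diff tendsto_const) auto
      have 3: "(\<lambda>k. inverse (real (Suc k)) * (1 / (1 - x))) \<longlonglongrightarrow> 0 * (1 / (1 - x))"
        by (intro tendsto_mult LIMSEQ_inverse_real_of_nat tendsto_const)
      show ?thesis using tendsto_diff[OF 3 2] by (simp add: b_def field_simps)
    qed
    have bpos: "b (Suc k) \<ge> 0" for k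
      using decseq_ge[OF decseq_SucI[of "\<lambda>k. b (Suc k)"] blim] bdec by blast
    \<comment> \<open>The value does not depend on x; this makes the final bound uniform.\<close>
    have b1: "b 1 = 1" using x by (simp add: b_def field_simps)
    \<comment> \<open>The last term is the cost of completing the \<open>L\<close> truncated
      geometric sums, at most x^L / (1 - x) each; it vanishes as \<open>L\<close> grows.\<close>
    have le: "(\<Sum>m\<in>{1..K}. x ^ (m^2)) \<le> M + (\<Sum>k<L. r (Suc k) / real (Suc k)) / (1 - x) + real L * x ^ L / (1 - x)"
      if L: "L \<ge> K^2" for L
    proof -
      have "(\<Sum>m\<in>{1..K}. x ^ (m^2)) = (\<Sum>m\<in>power2 ` {1..K}. x ^ m)"
        by (subst sum.reindex) (auto simp: inj_on_def)
      also have "\<dots> \<le> (\<Sum>m\<in>power2 ` {1..K}. c m * x ^ m)"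
      proof (rule sum_mono)
        fix m assume "m \<in> power2 ` {1..K}"
        then have "c m \<ge> 1" using c[of m] by (auto split: if_splits)
        then show "x ^ m \<le> c m * x ^ m" using x by simp
      qed
      also have "\<dots> \<le> (\<Sum>m\<in>{1..L}. c m * x ^ m)"
      proof (rule sum_mono2)
        show "power2 ` {1..K} \<subseteq> {1..L}"
        proof
          fix y assume "y \<in> power2 ` {1..K}"
          then obtain m where "y = m^2" "1 \<le> m" "m \<le> K" by auto
          moreover have "m^2 \<le> K^2" using \<open>m \<le> K\<close> by (rule power_mono) simp
          ultimately show "y \<in> {1..L}" using L by (auto simp del: power_mono_iff)
        qed
      qed (use c0 x in auto)
      also have "\<dots> = (\<Sum>n\<in>{1..L}. r n * (\<Sum>k\<in>{1..L div n}. x ^ (n * k)))"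
        unfolding c_def by (rule sum_divisor_sums_swap)
      also have "\<dots> \<le> (\<Sum>n\<in>{1..L}. r n * (x ^ n / (1 - x ^ n)) + x ^ L / (1 - x))"
      proof (rule sum_mono)
        fix n assume n: "n \<in> {1..L}"
        define q where "q = L div n"
        have y: "x ^ n < 1" "x ^ n > 0" using n xn x by auto
        have "(\<Sum>k\<in>{1..q}. x ^ (n * k)) = (\<Sum>k\<in>{1..q}. (x ^ n) ^ k)" by (simp add: power_mult)
        also have "\<dots> = (x ^ n - (x^n) ^ Suc q) / (1 - x ^ n)"
        proof -
          have "(1 - y) * (\<Sum>k\<in>{1..q}. y ^ k) = y - y ^ Suc q" for y :: real
          proof (induction q)
            case (Suc q)
            have "(1 - y) * (\<Sum>k\<in>{1..Suc q}. y ^ k) = (1 - y) * (\<Sum>k\<in>{1..q}. y ^ k) + (1 - y) * y ^ Suc q"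
              by (simp add: distrib_left)
            also have "\<dots> = (y - y ^ Suc q) + (1 - y) * y ^ Suc q" by (simp only: Suc.IH)
            also have "\<dots> = y - y ^ Suc (Suc q)" by (simp add: algebra_simps)
            finally show ?case .
          qed simp
          from this[of "x ^ n"] show ?thesis using y by (simp add: nonzero_eq_divide_eq mult.commute)
        qed
        finally have e: "(\<Sum>k\<in>{1..q}. x ^ (n * k)) = x ^ n / (1 - x ^ n) - (x^n) ^ Suc q / (1 - x ^ n)"
          by (simp add: diff_divide_distrib)
        have "L \<le> n * Suc q" unfolding q_def using n
          by (metis atLeastAtMost_iff dividend_less_times_div less_imp_le mult_Suc_right not_less_eq_eq not_one_le_zero gr0I add.commute)
        then have "(x^n) ^ Suc q \<le> x ^ L" using x by (simp add: power_mult[symmetric] power_decreasing del: power_Suc mult_Suc_right)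
        moreover have "1 - x \<le> 1 - x ^ n" using n x power_decreasing[of 1 n x] by simp
        ultimately have "(x^n) ^ Suc q / (1 - x ^ n) \<le> x ^ L / (1 - x)"
          using x y by (intro frac_le) auto
        moreover have "(x^n) ^ Suc q / (1 - x ^ n) \<ge> 0" using y by simp
        ultimately have "- r n * ((x^n) ^ Suc q / (1 - x ^ n)) \<le> x ^ L / (1 - x)"
          using vals[of n] by auto
        then show "r n * (\<Sum>k\<in>{1..L div n}. x ^ (n * k)) \<le> r n * (x ^ n / (1 - x ^ n)) + x ^ L / (1 - x)"
          unfolding q_def[symmetric] e by (simp add: algebra_simps)
      qed
      also have "\<dots> = (\<Sum>n\<in>{1..L}. r n * (x ^ n / (1 - x ^ n))) + real L * x ^ L / (1 - x)"
        by (simp add: sum.distrib)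
      also have "(\<Sum>n\<in>{1..L}. r n * (x ^ n / (1 - x ^ n))) = (\<Sum>n\<in>{1..L}. r n / real n / (1 - x) - r n * b n)"
        by (intro sum.cong) (auto simp: b_def algebra_simps)
      also have "\<dots> = (\<Sum>k<L. r (Suc k) / real (Suc k)) / (1 - x) - (\<Sum>k<L. r (Suc k) * b (Suc k))"
        by (simp add: sum_subtractf sum_divide_distrib sum.atLeast1_atMost_eq lessThan_atLeast0)
      finally have "(\<Sum>m\<in>{1..K}. x ^ (m^2)) \<le> (\<Sum>k<L. r (Suc k) / real (Suc k)) / (1 - x)
          - (\<Sum>k<L. r (Suc k) * b (Suc k)) + real L * x ^ L / (1 - x)" .
      moreover have "- (\<Sum>k<L. r (Suc k) * b (Suc k)) \<le> M * b 1"
        using norm_sum_mult_antimono_le[of "\<lambda>k. r (Suc k)" M "\<lambda>k. b (Suc k)" L] M bdec bpos by simp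
      ultimately show ?thesis using b1 by simp
    qed
    have l1: "(\<lambda>L. (\<Sum>k<L. r (Suc k) / real (Suc k))) \<longlonglongrightarrow> 0" using S by (simp add: sums_def)
    have l2: "(\<lambda>L. real L * x ^ L) \<longlonglongrightarrow> 0"
      using powser_times_n_limit_0[of x] x by simp
    have "(\<lambda>L. M + (\<Sum>k<L. r (Suc k) / real (Suc k)) / (1 - x) + real L * x ^ L / (1 - x)) \<longlonglongrightarrow> M + 0 / (1-x) + 0 / (1 - x)"
      using x by (intro tendsto_add tendsto_divide tendsto_const l1 l2) auto
    then show ?thesis
      by (intro LIMSEQ_le_const[where X = "\<lambda>L. M + (\<Sum>k<L. r (Suc k) / real (Suc k)) / (1 - x) + real L * x ^ L / (1 - x)"])
         (use le in auto)
  qed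
  obtain K :: nat where K: "real K > M" using reals_Archimedean2 by blast
  have "((\<lambda>x::real. \<Sum>m\<in>{1..K}. x ^ (m^2)) \<longlongrightarrow> (\<Sum>m\<in>{1..K}. 1 ^ (m^2))) (at_left 1)"
    by (intro tendsto_intros)
  moreover have "\<forall>\<^sub>F x in at_left (1::real). (\<Sum>m\<in>{1..K}. x ^ (m^2)) \<le> M"
    by (rule eventually_mono[OF eventually_at_left_real[of 0 1]]) (use bound in auto)
  ultimately have "(\<Sum>m\<in>{1..K}. (1::real) ^ (m^2)) \<le> M"
    by (intro tendsto_upperbound) auto
  then show False using K by simp
qed

section \<open>The 3-4-1 inequality\<close>

text \<open>For |w| = 1 one has Re (w^2) = 2 (Re w)^2 - 1, so the sum is 2 (1 + Re w)^2. The value z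
  = 0 is that of a character at a prime dividing its modulus.\<close>

lemma three_four_one_nonneg:
  fixes z :: complex
  assumes "norm z = 1 \<or> z = 0" "k > 0"
  shows "0 \<le> 3 + 4 * Re (z ^ k) + Re (z ^ (2 * k))"
proof (cases "z = 0")
  case False
  define w where "w = z ^ k"
  have "norm w = 1" using False assms by (simp add: w_def norm_power)
  then have "(Re w)^2 + (Im w)^2 = 1" by (metis cmod_power2 one_power2)
  moreover have "z ^ (2 * k) = w ^ 2" by (simp add: w_def power_mult[symmetric] mult.commute)
  ultimately have "3 + 4 * Re (z ^ k) + Re (z ^ (2 * k)) = 2 * (1 + Re w)^2"
    by (simp add: power2_eq_square w_def[symmetric] algebra_simps)
  then show ?thesis by simp
qed (use assms in auto)

lemma ln_norm_one_minus_series: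
  fixes y :: complex
  assumes "norm y < 1"
  shows "(\<lambda>k. Re (y ^ Suc k) / real (Suc k)) sums (- ln (norm (1 - y)))"
proof -
  have "norm (- y) < 1" using assms by simp
  from Ln_series'[OF this]
  have "(\<lambda>n. - (y ^ n / of_nat n)) sums Ln (1 - y)" by simp
  from sums_minus[OF this] have "(\<lambda>n. y ^ n / of_nat n) sums - Ln (1 - y)" by simp
  then have "(\<lambda>n. y ^ Suc n / of_nat (Suc n)) sums - Ln (1 - y)" by (subst sums_Suc_iff) simp
  from sums_Re[OF this] have "(\<lambda>n. Re (y ^ Suc n / of_nat (Suc n))) sums - Re (Ln (1 - y))" by simp
  moreover have "1 - y \<noteq> 0" using assms by auto
  ultimately show ?thesis by (simp del: of_nat_Suc power_Suc add: Re_divide_of_nat)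
qed

text \<open>The inverse Euler factors at one prime p, with x = p^(-s). Minus the logarithm of the
  norm is the sum of x^k / k times the nonnegative expression of the preceding inequality.\<close>

lemma three_four_one_local:
  fixes z :: complex and x :: real
  assumes z: "norm z = 1 \<or> z = 0" and x: "0 < x" "x < 1"
  shows "norm ((1 - of_real x) ^ 3 * (1 - z * of_real x) ^ 4 * (1 - z\<^sup>2 * of_real x)) \<le> 1"
proof -
  have z1: "norm z \<le> 1" using z by auto
  have n: "norm (of_real x :: complex) < 1" "norm (z * of_real x) < 1" "norm (z\<^sup>2 * of_real x) < 1"
    using x z by (auto simp: norm_mult norm_power)
  have ne: "1 - of_real x \<noteq> (0::complex)" "1 - z * of_real x \<noteq> 0" "1 - z\<^sup>2 * of_real x \<noteq> 0"
    using n by auto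
  define t where "t = (\<lambda>k. x ^ Suc k / real (Suc k) * (3 + 4 * Re (z ^ Suc k) + Re (z ^ (2 * Suc k))))"
  have "(\<lambda>k. 3 * (Re (of_real x ^ Suc k) / real (Suc k)) + 4 * (Re ((z * of_real x) ^ Suc k) / real (Suc k))
      + Re ((z\<^sup>2 * of_real x) ^ Suc k) / real (Suc k)) sums
      (3 * (- ln (norm (1 - complex_of_real x))) + 4 * (- ln (norm (1 - z * of_real x))) + (- ln (norm (1 - z\<^sup>2 * of_real x))))"
    by (intro sums_add sums_mult ln_norm_one_minus_series n)
  also have "(\<lambda>k. 3 * (Re (of_real x ^ Suc k) / real (Suc k)) + 4 * (Re ((z * of_real x) ^ Suc k) / real (Suc k))
      + Re ((z\<^sup>2 * of_real x) ^ Suc k) / real (Suc k)) = t"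
  proof
    fix k
    have 1: "Re (of_real x ^ Suc k) = x ^ Suc k" by (metis Re_complex_of_real of_real_power)
    have 2: "Re ((w * of_real x) ^ Suc k) = Re (w ^ Suc k) * x ^ Suc k" for w :: complex
      by (simp del: of_real_power power_Suc add: power_mult_distrib flip: of_real_power)
    show "3 * (Re (of_real x ^ Suc k) / real (Suc k)) + 4 * (Re ((z * of_real x) ^ Suc k) / real (Suc k))
      + Re ((z\<^sup>2 * of_real x) ^ Suc k) / real (Suc k) = t k"
      unfolding 1 2 t_def power_mult[symmetric] by (simp add: field_simps del: power_Suc of_nat_Suc)
  qed
  finally have "t sums (3 * (- ln (norm (1 - complex_of_real x))) + 4 * (- ln (norm (1 - z * of_real x))) + (- ln (norm (1 - z\<^sup>2 * of_real x))))" .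
  moreover have "t k \<ge> 0" for k
    unfolding t_def using x three_four_one_nonneg[OF z, of "Suc k"] by (intro mult_nonneg_nonneg) auto
  ultimately have "3 * (- ln (norm (1 - complex_of_real x))) + 4 * (- ln (norm (1 - z * of_real x))) + (- ln (norm (1 - z\<^sup>2 * of_real x))) \<ge> 0"
    using sums_le[OF _ sums_zero] by blast
  then have "ln (norm ((1 - of_real x) ^ 3 * (1 - z * of_real x) ^ 4 * (1 - z\<^sup>2 * of_real x))) \<le> 0"
    using ne by (simp add: norm_mult norm_power ln_mult ln_realpow)
  then show ?thesis using ne by (subst (asm) ln_le_zero_iff) (auto simp: zero_less_norm_iff simp del: norm_mult)
qed

section \<open>Elementary bounds for zeta(1 + d) and the decrease of n^(-d)\<close>

lemma powr_diff_le:
  fixes d :: real assumes "d > 0"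
  shows "real (Suc k) powr - d - real (Suc (Suc k)) powr - d \<le> d / real (Suc k)"
proof -
  define y where "y = real (Suc k)"
  have y: "y \<ge> 1" by (simp add: y_def)
  have "ln (y + 1) - ln y \<le> 1 / y"
    using ln_diff_le[of "y + 1" y] y by simp
  then have "- (d / y) \<le> - d * (ln (y + 1) - ln y)" using assms mult_left_mono[of "ln (y + 1) - ln y" "1 / y" d] by simp
  moreover have "1 + - d * (ln (y + 1) - ln y) \<le> exp (- d * (ln (y + 1) - ln y))" by (rule exp_ge_add_one_self)
  ultimately have 1: "1 - exp (- d * (ln (y + 1) - ln y)) \<le> d / y" by linarith
  have "y powr - d - (y + 1) powr - d = y powr - d * (1 - exp (- d * (ln (y + 1) - ln y)))"
    using y by (simp add: powr_def algebra_simps exp_add[symmetric])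
  also have "\<dots> \<le> 1 * (d / y)"
  proof (rule mult_mono)
    show "y powr - d \<le> 1" using powr_mono[of "- d" 0 y] y assms by simp
  qed (use 1 y assms in auto)
  finally show ?thesis by (simp add: y_def add.commute)
qed

lemma powr_diff_ge:
  fixes d :: real assumes "d > 0"
  shows "d * real (Suc (Suc k)) powr - (1 + d) \<le> real (Suc k) powr - d - real (Suc (Suc k)) powr - d"
proof -
  define y where "y = real (Suc (Suc k))"
  have y: "y \<ge> 2" by (simp add: y_def)
  have "ln (y - 1) - ln y \<le> (y - 1 - y) / y"
    using ln_diff_le[of "y - 1" y] y by simp
  then have "d / y \<le> d * (ln y - ln (y - 1))" using assms mult_left_mono[of "1 / y" "ln y - ln (y - 1)" d] y by simp
  moreover have "1 + d * (ln y - ln (y - 1)) \<le> exp (d * (ln y - ln (y - 1)))" by (rule exp_ge_add_one_self)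
  ultimately have 1: "d / y \<le> exp (d * (ln y - ln (y - 1))) - 1" by linarith
  have "d * y powr - (1 + d) = y powr - d * (d / y)"
    using y by (simp add: powr_diff powr_minus_divide)
  also have "\<dots> \<le> y powr - d * (exp (d * (ln y - ln (y - 1))) - 1)"
    using 1 by (intro mult_left_mono) auto
  also have "\<dots> = (y - 1) powr - d - y powr - d"
    using y by (simp add: powr_def algebra_simps exp_add[symmetric])
  finally show ?thesis by (simp add: y_def)
qed

lemma sum_powr_le:
  fixes d :: real assumes "d > 0"
  shows "(\<Sum>k<n. real (Suc k) powr - (1 + d)) \<le> 1 + 1 / d"
proof -
  have "(\<Sum>k<Suc n. real (Suc k) powr - (1 + d)) \<le> 1 + (1 - real (Suc n) powr - d) / d" for n
  proof (induction n)
    case (Suc n)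
    have "real (Suc (Suc n)) powr - (1 + d) \<le> (real (Suc n) powr - d - real (Suc (Suc n)) powr - d) / d"
      using powr_diff_ge[OF assms, of n] assms by (simp add: pos_le_divide_eq mult.commute)
    then show ?case using Suc by (simp add: diff_divide_distrib)
  qed simp
  also have "1 + (1 - real (Suc n) powr - d) / d \<le> 1 + 1 / d" for n
    using assms by (simp add: divide_right_mono)
  finally have *: "(\<Sum>k<Suc n. real (Suc k) powr - (1 + d)) \<le> 1 + 1 / d" for n .
  show ?thesis using *[of n] by (simp add: ) (smt (verit) powr_ge_zero)
qed

lemma nat_powr_summable:
  fixes s :: real assumes "s > 1"
  shows "(\<lambda>n. real n powr - s) summable_on A"
proof -
  have "summable (\<lambda>n. norm (real n powr - s))" using assms by (simp add: summable_real_powr_iff)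
  then have "(\<lambda>n. real n powr - s) summable_on UNIV" by (rule norm_summable_imp_summable_on)
  then show ?thesis by (rule summable_on_subset_banach) simp
qed

section \<open>Sieving a completely multiplicative series by finitely many primes\<close>

lemma sieve_step:
  fixes w :: "nat \<Rightarrow> complex"
  assumes mult: "\<And>m n. w (m * n) = w m * w n" and sm: "\<And>A. w summable_on A"
    and P: "\<And>q. q \<in> P \<Longrightarrow> prime q" and p: "prime p" "p \<notin> P"
  shows "infsum w {n. n > 0 \<and> (\<forall>q\<in>insert p P. \<not> q dvd n)} =
      (1 - w p) * infsum w {n. n > 0 \<and> (\<forall>q\<in>P. \<not> q dvd n)}"
proof -
  let ?S = "{n::nat. n > 0 \<and> (\<forall>q\<in>P. \<not> q dvd n)}"
  let ?T = "{n::nat. n > 0 \<and> (\<forall>q\<in>insert p P. \<not> q dvd n)}"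
  have S: "?S = ?T \<union> (\<lambda>n. p * n) ` ?S"
  proof (intro equalityI subsetI)
    fix n assume n: "n \<in> ?S"
    show "n \<in> ?T \<union> (\<lambda>n. p * n) ` ?S"
    proof (cases "p dvd n")
      case True
      then obtain m where m: "n = p * m" by (auto simp: dvd_def)
      then have "m \<in> ?S" using n by auto
      then show ?thesis using m by blast
    qed (use n in auto)
  next
    fix n assume "n \<in> ?T \<union> (\<lambda>n. p * n) ` ?S"
    then show "n \<in> ?S"
    proof
      assume "n \<in> (\<lambda>n. p * n) ` ?S"
      then obtain m where m: "n = p * m" "m \<in> ?S" by auto
      have "\<not> q dvd p" if "q \<in> P" for q
        using that P p by (metis primes_dvd_imp_eq)
      then show ?thesis using m P p prime_gt_0_nat by (auto simp: prime_dvd_mult_iff)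
    qed auto
  qed
  have "infsum w ?S = infsum w (?T \<union> (\<lambda>n. p * n) ` ?S)" using S by (rule arg_cong)
  also have "\<dots> = infsum w ?T + infsum w ((\<lambda>n. p * n) ` ?S)"
    by (rule infsum_Un_disjoint[OF sm sm]) auto
  also have "infsum w ((\<lambda>n. p * n) ` ?S) = infsum (\<lambda>n. w (p * n)) ?S"
    using p prime_gt_0_nat by (subst infsum_reindex) (auto simp: inj_on_def o_def)
  also have "\<dots> = w p * infsum w ?S"
    by (simp add: mult infsum_cmult_right')
  finally have "infsum w ?T = infsum w ?S - w p * infsum w ?S"
    by (rule eq_diff_eq[THEN iffD2, OF sym])
  then show ?thesis by (simp only: left_diff_distrib mult_1)
qed

lemma sieve_prod:
  fixes w :: "nat \<Rightarrow> complex"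
  assumes mult: "\<And>m n. w (m * n) = w m * w n" and sm: "\<And>A. w summable_on A"
    and P: "finite P" "\<And>q. q \<in> P \<Longrightarrow> prime q"
  shows "infsum w {n. n > 0 \<and> (\<forall>q\<in>P. \<not> q dvd n)} = (\<Prod>p\<in>P. 1 - w p) * infsum w {n. n > 0}"
  using P
proof (induction P rule: finite_induct)
  case (insert p P)
  have "infsum w {n. n > 0 \<and> (\<forall>q\<in>insert p P. \<not> q dvd n)} =
      (1 - w p) * infsum w {n. n > 0 \<and> (\<forall>q\<in>P. \<not> q dvd n)}"
    by (rule sieve_step[OF mult sm]) (use insert in auto)
  then show ?case using insert by simp
qed simp

text \<open>Apart from 1, a positive number without prime factors below \<open>K\<close> is at least
  \<open>K\<close>, so the sieved sum differs from w(1) by at most a tail of the dominating series.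
  \<open>P\<close> is chosen before \<open>w\<close>: the same primes have to serve three series at
  once.\<close>

lemma sieve_near_one:
  fixes s e :: real assumes "s > 1" "e > 0"
  obtains P where "finite P" "\<And>q. q \<in> P \<Longrightarrow> prime (q::nat)"
    "\<And>w. (\<And>n. norm (w n :: complex) \<le> real n powr - s) \<Longrightarrow> w 1 = 1 \<Longrightarrow>
      norm (infsum w {n. n > 0 \<and> (\<forall>q\<in>P. \<not> q dvd n)} - 1) \<le> e"
proof -
  let ?f = "\<lambda>n. real n powr - s"
  have sum: "summable ?f" using assms by (simp add: summable_real_powr_iff)
  have sumn: "summable (\<lambda>n. norm (?f n))" using sum by simp
  obtain K0 where K0: "\<And>K. K \<ge> K0 \<Longrightarrow> norm (\<Sum>i. ?f (i + K)) < e"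
    using suminf_exist_split[OF \<open>e > 0\<close> sum] by blast
  define K where "K = max K0 2"
  define P where "P = {q. prime q \<and> q < K}"
  have tail: "infsum ?f {K..} \<le> e"
  proof -
    have "infsum ?f {K..} = infsum (\<lambda>i. ?f (i + K)) UNIV"
    proof -
      have "{K..} = (\<lambda>i. i + K) ` UNIV" by (auto simp: image_iff) (metis add.commute le_Suc_ex)
      then show ?thesis by (simp add: infsum_reindex inj_on_def o_def)
    qed
    also have "\<dots> = (\<Sum>i. ?f (i + K))"
    proof -
      have "summable (\<lambda>i. norm (?f (i + K)))" using sumn by (rule summable_ignore_initial_segment)
      from infsumI[OF norm_summable_imp_has_sum[OF this summable_sums[OF summable_norm_cancel[OF this]]]]
      show ?thesis .
    qed
    also have "\<dots> \<le> e" using K0[of K] by (simp add: K_def)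
    finally show ?thesis .
  qed
  show ?thesis
  proof (rule that[of P])
    show "finite P" by (simp add: P_def)
    show "prime q" if "q \<in> P" for q using that by (simp add: P_def)
    fix w :: "nat \<Rightarrow> complex" assume w: "\<And>n. norm (w n) \<le> ?f n" "w 1 = 1"
    let ?S = "{n::nat. n > 0 \<and> (\<forall>q\<in>P. \<not> q dvd n)}"
    have nsm: "(\<lambda>n. norm (w n)) summable_on A" for A
      by (rule summable_on_comparison_test[OF nat_powr_summable[OF \<open>s > 1\<close>]]) (use w in auto)
    have sm: "w summable_on A" for A using nsm by (rule abs_summable_summable)
    have S1: "?S = insert 1 (?S - {1})"
      using prime_gt_1_nat by (auto simp: P_def dest: prime_gt_1_nat)
    have "?S - {1} \<subseteq> {K..}"
    proof
      fix n assume n: "n \<in> ?S - {1}"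
      then obtain q where "prime q" "q dvd n" using prime_factor_nat by auto
      then have "\<not> q < K" using n by (auto simp: P_def)
      moreover have "q \<le> n" using \<open>q dvd n\<close> n by (auto intro: dvd_imp_le)
      ultimately show "n \<in> {K..}" by simp
    qed
    have "infsum w ?S = infsum w ({1} \<union> (?S - {1}))" using S1 by (metis insert_is_Un)
    also have "\<dots> = infsum w {1} + infsum w (?S - {1})"
      by (rule infsum_Un_disjoint[OF sm sm]) auto
    finally have "infsum w ?S = infsum w {1} + infsum w (?S - {1})" .
    then have "norm (infsum w ?S - 1) = norm (infsum w (?S - {1}))" using w by simp
    also have "\<dots> \<le> infsum (\<lambda>n. norm (w n)) (?S - {1})" by (rule norm_infsum_bound[OF nsm])
    also have "\<dots> \<le> infsum ?f (?S - {1})"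
      by (rule infsum_mono[OF nsm nat_powr_summable[OF \<open>s > 1\<close>]]) (use w in auto)
    also have "\<dots> \<le> infsum ?f {K..}"
      by (rule infsum_mono_neutral[OF nat_powr_summable[OF \<open>s > 1\<close>] nat_powr_summable[OF \<open>s > 1\<close>]])
         (use \<open>?S - {1} \<subseteq> {K..}\<close> in auto)
    also have "\<dots> \<le> e" by (rule tail)
    finally show "norm (infsum w ?S - 1) \<le> e" .
  qed
qed

text \<open>Each product of \<open>L j\<close> with its finite sieve factor is within 1/2 of 1,
  hence has norm at least 1/2, while the sieve factors combined with exponents 3, 4, 1 have norm at
  most 1, prime by prime. The constant is 2^(3+4+1). For j = 0 the coefficient is 1 even where
  \<psi> vanishes, so \<open>L 0\<close> is the zeta function.\<close>

lemma three_four_one: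
  fixes \<psi> :: "nat \<Rightarrow> complex" and s :: real
  assumes mult: "\<And>m n. \<psi> (m * n) = \<psi> m * \<psi> n" and one: "\<psi> 1 = 1"
    and norm: "\<And>n. norm (\<psi> n) = 1 \<or> \<psi> n = 0" and s: "s > 1"
  defines "L \<equiv> \<lambda>j. infsum (\<lambda>n. \<psi> n ^ j * of_real (real n powr - s)) {n. n > 0}"
  shows "1 \<le> 2 ^ 8 * norm (L 0 ^ 3 * L 1 ^ 4 * L 2)"
proof -
  define w where "w = (\<lambda>j n. \<psi> n ^ j * complex_of_real (real n powr - s))"
  have wm: "w j (m * n) = w j m * w j n" for j m n
    by (simp add: w_def mult power_mult_distrib powr_mult)
  have w1: "w j 1 = 1" for j using one by (simp add: w_def)
  have nc: "norm (\<psi> n) \<le> 1" for n using norm[of n] by auto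
  have wn: "norm (w j n) \<le> real n powr - s" for j n
    using mult_right_mono[OF power_le_one[OF _ nc, of n j], of "real n powr - s"]
    by (simp add: w_def norm_mult norm_power)
  have nsm: "(\<lambda>n. norm (w j n)) summable_on A" for A j
    by (rule summable_on_comparison_test[OF nat_powr_summable[OF s]]) (use wn in auto)
  have sm: "w j summable_on A" for A j using nsm by (rule abs_summable_summable)
  obtain P where P: "finite P" "\<And>q. q \<in> P \<Longrightarrow> prime (q::nat)"
    and near: "\<And>w. (\<And>n. norm (w n :: complex) \<le> real n powr - s) \<Longrightarrow> w 1 = 1 \<Longrightarrow>
      norm (infsum w {n. n > 0 \<and> (\<forall>q\<in>P. \<not> q dvd n)} - 1) \<le> 1 / 2"
    using sieve_near_one[OF s, of "1/2"] by auto
  have ge: "1 / 2 \<le> norm ((\<Prod>p\<in>P. 1 - w j p) * L j)" for j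
  proof -
    have "norm (infsum (w j) {n. n > 0 \<and> (\<forall>q\<in>P. \<not> q dvd n)} - 1) \<le> 1 / 2"
      by (rule near) (use wn w1 in auto)
    then have "norm ((\<Prod>p\<in>P. 1 - w j p) * L j - 1) \<le> 1 / 2"
      using sieve_prod[OF wm sm P] by (simp add: L_def w_def)
    then show ?thesis
      using norm_triangle_ineq2[of 1 "1 - (\<Prod>p\<in>P. 1 - w j p) * L j"]
      by (simp add: norm_minus_commute)
  qed
  let ?E = "\<lambda>j. \<Prod>p\<in>P. 1 - w j p"
  have "norm (?E 0 ^ 3 * ?E 1 ^ 4 * ?E 2) = (\<Prod>p\<in>P. norm ((1 - w 0 p) ^ 3 * (1 - w 1 p) ^ 4 * (1 - w 2 p)))"
    by (simp only: prod_norm prod.distrib prod_power_distrib)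
  also have "\<dots> \<le> 1"
  proof (rule prod_le_1)
    fix p assume "p \<in> P"
    then have "p > 1" using P(2) prime_gt_1_nat by blast
    then have "0 < real p powr - s" "real p powr - s < 1" using s by (auto simp: powr_less_one)
    from three_four_one_local[OF norm[of p] this]
    show "0 \<le> norm ((1 - w 0 p) ^ 3 * (1 - w 1 p) ^ 4 * (1 - w 2 p)) \<and>
        norm ((1 - w 0 p) ^ 3 * (1 - w 1 p) ^ 4 * (1 - w 2 p)) \<le> 1"
      by (simp add: w_def)
  qed
  finally have E: "norm (?E 0 ^ 3 * ?E 1 ^ 4 * ?E 2) \<le> 1" .
  have "(1/2) ^ 3 * (1/2) ^ 4 * (1/2) \<le> norm (?E 0 * L 0) ^ 3 * norm (?E 1 * L 1) ^ 4 * norm (?E 2 * L 2)"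
    by (intro mult_mono power_mono ge) auto
  also have "\<dots> = norm (?E 0 ^ 3 * ?E 1 ^ 4 * ?E 2) * norm (L 0 ^ 3 * L 1 ^ 4 * L 2)"
    by (simp add: norm_mult norm_power power_mult_distrib)
  also have "\<dots> \<le> 1 * norm (L 0 ^ 3 * L 1 ^ 4 * L 2)"
    by (intro mult_right_mono E) auto
  finally show ?thesis by (simp add: power_divide field_simps)
qed

section \<open>Nonvanishing of Dirichlet series at 1\<close>

lemma infsum_pos_nat_eq_suminf:
  fixes f :: "nat \<Rightarrow> complex"
  assumes "summable (\<lambda>k. norm (f (Suc k)))"
  shows "infsum f {n. n > 0} = (\<Sum>k. f (Suc k))"
proof -
  have "{n. n > 0} = range Suc" by (auto simp: image_iff gr0_conv_Suc)
  then have "infsum f {n. n > 0} = infsum (\<lambda>k. f (Suc k)) UNIV"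
    by (simp add: infsum_reindex o_def)
  also have "\<dots> = (\<Sum>k. f (Suc k))"
    using infsumI[OF norm_summable_imp_has_sum[OF assms summable_sums[OF summable_norm_cancel[OF assms]]]] .
  finally show ?thesis .
qed

text \<open>Vanishing at 1 forces vanishing of first order. The partial sums T(n) of c(k)/k are
  minus the tails, hence O(1/n). Summing by parts against k^(-d), whose decrease is at most d/k,
  leaves d times a telescoping sum of 1/(k(k+1)).\<close>

lemma dirichlet_series_near_zero:
  fixes c :: "nat \<Rightarrow> complex" and d :: real
  assumes M: "\<And>n. norm (\<Sum>k<n. c (Suc k)) \<le> M" and d: "d > 0"
    and zero: "(\<lambda>k. c (Suc k) / of_nat (Suc k)) sums 0"
  shows "norm (\<Sum>k. c (Suc k) * of_real (real (Suc k) powr - (1 + d))) \<le> 2 * M * d"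
proof -
  define a where "a = (\<lambda>k. c (Suc k) / of_nat (Suc k))"
  define T where "T = (\<lambda>n. \<Sum>k<n. a k)"
  define b where "b = (\<lambda>k. real (Suc k) powr - d)"
  have M0: "M \<ge> 0" using M[of 0] by simp
  have T: "norm (T n) \<le> 2 * M / real (Suc n)" for n
  proof -
    have sm: "summable a" using zero by (simp add: a_def sums_iff)
    have "(\<Sum>k. a (k + n)) = - T n"
      using suminf_minus_initial_segment[OF sm, of n] zero by (simp add: a_def T_def sums_iff)
    moreover have "norm (\<Sum>k. c (Suc (k + n)) * of_real (1 / real (Suc (k + n)))) \<le> 2 * M * (1 / real (Suc n))"
    proof (rule norm_suminf_shift_mult_antimono_le[of "\<lambda>k. c (Suc k)" M "\<lambda>k. 1 / real (Suc k)"])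
      show "(\<lambda>k. 1 / real (Suc k)) \<longlonglongrightarrow> 0"
        using LIMSEQ_inverse_real_of_nat by (simp add: inverse_eq_divide)
    qed (use M in \<open>auto simp: field_simps\<close>)
    ultimately show ?thesis by (simp add: a_def divide_inverse norm_minus_commute del: of_nat_Suc)
  qed
  have bb: "0 \<le> b k" "b k \<le> 1" "b (Suc k) \<le> b k" for k
  proof -
    show "0 \<le> b k" by (simp add: b_def)
    show "b k \<le> 1" using powr_mono[of "- d" 0 "real (Suc k)"] d by (simp add: b_def)
    show "b (Suc k) \<le> b k" unfolding b_def by (rule powr_mono2') (use d in auto)
  qed
  have part: "norm (\<Sum>k<n. a k * of_real (b k)) \<le> 2 * M / real (Suc n) + 2 * M * d" for n
  proof -
    have "norm (\<Sum>k<n. a k * of_real (b k)) \<le> norm (T n * of_real (b n)) + (\<Sum>k<n. norm (T (Suc k) * of_real (b k - b (Suc k))))"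
      unfolding summation_by_parts[of a] T_def of_real_diff[symmetric]
      by (rule order_trans[OF norm_triangle_ineq]) (intro add_mono norm_sum order_refl)
    also have "\<dots> \<le> 2 * M / real (Suc n) * 1 + (\<Sum>k<n. (2 * M / real (Suc (Suc k))) * (d / real (Suc k)))"
    proof (intro add_mono sum_mono)
      show "norm (T n * of_real (b n)) \<le> 2 * M / real (Suc n) * 1"
        unfolding norm_mult by (intro mult_mono T) (use bb M0 in auto)
      show "norm (T (Suc k) * of_real (b k - b (Suc k))) \<le> (2 * M / real (Suc (Suc k))) * (d / real (Suc k))" for k
        unfolding norm_mult
        using bb[of k] powr_diff_le[OF d, of k] M0
        by (intro mult_mono T) (simp_all add: b_def norm_of_real abs_of_nonneg del: of_nat_Suc of_real_diff)
    qed
    also have "(\<Sum>k<n. (2 * M / real (Suc (Suc k))) * (d / real (Suc k))) = (\<Sum>k<n. 2 * M * d * (1 / real (Suc k) - 1 / real (Suc (Suc k))))"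
      by (intro sum.cong refl) (simp add: field_simps)
    also have "\<dots> = 2 * M * d * (1 - 1 / real (Suc n))"
      using sum_lessThan_telescope'[of "\<lambda>k. 1 / real (Suc k)" n] by (simp add: sum_distrib_left[symmetric])
    also have "\<dots> \<le> 2 * M * d * 1" using M0 d by (intro mult_left_mono) auto
    finally show ?thesis by simp
  qed
  have eq: "c (Suc k) * of_real (real (Suc k) powr - (1 + d)) = a k * of_real (b k)" for k
  proof -
    have "real (Suc k) powr - (1 + d) = real (Suc k) powr - d / real (Suc k)"
    proof -
      have "- (1 + d) = - d - 1" by simp
      then show ?thesis using powr_diff[of "real (Suc k)" "- d" 1] by (simp only:) simp
    qed
    then show ?thesis by (simp only: a_def b_def of_real_divide of_real_of_nat_eq times_divide_eq_right times_divide_eq_left)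
  qed
  have "summable a" using zero by (simp add: a_def sums_iff)
  have "summable (\<lambda>k. real (Suc k) powr - (1 + d))"
    using d summable_real_powr_iff[of "- (1 + d)"] by (subst summable_Suc_iff) simp
  have "norm (c (Suc k)) \<le> 2 * M" for k
    using M[of "Suc k"] M[of k] norm_triangle_ineq4[of "\<Sum>k<Suc k. c (Suc k)" "\<Sum>k<k. c (Suc k)"] by simp
  then have "summable (\<lambda>k. c (Suc k) * of_real (real (Suc k) powr - (1 + d)))"
    by (intro summable_comparison_test'[OF summable_mult[OF \<open>summable (\<lambda>k. real (Suc k) powr - (1 + d))\<close>, of "2 * M"], of 0])
       (simp add: norm_mult mult_right_mono del: of_nat_Suc)
  then have sm: "summable (\<lambda>k. a k * of_real (b k))" unfolding eq .
  have l: "(\<lambda>n. 2 * M / real (Suc n) + 2 * M * d) \<longlonglongrightarrow> 0 + 2 * M * d"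
    using tendsto_mult_left[OF LIMSEQ_inverse_real_of_nat, of "2 * M"]
    by (intro tendsto_add tendsto_const) (simp add: divide_inverse)
  have "norm (\<Sum>k. a k * of_real (b k)) \<le> 0 + 2 * M * d"
    by (rule LIMSEQ_le[OF tendsto_norm[OF summable_LIMSEQ[OF sm]] l]) (use part in auto)
  then show ?thesis unfolding eq by simp
qed

text \<open>At s = 1 + d the three series are bounded by 2/d, 2Md and M. Inserted into the 3-4-1
  inequality, the zero of order 4 beats the pole of order 3 and the right side is a constant times
  d. That \<psi>^2 is not principal enters through the bound \<open>M2\<close>.\<close>

lemma complex_character_series_nonzero:
  fixes \<psi> :: "nat \<Rightarrow> complex"
  assumes mult: "\<And>m n. \<psi> (m * n) = \<psi> m * \<psi> n" and one: "\<psi> 1 = 1"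
    and norm: "\<And>n. norm (\<psi> n) = 1 \<or> \<psi> n = 0"
    and M: "\<And>n. norm (\<Sum>k<n. \<psi> (Suc k)) \<le> M" and M2: "\<And>n. norm (\<Sum>k<n. \<psi> (Suc k) ^ 2) \<le> M"
  shows "\<not> (\<lambda>k. \<psi> (Suc k) / of_nat (Suc k)) sums 0"
proof
  assume zero: "(\<lambda>k. \<psi> (Suc k) / of_nat (Suc k)) sums 0"
  have M0: "M \<ge> 0" using M[of 0] by simp
  have bound: "1 \<le> 32768 * (M ^ 5 * d)" if d: "0 < d" "d \<le> 1" for d
  proof -
    define L where "L = (\<lambda>j. infsum (\<lambda>n. \<psi> n ^ j * of_real (real n powr - (1 + d))) {n. n > 0})"
    have sp: "summable (\<lambda>k. real (Suc k) powr - (1 + d))"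
      using d summable_real_powr_iff[of "- (1 + d)"] by (subst summable_Suc_iff) simp
    have nc: "norm (\<psi> n) \<le> 1" for n using norm[of n] by auto
    have sm: "summable (\<lambda>k. norm (\<psi> (Suc k) ^ j * of_real (real (Suc k) powr - (1 + d))))" for j
    proof (rule summable_comparison_test'[OF sp, of 0])
      fix n
      show "norm (norm (\<psi> (Suc n) ^ j * of_real (real (Suc n) powr - (1 + d)))) \<le> real (Suc n) powr - (1 + d)"
        using mult_right_mono[OF power_le_one[OF _ nc, of "Suc n" j], of "real (Suc n) powr - (1 + d)"]
        by (simp add: norm_mult norm_power del: of_nat_Suc)
    qed
    have L: "L j = (\<Sum>k. \<psi> (Suc k) ^ j * of_real (real (Suc k) powr - (1 + d)))" for j
      unfolding L_def by (rule infsum_pos_nat_eq_suminf[OF sm])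
    have "norm (L 0) \<le> (\<Sum>k. norm (\<psi> (Suc k) ^ 0 * of_real (real (Suc k) powr - (1 + d))))"
      unfolding L by (rule summable_norm[OF sm])
    also have "\<dots> = (\<Sum>k. real (Suc k) powr - (1 + d))" by simp
    also have "\<dots> \<le> 1 + 1 / d"
      by (rule suminf_le_const[OF sp sum_powr_le[OF d(1)]])
    also have "\<dots> \<le> 2 / d" using d by (simp add: field_simps)
    finally have L0: "norm (L 0) \<le> 2 / d" .
    have L1: "norm (L 1) \<le> 2 * M * d"
      unfolding L using dirichlet_series_near_zero[OF M d(1) zero] by simp
    have "norm (L 2) \<le> M * real (Suc 0) powr - (1 + d)"
      unfolding L
    proof (rule norm_suminf_mult_antimono_le[of "\<lambda>k. \<psi> (Suc k) ^ 2", OF M2])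
      show "real (Suc (Suc k)) powr - (1 + d) \<le> real (Suc k) powr - (1 + d)" for k
        using powr_mono2'[of "- (1 + d)" "real (Suc k)" "real (Suc (Suc k))"] d by simp
      show "(\<lambda>k. real (Suc k) powr - (1 + d)) \<longlonglongrightarrow> 0" by (rule summable_LIMSEQ_zero[OF sp])
    qed
    then have L2: "norm (L 2) \<le> M" by simp
    have "1 \<le> 2 ^ 8 * norm (L 0 ^ 3 * L 1 ^ 4 * L 2)"
      unfolding L_def by (rule three_four_one[OF mult one norm]) (use d in auto)
    also have "\<dots> \<le> 2 ^ 8 * ((2 / d) ^ 3 * (2 * M * d) ^ 4 * M)"
      unfolding norm_mult norm_power
      by (intro mult_left_mono mult_mono power_mono L0 L1 L2) (use M0 d in auto)
    \<comment> \<open>The constant is 2^8 * 2^3 * 2^4.\<close>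
    also have "\<dots> = 32768 * (M ^ 5 * d)" using d by (simp add: field_simps power_numeral_reduce)
    finally show ?thesis .
  qed
  \<comment> \<open>Small enough that 32768 M^5 d < 1; the summand 1 keeps the denominator positive
    when M = 0.\<close>
  define d where "d = 1 / (32769 * (M ^ 5 + 1))"
  have M5: "M ^ 5 \<ge> 0" using M0 by simp
  have d0: "0 < d" using M5 by (simp add: d_def add_nonneg_pos)
  have "d * (32769 * (M ^ 5 + 1)) = 1" using M5 by (simp add: d_def add_nonneg_eq_0_iff)
  then have e: "32769 * (M ^ 5 * d) + 32769 * d = 1" by (simp add: algebra_simps)
  have p: "0 \<le> M ^ 5 * d" using M5 d0 by simp
  have d1: "d \<le> 1" using e p d0 by linarith
  have "32768 * (M ^ 5 * d) < 1" using e p d0 by linarith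
  then show False using bound[OF d0 d1] by simp
qed

section \<open>Dirichlet characters modulo N and periodic functions\<close>

locale dirichlet_character =
  fixes N :: nat and \<psi> :: "nat \<Rightarrow> complex"
  assumes N_pos: "N > 0" and period: "\<psi> (m + N) = \<psi> m"
    and mult: "\<psi> (m * n) = \<psi> m * \<psi> n" and one: "\<psi> 1 = 1"
    and zero: "\<not> coprime m N \<Longrightarrow> \<psi> m = 0"

lemma periodic_add_mult:
  fixes h :: "nat \<Rightarrow> 'a"
  assumes "\<And>m. h (m + N) = h m"
  shows "h (m + k * N) = h m"
proof (induction k)
  case (Suc k)
  have "m + Suc k * N = (m + k * N) + N" by simp
  then show ?case using assms[of "m + k * N"] Suc by (simp only:)
qed simp

lemma periodic_cong:
  fixes h :: "nat \<Rightarrow> 'a"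
  assumes "\<And>m. h (m + N) = h m" and "m mod N = n mod N"
  shows "h m = h n"
proof -
  have "h m = h (m mod N)" for m
    using periodic_add_mult[of h N "m mod N" "m div N", OF assms(1)] by simp
  then show ?thesis using assms(2) by metis
qed

lemma bij_betw_mult_mod:
  fixes N u :: nat
  assumes "N > 0" "coprime u N"
  shows "bij_betw (\<lambda>m. (u * m) mod N) {..<N} {..<N}"
proof -
  have "inj_on (\<lambda>m. (u * m) mod N) {..<N}"
  proof (rule inj_onI)
    fix x y assume xy: "x \<in> {..<N}" "y \<in> {..<N}" and "u * x mod N = u * y mod N"
    then have "[u * x = u * y] (mod N)" by (simp add: unique_euclidean_semiring_class.cong_def)
    then have "[x = y] (mod N)" by (rule cong_mult_lcancel_nat[OF assms(2), THEN iffD1])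
    then show "x = y" using xy by (simp add: unique_euclidean_semiring_class.cong_def)
  qed
  moreover have "(\<lambda>m. (u * m) mod N) ` {..<N} \<subseteq> {..<N}" using assms(1) by auto
  ultimately show ?thesis by (simp add: bij_betw_def endo_inj_surj)
qed

lemma sum_dilate_periodic:
  fixes h :: "nat \<Rightarrow> 'a::comm_monoid_add"
  assumes "N > 0" "coprime u N" "\<And>m. h (m + N) = h m"
  shows "(\<Sum>m<N. h (u * m)) = (\<Sum>m<N. h m)"
proof -
  have "(\<Sum>m<N. h (u * m)) = (\<Sum>m<N. h ((u * m) mod N))"
    by (intro sum.cong refl periodic_cong[of h N, OF assms(3)]) simp
  also have "\<dots> = (\<Sum>m<N. h m)" by (rule sum.reindex_bij_betw[OF bij_betw_mult_mod[OF assms(1,2)]])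
  finally show ?thesis .
qed

lemma periodic_sums_bounded:
  fixes h :: "nat \<Rightarrow> complex"
  assumes N: "N > 0" and per: "\<And>m. h (m + N) = h m" and zero: "(\<Sum>m<N. h m) = 0"
  obtains M where "\<And>n. norm (\<Sum>k<n. h (Suc k)) \<le> M"
proof -
  have full: "(\<Sum>m<N * q. h m) = 0" for q
  proof (induction q)
    case (Suc q)
    have "(\<Sum>m<N * Suc q. h m) = (\<Sum>m<N * q. h m) + (\<Sum>m=N * q..<N * q + N. h m)"
      by (simp add: lessThan_atLeast0 sum.atLeastLessThan_concat algebra_simps)
    also have "(\<Sum>m=N * q..<N * q + N. h m) = (\<Sum>m<N. h (m + q * N))"
      using sum.shift_bounds_nat_ivl[of h 0 "N * q" N] by (simp add: lessThan_atLeast0 mult.commute add.commute)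
    also have "\<dots> = 0" using periodic_add_mult[of h N, OF per] zero by simp
    finally show ?case using Suc by simp
  qed simp
  have part: "(\<Sum>m<n. h m) = (\<Sum>m<n mod N. h m)" for n
  proof -
    have "(\<Sum>m<n. h m) = (\<Sum>m<N * (n div N) + n mod N. h m)" by simp
    also have "\<dots> = (\<Sum>m<N * (n div N). h m) + (\<Sum>m=N * (n div N)..<N * (n div N) + n mod N. h m)"
      by (metis le_add1 lessThan_atLeast0 sum.atLeastLessThan_concat zero_le)
    also have "(\<Sum>m=N * (n div N)..<N * (n div N) + n mod N. h m) = (\<Sum>m<n mod N. h (m + (n div N) * N))"
      using sum.shift_bounds_nat_ivl[of h 0 "N * (n div N)" "n mod N"]
      by (simp add: lessThan_atLeast0 mult.commute add.commute)
    finally show ?thesis using full periodic_add_mult[of h N, OF per] by simp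
  qed
  have "norm (\<Sum>k<n. h (Suc k)) \<le> (\<Sum>m<N. norm (h m)) + norm (h 0)" for n
  proof -
    have "(\<Sum>k<n. h (Suc k)) = (\<Sum>m<Suc n mod N. h m) - h 0"
      using sum.lessThan_Suc_shift[of h n] part[of "Suc n"] by (simp add: algebra_simps)
    then have "norm (\<Sum>k<n. h (Suc k)) \<le> norm (\<Sum>m<Suc n mod N. h m) + norm (h 0)"
      by (simp add: norm_triangle_ineq4)
    also have "norm (\<Sum>m<Suc n mod N. h m) \<le> (\<Sum>m<Suc n mod N. norm (h m))" by (rule norm_sum)
    also have "\<dots> \<le> (\<Sum>m<N. norm (h m))"
      using N by (intro sum_mono2) (auto intro: less_le_trans[OF _ less_imp_le[OF mod_less_divisor]])
    finally show ?thesis by simp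
  qed
  then show ?thesis by (rule that)
qed

context dirichlet_character
begin

lemma power_totient: "coprime m N \<Longrightarrow> \<psi> m ^ totient N = 1"
proof -
  assume "coprime m N"
  have pow: "\<psi> (m ^ k) = \<psi> m ^ k" for k using one by (induction k) (auto simp: mult)
  have "[m ^ totient N = 1] (mod N)" using \<open>coprime m N\<close> by (rule euler_theorem)
  then have "\<psi> (m ^ totient N) = \<psi> 1"
    by (intro periodic_cong[of \<psi> N, OF period]) (simp add: unique_euclidean_semiring_class.cong_def)
  then show "\<psi> m ^ totient N = 1" using pow one by simp
qed

lemma norm_values: "norm (\<psi> m) = 1 \<or> \<psi> m = 0"
proof (cases "coprime m N")
  case True
  have "norm (\<psi> m) ^ totient N = 1" using power_totient[OF True] by (metis norm_one norm_power)
  then show ?thesis using N_pos power_eq_1_iff[of "norm (\<psi> m)" "totient N"] by (simp add: power_eq_1_iff)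
qed (use zero in auto)

lemma sum_zero:
  assumes "coprime u N" "\<psi> u \<noteq> 1"
  shows "(\<Sum>m<N. \<psi> m) = 0"
proof -
  have "\<psi> u * (\<Sum>m<N. \<psi> m) = (\<Sum>m<N. \<psi> (u * m))" by (simp add: sum_distrib_left mult)
  also have "\<dots> = (\<Sum>m<N. \<psi> m)" by (rule sum_dilate_periodic[of N u \<psi>, OF N_pos assms(1) period])
  finally show ?thesis using assms(2) by simp
qed

lemma square: "dirichlet_character N (\<lambda>m. \<psi> m ^ 2)"
  by unfold_locales (use N_pos period mult one zero in \<open>auto simp: power_mult_distrib\<close>)

text \<open>For the principal character all terms are nonnegative and the first is 1. Otherwise the
  partial sums are bounded. If \<psi>^2 is principal, the values are -1, 0, 1 and the Lambert series
  argument applies; if not, the sums of \<psi>^2 are bounded too, as the 3-4-1 argument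
  requires.\<close>

lemma series_nonzero: "\<not> (\<lambda>k. \<psi> (Suc k) / of_nat (Suc k)) sums 0"
proof (cases "\<forall>m. coprime m N \<longrightarrow> \<psi> m = 1")
  case True
  show ?thesis
  proof
    assume "(\<lambda>k. \<psi> (Suc k) / of_nat (Suc k)) sums 0"
    from sums_Re[OF this] have *: "(\<lambda>k. Re (\<psi> (Suc k)) / real (Suc k)) sums 0"
      by (simp add: Re_divide_of_nat del: of_nat_Suc)
    have "Re (\<psi> m) \<ge> 0" for m using True zero by (cases "coprime m N") auto
    then have "(\<Sum>k<1. Re (\<psi> (Suc k)) / real (Suc k)) \<le> (\<Sum>k. Re (\<psi> (Suc k)) / real (Suc k))"
      by (intro sum_le_suminf) (use * in \<open>auto simp: sums_iff\<close>)
    then show False using * one by (simp add: sums_iff)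
  qed
next
  case False
  then obtain u where u: "coprime u N" "\<psi> u \<noteq> 1" by blast
  obtain M where M: "\<And>n. norm (\<Sum>k<n. \<psi> (Suc k)) \<le> M"
    using periodic_sums_bounded[OF N_pos period sum_zero[OF u]] by blast
  show ?thesis
  proof (cases "\<forall>m. coprime m N \<longrightarrow> \<psi> m ^ 2 = 1")
    case True
    have vals: "\<psi> m \<in> {-1, 0, 1}" for m
      using True zero[of m] by (cases "coprime m N") (auto simp: power2_eq_1_iff)
    define r where "r = (\<lambda>m. Re (\<psi> m))"
    have r: "\<psi> m = of_real (r m)" for m using vals[of m] by (auto simp: r_def)
    show ?thesis
    proof
      assume "(\<lambda>k. \<psi> (Suc k) / of_nat (Suc k)) sums 0"
      from sums_Re[OF this] have *: "(\<lambda>k. r (Suc k) / real (Suc k)) sums 0"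
        by (simp add: Re_divide_of_nat r_def del: of_nat_Suc)
      have "norm (\<Sum>k<n. r (Suc k)) \<le> M" for n
        using M[of n] unfolding r by (metis norm_of_real of_real_sum real_norm_def)
      moreover have "r (m * n) = r m * r n" for m n
        using mult[of m n] unfolding r by (metis of_real_eq_iff of_real_mult)
      moreover have "r m \<in> {-1, 0, 1}" for m using vals[of m] by (auto simp: r_def)
      moreover have "r 1 = 1" using one by (simp add: r_def)
      ultimately show False using real_character_series_nonzero[of r M] * by blast
    qed
  next
    case False
    then obtain v where v: "coprime v N" "\<psi> v ^ 2 \<noteq> 1" by blast
    interpret sq: dirichlet_character N "\<lambda>m. \<psi> m ^ 2" by (rule square)
    obtain M2 where M2: "\<And>n. norm (\<Sum>k<n. \<psi> (Suc k) ^ 2) \<le> M2"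
      using periodic_sums_bounded[OF N_pos sq.period sq.sum_zero[OF v]] by blast
    have "norm (\<Sum>k<n. \<psi> (Suc k)) \<le> max M M2" for n
      using M[of n] by linarith
    moreover have "norm (\<Sum>k<n. \<psi> (Suc k) ^ 2) \<le> max M M2" for n
      using M2[of n] by linarith
    ultimately show ?thesis using complex_character_series_nonzero[OF mult one norm_values, of "max M M2"] by blast
  qed
qed

end

text \<open>Asking for all \<open>j\<close> at once makes the space stable under the dilations m ->
  d m, hence under projections built from them.\<close>

definition harmonic_null :: "(nat \<Rightarrow> complex) \<Rightarrow> bool" where
  "harmonic_null h \<longleftrightarrow> (\<forall>j. (\<lambda>k. h (j * Suc k) / of_nat (Suc k)) sums 0)"

lemma harmonic_null_dilate:
  assumes "harmonic_null h"
  shows "harmonic_null (\<lambda>m. h (d * m))"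
  unfolding harmonic_null_def
proof
  fix j
  show "(\<lambda>k. h (d * (j * Suc k)) / of_nat (Suc k)) sums 0"
    using assms[unfolded harmonic_null_def, THEN spec, of "d * j"] by (simp only: mult.assoc)
qed

lemma harmonic_null_cmult: "harmonic_null h \<Longrightarrow> harmonic_null (\<lambda>m. c * h m)"
  unfolding harmonic_null_def
  using sums_mult[where c = c and a = 0] by (fastforce simp del: of_nat_Suc)

lemma harmonic_null_sum:
  assumes "\<And>i. i \<in> I \<Longrightarrow> harmonic_null (h i)"
  shows "harmonic_null (\<lambda>m. \<Sum>i\<in>I. h i m)"
  unfolding harmonic_null_def
proof
  fix j
  have "(\<lambda>k. \<Sum>i\<in>I. h i (j * Suc k) / of_nat (Suc k)) sums (\<Sum>i\<in>I. 0)"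
    by (intro sums_sum) (use assms in \<open>auto simp: harmonic_null_def\<close>)
  then show "(\<lambda>k. (\<Sum>i\<in>I. h i (j * Suc k)) / of_nat (Suc k)) sums 0"
    by (simp add: sum_divide_distrib del: of_nat_Suc)
qed

lemma sum_root_unity_powers:
  assumes "0 < i" "i < r"
  shows "(\<Sum>t<r. exp (2 * of_real pi * \<i> * of_nat t / of_nat r) ^ i) = (0::complex)"
proof -
  define w :: complex where "w = exp (2 * of_real pi * \<i> * of_nat i / of_nat r)"
  have "r \<ge> 1" "\<not> r dvd i" using assms by (auto dest: dvd_imp_le)
  then have "w \<noteq> 1" unfolding w_def using complex_root_unity_eq_1[of r i] by simp
  have "w ^ r = 1" unfolding w_def using complex_root_unity[of r i] assms by simp
  have "exp (2 * of_real pi * \<i> * of_nat t / of_nat r) ^ i = w ^ t" for t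
    unfolding w_def by (simp add: exp_of_nat_mult[symmetric] algebra_simps)
  then have "(\<Sum>t<r. exp (2 * of_real pi * \<i> * of_nat t / of_nat r) ^ i) = (\<Sum>t<r. w ^ t)" by simp
  also have "\<dots> = 0" using geometric_sum[OF \<open>w \<noteq> 1\<close>, of r] \<open>w ^ r = 1\<close> by simp
  finally show ?thesis .
qed

text \<open>Dilation by a unit \<open>u\<close> has order dividing r = \<open>totient N\<close>, so
  \<open>g\<close> is the mean of its projections \<open>p t\<close> to the eigenspaces, indexed by
  the r-th roots of unity, and one of these does not vanish at \<open>a\<close>. Dilations commute,
  so eigenvalues obtained for earlier units survive.\<close>

lemma harmonic_null_eigenfunction:
  fixes h :: "nat \<Rightarrow> complex"
  assumes N: "N > 0" and per: "\<And>m. h (m + N) = h m" and supp: "\<And>m. \<not> coprime m N \<Longrightarrow> h m = 0"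
    and null: "harmonic_null h" and ne: "h a \<noteq> 0"
    and U: "finite U" "\<And>u. u \<in> U \<Longrightarrow> coprime u N"
  shows "\<exists>g a. (\<forall>m. g (m + N) = g m) \<and> (\<forall>m. \<not> coprime m N \<longrightarrow> g m = 0) \<and> harmonic_null g \<and>
      g a \<noteq> 0 \<and> (\<forall>u\<in>U. \<exists>l. \<forall>m. g (u * m) = l * g m)"
  using U
proof (induction U rule: finite_induct)
  case empty
  then show ?case using assms by blast
next
  case (insert u U)
  then obtain g a where g: "\<And>m. g (m + N) = g m" "\<And>m. \<not> coprime m N \<Longrightarrow> g m = 0" "harmonic_null g"
      "g a \<noteq> 0" and eig: "\<And>v. v \<in> U \<Longrightarrow> \<exists>l. \<forall>m. g (v * m) = l * g m" by (metis insert_iff)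
  have u: "coprime u N" using insert by simp
  define r where "r = totient N"
  have r0: "r > 0" using N by (simp add: r_def)
  define z where "z = (\<lambda>t. exp (2 * of_real pi * \<i> * of_nat t / of_nat r) :: complex)"
  have z: "z t ^ r = 1" "z t \<noteq> 0" for t
    unfolding z_def using complex_root_unity[of r t] r0 by auto
  define p where "p = (\<lambda>t m. \<Sum>i<r. z t ^ i * g (u ^ i * m))"
  \<comment> \<open>Summing over all r-th roots of unity kills every i except 0.\<close>
  have "(\<Sum>t<r. p t a) = (\<Sum>i<r. (\<Sum>t<r. z t ^ i) * g (u ^ i * a))"
    unfolding p_def by (subst sum.swap) (simp add: sum_distrib_right)
  also have "\<dots> = (\<Sum>i<r. if i = 0 then of_nat r * g a else 0)"
    by (intro sum.cong refl) (auto simp: sum_root_unity_powers z_def)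
  also have "\<dots> = of_nat r * g a" using r0 by simp
  finally have "(\<Sum>t<r. p t a) \<noteq> 0" using r0 g by simp
  then obtain t where t: "p t a \<noteq> 0" by (meson sum.neutral)
  have per: "p t (m + N) = p t m" for m
    unfolding p_def
    by (intro sum.cong refl arg_cong2[of _ _ _ _ "(*)"] periodic_cong[of g N, OF g(1)]) (simp add: distrib_left)
  have supp: "p t m = 0" if "\<not> coprime m N" for m
    unfolding p_def using that by (intro sum.neutral) (auto intro!: g)
  have null: "harmonic_null (p t)"
    unfolding p_def by (intro harmonic_null_sum harmonic_null_cmult harmonic_null_dilate g)
  have eigU: "\<exists>l. \<forall>m. p t (v * m) = l * p t m" if "v \<in> U" for v
  proof -
    obtain l where l: "\<And>m. g (v * m) = l * g m" using eig[OF \<open>v \<in> U\<close>] by blast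
    have "p t (v * m) = l * p t m" for m
    proof -
      have "g (u ^ i * (v * m)) = l * g (u ^ i * m)" for i
        using l[of "u ^ i * m"] by (simp add: algebra_simps)
      then show ?thesis unfolding p_def by (simp add: sum_distrib_left algebra_simps)
    qed
    then show ?thesis by blast
  qed
  have eigu: "p t (u * m) = inverse (z t) * p t m" for m
  proof -
    have per_u: "g (u ^ r * m) = g m"
    proof (rule periodic_cong[of g N, OF g(1)])
      have "[u ^ r * m = 1 * m] (mod N)" unfolding r_def by (intro cong_scalar_right euler_theorem u)
      then show "u ^ r * m mod N = m mod N" by (simp add: unique_euclidean_semiring_class.cong_def)
    qed
    have "z t * p t (u * m) = (\<Sum>i<r. z t ^ Suc i * g (u ^ Suc i * m))"
      unfolding p_def by (simp add: sum_distrib_left mult_ac)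
    also have "\<dots> = (\<Sum>i<Suc r. z t ^ i * g (u ^ i * m)) - g m"
      by (subst sum.lessThan_Suc_shift) simp
    also have "\<dots> = p t m" unfolding p_def using per_u z by simp
    finally show ?thesis using z by (simp add: field_simps)
  qed
  have "(\<forall>m. p t (m + N) = p t m) \<and> (\<forall>m. \<not> coprime m N \<longrightarrow> p t m = 0) \<and> harmonic_null (p t) \<and>
      p t a \<noteq> 0 \<and> (\<forall>v\<in>insert u U. \<exists>l. \<forall>m. p t (v * m) = l * p t m)"
    using per supp null t eigU eigu by blast
  then show ?case by blast
qed

text \<open>If m shares the factor d = gcd(m, N) > 1 with N, then the dilate by d has the smaller
  period N/d and vanishes by induction. So \<open>h\<close> lives on the units modulo N; a
  simultaneous eigenfunction of all unit dilations is a multiple of a Dirichlet character, whose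
  series at 1 would be 0.\<close>

theorem harmonic_null_periodic_zero:
  assumes "N > 0" "\<And>m. h (m + N) = h m" "harmonic_null h"
  shows "h m = 0"
  using assms
proof (induction N arbitrary: h m rule: less_induct)
  case (less N)
  have supp: "h m = 0" if "\<not> coprime m N" for m
  proof -
    define d where "d = gcd m N"
    have "d > 1" using that less.prems(1)
      by (auto simp: d_def coprime_iff_gcd_eq_1 nat_neq_iff)
    obtain m' where m': "m = d * m'" unfolding d_def by (metis dvdE gcd_dvd1)
    obtain N' where N': "N = d * N'" unfolding d_def by (metis dvdE gcd_dvd2)
    have "N' < N" "N' > 0" using N' \<open>d > 1\<close> less.prems(1) by auto
    have "h (d * m') = 0"
    proof (rule less.IH[of N' "\<lambda>m. h (d * m)"])
      show "h (d * (m + N')) = h (d * m)" for m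
        using less.prems(2)[of "d * m"] by (simp add: N' distrib_left)
    qed (use \<open>N' < N\<close> \<open>N' > 0\<close> harmonic_null_dilate less.prems in auto)
    then show ?thesis using m' by simp
  qed
  show ?case
  proof (rule ccontr)
    assume "h m \<noteq> 0"
    let ?U = "{u. u < N \<and> coprime u N}"
    have "finite ?U" "\<And>u. u \<in> ?U \<Longrightarrow> coprime u N" by auto
    from harmonic_null_eigenfunction[OF less.prems(1,2) supp less.prems(3) \<open>h m \<noteq> 0\<close> this]
    obtain g a where g: "\<And>m. g (m + N) = g m" "\<And>m. \<not> coprime m N \<Longrightarrow> g m = 0" "harmonic_null g"
      "g a \<noteq> 0" and eig: "\<And>v. v \<in> ?U \<Longrightarrow> \<exists>l. \<forall>m. g (v * m) = l * g m" by blast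
    have eig': "\<exists>l. \<forall>m. g (v * m) = l * g m" if "coprime v N" for v
    proof -
      have "v mod N \<in> ?U" using that less.prems(1) by (simp add: coprime_commute)
      then obtain l where l: "\<And>m. g ((v mod N) * m) = l * g m" using eig by blast
      have "g (v * m) = l * g m" for m
        unfolding l[symmetric] by (rule periodic_cong[of g N, OF g(1)]) (simp add: mod_mult_left_eq)
      then show ?thesis by blast
    qed
    have "coprime a N" using g(2,4) by blast
    then obtain l where "\<And>m. g (a * m) = l * g m" using eig' by blast
    \<comment> \<open>Dilation by the unit \<open>a\<close> sends the value at 1 to a multiple of
      itself, and this multiple is g(a).\<close>
    from this[of 1] have g1: "g 1 \<noteq> 0" using g(4) by auto
    define \<psi> where "\<psi> = (\<lambda>m. g m / g 1)"
    have gm: "g (v * m) = \<psi> v * g m" for v m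
    proof (cases "coprime v N")
      case True
      then obtain l where l: "\<And>m. g (v * m) = l * g m" using eig' by blast
      from l[of 1] have "l = \<psi> v" using g1 by (simp add: \<psi>_def)
      then show ?thesis using l by simp
    next
      case False
      then show ?thesis using g(2)[of v] g(2)[of "v * m"] by (simp add: \<psi>_def)
    qed
    have "dirichlet_character N \<psi>"
      by unfold_locales (use less.prems(1) g g1 gm in \<open>auto simp: \<psi>_def\<close>)
    then have "\<not> (\<lambda>k. \<psi> (Suc k) / of_nat (Suc k)) sums 0" by (rule dirichlet_character.series_nonzero)
    moreover have "harmonic_null \<psi>"
      using harmonic_null_cmult[OF g(3), of "1 / g 1"] by (simp add: \<psi>_def)
    ultimately show False unfolding harmonic_null_def by (auto dest: spec[of _ 1])
  qed
qed

section \<open>Characters of odd order\<close>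

abbreviation imul :: "int \<Rightarrow> 'a::ab_group_add \<Rightarrow> 'a" (infixr "\<odot>" 75)
  where "k \<odot> g \<equiv> g [^]\<^bsub>add_grp\<^esub> k"

lemma add_grp_simps [simp]:
  "carrier add_grp = UNIV" "x \<otimes>\<^bsub>add_grp\<^esub> y = x + y" "\<one>\<^bsub>add_grp\<^esub> = 0"
  by (simp_all add: add_grp_def)

lemma comm_group_add_grp: "comm_group (add_grp :: 'a::ab_group_add monoid)"
proof (rule comm_groupI)
  fix x :: 'a
  show "\<exists>y\<in>carrier add_grp. y \<otimes>\<^bsub>add_grp\<^esub> x = \<one>\<^bsub>add_grp\<^esub>"
    by (auto intro: exI[of _ "- x"])
qed (auto simp: algebra_simps)

lemma group_add_grp: "group (add_grp :: 'a::ab_group_add monoid)"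
  using comm_group_add_grp by (rule comm_group.axioms)

lemma inv_add_grp [simp]: "inv\<^bsub>add_grp\<^esub> x = - (x :: 'a::ab_group_add)"
  using group.inv_equality[OF group_add_grp, of "- x" x] by simp

lemma imul_1_left [simp]: "(1::int) \<odot> g = (g :: 'a::ab_group_add)"
  using group.int_pow_1[OF group_add_grp, where x = g] by simp

lemma imul_add_left: "(j + k) \<odot> g = j \<odot> g + k \<odot> (g :: 'a::ab_group_add)"
  using group.int_pow_mult[OF group_add_grp, where x = g] by simp

lemma imul_minus_left: "(- k) \<odot> g = - (k \<odot> (g :: 'a::ab_group_add))"
  using group.int_pow_neg[OF group_add_grp, where x = g] by simp

lemma imul_diff_left: "(j - k) \<odot> g = j \<odot> g - k \<odot> (g :: 'a::ab_group_add)"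
  using imul_add_left[of g j "- k"] by (simp add: imul_minus_left)

lemma imul_imul: "j \<odot> k \<odot> g = (j * k) \<odot> (g :: 'a::ab_group_add)"
  using group.int_pow_pow[OF group_add_grp, where x = g] by (simp add: mult.commute)

lemma imul_add_right: "k \<odot> (g + h) = k \<odot> g + k \<odot> (h :: 'a::ab_group_add)"
  using comm_group.int_pow_distrib[OF comm_group_add_grp, where x = g and y = h] by simp

lemma imul_0_right [simp]: "k \<odot> (0 :: 'a::ab_group_add) = 0"
  using group.int_pow_one[OF group_add_grp, of k] by simp

lemma imul_minus_right: "k \<odot> (- g) = - (k \<odot> (g :: 'a::ab_group_add))"
  using imul_add_right[of "- g" g k] by (simp add: eq_neg_iff_add_eq_0)

lemma imul_2: "2 \<odot> g = g + (g :: 'a::ab_group_add)"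
  using imul_add_left[of g 1 1] by simp

lemma imul_Suc: "int (Suc n) \<odot> g = int n \<odot> g + (g :: 'a::ab_group_add)"
  using imul_add_left[of g "int n" 1] by (simp add: add.commute)

lemma imul_pow2_zero:
  fixes x :: "'a::ab_group_add"
  assumes no_order_two: "\<And>g::'a. g + g = 0 \<Longrightarrow> g = 0" and "(2 ^ i) \<odot> x = 0"
  shows "x = 0"
  using assms(2)
proof (induction i)
  case (Suc i)
  have "(2 ^ Suc i) \<odot> x = (2 ^ i) \<odot> x + (2 ^ i) \<odot> x" by (simp add: imul_2[symmetric] imul_imul)
  then show ?case using Suc no_order_two by metis
qed simp

lemma double_invariant_pow2:
  fixes \<nu> :: "'a::ab_group_add \<Rightarrow> 'b"
  assumes "\<And>x. \<nu> (x + x) = \<nu> x"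
  shows "\<nu> ((2 ^ i) \<odot> x) = \<nu> x"
proof (induction i)
  case (Suc i)
  have "(2 ^ Suc i) \<odot> x = (2 ^ i) \<odot> x + (2 ^ i) \<odot> x" by (simp add: imul_2[symmetric] imul_imul)
  then show ?case using Suc assms by metis
qed simp

section \<open>Roots of unity of odd order and the extension of characters\<close>

definition odd_root :: "complex \<Rightarrow> bool" where
  "odd_root z \<longleftrightarrow> (\<exists>n. odd n \<and> z ^ n = 1)"

lemma odd_root_1 [simp]: "odd_root 1"
  unfolding odd_root_def by (rule exI[of _ 1]) simp

lemma odd_root_mult:
  assumes "odd_root z" "odd_root w"
  shows "odd_root (z * w)"
proof -
  obtain m n where mn: "odd m" "z ^ m = 1" "odd n" "w ^ n = 1" using assms by (auto simp: odd_root_def)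
  have "(z * w) ^ (m * n) = (z ^ m) ^ n * (w ^ n) ^ m"
    by (simp add: power_mult_distrib power_mult[symmetric] mult.commute)
  then have "(z * w) ^ (m * n) = 1" using mn by simp
  then show ?thesis unfolding odd_root_def using mn by (intro exI[of _ "m * n"]) simp
qed

lemma odd_root_inverse: "odd_root z \<Longrightarrow> odd_root (inverse z)"
  unfolding odd_root_def by (auto simp: power_inverse)

lemma odd_root_power: "odd_root z \<Longrightarrow> odd_root (z ^ k)"
  by (induction k) (auto intro: odd_root_mult)

lemma odd_root_powi: "odd_root z \<Longrightarrow> odd_root (z powi k)"
  by (cases k rule: int_cases2) (auto simp: power_int_minus intro: odd_root_power odd_root_inverse)

lemma odd_root_norm: "odd_root z \<Longrightarrow> norm z = 1"
proof -
  assume "odd_root z"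
  then obtain n where "odd n" "z ^ n = 1" by (auto simp: odd_root_def)
  then show ?thesis using power_eq_1_iff[of z n] by (auto dest: odd_pos)
qed

lemma odd_root_nonzero: "odd_root z \<Longrightarrow> z \<noteq> 0"
  using odd_root_norm by force

text \<open>Divisibility of the group of values. For odd k any complex k-th root has odd order
  again. A factor 2 is removed by the square root w^((n+1)/2) of an element w with w^n = 1, n
  odd.\<close>

lemma odd_root_exists_root:
  assumes "odd_root z" "k > 0"
  shows "\<exists>w. odd_root w \<and> w ^ k = z"
  using assms
proof (induction k arbitrary: z rule: less_induct)
  case (less k)
  show ?case
  proof (cases "odd k")
    case True
    obtain n where n: "odd n" "z ^ n = 1" using less.prems by (auto simp: odd_root_def)
    obtain w where w: "z = w ^ k" using exists_complex_root[of k z] less.prems by auto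
    then have "w ^ (k * n) = 1" using n by (simp add: power_mult)
    then have "odd_root w" unfolding odd_root_def using True n by (intro exI[of _ "k * n"]) simp
    then show ?thesis using w by blast
  next
    case False
    then obtain j where j: "k = 2 * j" by (auto elim: evenE)
    then obtain w where w: "odd_root w" "w ^ j = z" using less by (metis less.IH mult_2 less_add_same_cancel1 nat_0_less_mult_iff)
    obtain n where n: "odd n" "w ^ n = 1" using w by (auto simp: odd_root_def)
    obtain i where i: "n + 1 = 2 * i" using n by (metis evenE odd_even_add odd_one)
    have "(w ^ i) ^ k = (w ^ (n + 1)) ^ j" unfolding i j by (simp add: power_mult[symmetric] mult_ac)
    also have "\<dots> = z" using n w by (simp add: power_add)
    finally show ?thesis using odd_root_power[OF w(1)] by blast
  qed
qed

definition odd_char :: "('a::ab_group_add \<Rightarrow> complex) \<Rightarrow> bool" where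
  "odd_char \<psi> \<longleftrightarrow> (\<forall>x y. \<psi> (x + y) = \<psi> x * \<psi> y) \<and> (\<forall>x. odd_root (\<psi> x))"

text \<open>Graphs of characters defined on a subgroup.\<close>

definition partial_char :: "('a::ab_group_add \<times> complex) set \<Rightarrow> bool" where
  "partial_char R \<longleftrightarrow> (0, 1) \<in> R \<and> (\<forall>a z. (a, z) \<in> R \<longrightarrow> odd_root z \<and> (- a, inverse z) \<in> R) \<and>
    (\<forall>a z b w. (a, z) \<in> R \<longrightarrow> (b, w) \<in> R \<longrightarrow> (a + b, z * w) \<in> R) \<and> (\<forall>z. (0, z) \<in> R \<longrightarrow> z = 1)"

lemma partial_charD:
  assumes "partial_char R"
  shows "(0, 1) \<in> R" "\<And>a z. (a, z) \<in> R \<Longrightarrow> odd_root z" "\<And>a z. (a, z) \<in> R \<Longrightarrow> (- a, inverse z) \<in> R"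
    "\<And>a z b w. (a, z) \<in> R \<Longrightarrow> (b, w) \<in> R \<Longrightarrow> (a + b, z * w) \<in> R" "\<And>z. (0, z) \<in> R \<Longrightarrow> z = 1"
  using assms unfolding partial_char_def by blast+

lemma partial_char_unique:
  assumes R: "partial_char R" and "(a, z) \<in> R" "(a, w) \<in> R"
  shows "z = w"
proof -
  have "(a + - a, z * inverse w) \<in> R"
    using partial_charD(4)[OF R assms(2) partial_charD(3)[OF R assms(3)]] .
  then have "z * inverse w = 1" using partial_charD(5)[OF R] by simp
  then show ?thesis using odd_root_nonzero[OF partial_charD(2)[OF R assms(3)]] by (simp add: field_simps)
qed

lemma partial_char_imul:
  assumes R: "partial_char R" and a: "(a, z) \<in> R"
  shows "(k \<odot> a, z powi k) \<in> R"
proof -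
  have nat: "(int n \<odot> a, z ^ n) \<in> R" for n
  proof (induction n)
    case (Suc n)
    from partial_charD(4)[OF R this a] show ?case unfolding imul_Suc by (simp add: mult.commute)
  qed (use partial_charD(1)[OF R] in simp)
  show ?thesis
  proof (cases k rule: int_cases2)
    case (nonneg n) then show ?thesis using nat by simp
  next
    case (nonpos n)
    then show ?thesis using partial_charD(3)[OF R nat[of n]] by (simp add: imul_minus_left power_int_minus)
  qed
qed

text \<open>\<open>compat\<close> says that \<open>w\<close> agrees with the values already fixed at
  those multiples of \<open>g\<close> that lie in the domain; this keeps the value at 0
  unique.\<close>

lemma partial_char_adjoin:
  assumes R: "partial_char R" and w: "odd_root w"
    and compat: "\<And>k c. (k \<odot> g, c) \<in> R \<Longrightarrow> c = w powi k"
  shows "partial_char {(a + k \<odot> g, z * w powi k) | a z k. (a, z) \<in> R}" (is "partial_char ?R")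
proof -
  note D = partial_charD[OF R]
  have w0: "w \<noteq> 0" using odd_root_nonzero[OF w] .
  show ?thesis unfolding partial_char_def
  proof (intro conjI allI impI)
    show "(0, 1) \<in> ?R" using D(1) by (force intro!: exI[of _ "0::int"])
    fix b c assume bc: "(b, c) \<in> ?R"
    then obtain a z k where a: "(a, z) \<in> R" "b = a + k \<odot> g" "c = z * w powi k" by blast
    show "odd_root c" unfolding a using D(2)[OF a(1)] w by (intro odd_root_mult odd_root_powi)
    have "- b = - a + (- k) \<odot> g" "inverse c = inverse z * w powi (- k)"
      using a by (simp_all add: imul_minus_left power_int_minus)
    then show "(- b, inverse c) \<in> ?R" using D(3)[OF a(1)] by blast
    fix b' c' assume "(b', c') \<in> ?R"
    then obtain a' z' k' where a': "(a', z') \<in> R" "b' = a' + k' \<odot> g" "c' = z' * w powi k'" by blast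
    have "b + b' = (a + a') + (k + k') \<odot> g" "c * c' = (z * z') * w powi (k + k')"
      using a a' w0 by (simp_all add: imul_add_left power_int_add)
    then show "(b + b', c * c') \<in> ?R" using D(4)[OF a(1) a'(1)] by blast
  next
    fix c assume "(0, c) \<in> ?R"
    then obtain a z k where a: "(a, z) \<in> R" "0 = a + k \<odot> g" "c = z * w powi k" by blast
    then have "k \<odot> g = - a" by (simp add: eq_neg_iff_add_eq_0 add.commute)
    then have "inverse z = w powi k" using compat[of k "inverse z"] D(3)[OF a(1)] by simp
    then show "c = 1" using a odd_root_nonzero[OF D(2)[OF a(1)]] by (simp add: field_simps)
  qed
qed

text \<open>If n g is the least positive multiple of g in the domain, all others there are multiples
  of n g, so an n-th root of its value will do. If there is none, the choice is free.\<close>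

lemma partial_char_root_exists:
  assumes R: "partial_char R"
  shows "\<exists>w. odd_root w \<and> (\<forall>k c. (k \<odot> g, c) \<in> R \<longrightarrow> c = w powi k)"
proof (cases "\<exists>n c. n > 0 \<and> (int n \<odot> g, c) \<in> R")
  case False
  have "k = 0" if "(k \<odot> g, c) \<in> R" for k c
  proof (cases k rule: int_cases2)
    case (nonneg n) then show ?thesis using False that by auto
  next
    case (nonpos n)
    then have "(int n \<odot> g, inverse c) \<in> R" using partial_charD(3)[OF R that] by (simp add: imul_minus_left)
    then show ?thesis using False nonpos by auto
  qed
  then have "\<forall>k c. (k \<odot> g, c) \<in> R \<longrightarrow> c = 1 powi k" using partial_charD(5)[OF R] by fastforce
  then show ?thesis by (intro exI[of _ 1]) simp
next
  case True
  define n where "n = (LEAST n. n > 0 \<and> (\<exists>c. (int n \<odot> g, c) \<in> R))"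
  have "n > 0 \<and> (\<exists>c. (int n \<odot> g, c) \<in> R)" unfolding n_def by (rule LeastI_ex) (use True in blast)
  then obtain c where n: "n > 0" "(int n \<odot> g, c) \<in> R" by blast
  have least: "\<not> (m > 0 \<and> (\<exists>c. (int m \<odot> g, c) \<in> R))" if "m < n" for m
    using not_less_Least[OF that[unfolded n_def]] .
  obtain w where w: "odd_root w" "w ^ n = c" using odd_root_exists_root[OF partial_charD(2)[OF R n(2)] n(1)] by blast
  have "d = w powi k" if kd: "(k \<odot> g, d) \<in> R" for k d
  proof -
    define q r where "q = k div int n" and "r = k mod int n"
    have k: "k = q * int n + r" by (simp add: q_def r_def)
    have r: "0 \<le> r" "r < int n" using n by (simp_all add: r_def)
    have qn: "((q * int n) \<odot> g, c powi q) \<in> R" using partial_char_imul[OF R n(2), of q] by (simp add: imul_imul)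
    have "(k \<odot> g + - ((q * int n) \<odot> g), d * inverse (c powi q)) \<in> R"
      by (rule partial_charD(4)[OF R kd partial_charD(3)[OF R qn]])
    then have "(int (nat r) \<odot> g, d * inverse (c powi q)) \<in> R" using r by (simp add: k imul_add_left)
    then have "nat r = 0" using least[of "nat r"] r by force
    then have "r = 0" using r by simp
    then have "((q * int n) \<odot> g, d) \<in> R" using kd k by simp
    then have "d = c powi q" using partial_char_unique[OF R _ qn] by blast
    also have "\<dots> = w powi k" unfolding w(2)[symmetric] using k \<open>r = 0\<close> by (simp add: power_int_power mult.commute)
    finally show ?thesis .
  qed
  then show ?thesis using w by blast
qed

lemma partial_char_extend:
  assumes R0: "partial_char R0"
  shows "\<exists>\<psi>. odd_char \<psi> \<and> (\<forall>a z. (a, z) \<in> R0 \<longrightarrow> \<psi> a = z)"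
proof -
  let ?A = "{R. partial_char R \<and> R0 \<subseteq> R}"
  have "\<exists>M\<in>?A. \<forall>X\<in>?A. M \<subseteq> X \<longrightarrow> X = M"
  proof (rule subset_Zorn_nonempty)
    show "?A \<noteq> {}" using R0 by blast
    fix C assume C: "C \<noteq> {}" "subset.chain ?A C"
    then have sub: "\<And>R. R \<in> C \<Longrightarrow> partial_char R \<and> R0 \<subseteq> R"
      and lin: "\<And>R S. R \<in> C \<Longrightarrow> S \<in> C \<Longrightarrow> R \<subseteq> S \<or> S \<subseteq> R"
      by (auto simp: subset_chain_def)
    have "partial_char (\<Union>C)" unfolding partial_char_def
    proof (intro conjI allI impI)
      show "(0, 1) \<in> \<Union>C" using C(1) sub partial_charD(1) by blast
      fix a z assume "(a, z) \<in> \<Union>C"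
      then obtain R where R: "R \<in> C" "(a, z) \<in> R" by blast
      show "odd_root z" using partial_charD(2) sub R by blast
      show "(- a, inverse z) \<in> \<Union>C" using partial_charD(3) sub R by blast
      fix b w assume "(b, w) \<in> \<Union>C"
      then obtain S where S: "S \<in> C" "(b, w) \<in> S" by blast
      obtain T where "T \<in> C" "(a, z) \<in> T" "(b, w) \<in> T" using lin[OF R(1) S(1)] R S by blast
      then show "(a + b, z * w) \<in> \<Union>C" using partial_charD(4) sub by blast
    next
      fix z assume "(0, z) \<in> \<Union>C" then show "z = 1" using partial_charD(5) sub by blast
    qed
    moreover have "R0 \<subseteq> \<Union>C" using C(1) sub by blast
    ultimately show "\<Union>C \<in> ?A" by blast
  qed
  then obtain M where M: "partial_char M" "R0 \<subseteq> M" and max: "\<And>X. partial_char X \<Longrightarrow> M \<subseteq> X \<Longrightarrow> X = M"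
    by (metis (mono_tags, lifting) mem_Collect_eq order_trans)
  have dom: "\<exists>z. (g, z) \<in> M" for g
  proof -
    obtain w where w: "odd_root w" "\<And>k c. (k \<odot> g, c) \<in> M \<Longrightarrow> c = w powi k"
      using partial_char_root_exists[OF M(1)] by blast
    let ?X = "{(a + k \<odot> g, z * w powi k) | a z k. (a, z) \<in> M}"
    have "M \<subseteq> ?X"
    proof
      fix p assume "p \<in> M"
      then show "p \<in> ?X" by (cases p) (force intro!: exI[of _ "0::int"])
    qed
    then have "?X = M" using max partial_char_adjoin[OF M(1) w] by blast
    moreover have "(0 + 1 \<odot> g, 1 * w powi 1) \<in> ?X" using partial_charD(1)[OF M(1)] by blast
    ultimately show ?thesis by auto
  qed
  define \<psi> where "\<psi> = (\<lambda>g. SOME z. (g, z) \<in> M)"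
  have \<psi>: "(g, \<psi> g) \<in> M" for g unfolding \<psi>_def using dom by (rule someI_ex)
  have "odd_char \<psi>" unfolding odd_char_def
  proof (intro conjI allI)
    show "odd_root (\<psi> x)" for x using partial_charD(2)[OF M(1) \<psi>] .
    show "\<psi> (x + y) = \<psi> x * \<psi> y" for x y
      using partial_char_unique[OF M(1) \<psi> partial_charD(4)[OF M(1) \<psi> \<psi>]] .
  qed
  moreover have "\<psi> a = z" if "(a, z) \<in> R0" for a z
    using partial_char_unique[OF M(1) \<psi>] that M(2) by blast
  ultimately show ?thesis by blast
qed

lemma odd_char_exists:
  fixes H :: "'a::ab_group_add set"
  assumes H: "0 \<in> H" "\<And>x y. x \<in> H \<Longrightarrow> y \<in> H \<Longrightarrow> x + y \<in> H" "\<And>x. x \<in> H \<Longrightarrow> - x \<in> H"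
    and w: "odd_root w" "\<And>k. k \<odot> s \<in> H \<Longrightarrow> w powi k = 1"
  obtains \<psi> where "odd_char \<psi>" "\<And>h. h \<in> H \<Longrightarrow> \<psi> h = 1" "\<psi> s = w"
proof -
  let ?R = "(\<lambda>h. (h, 1)) ` H"
  have R: "partial_char ?R" unfolding partial_char_def using H by auto
  have X: "partial_char {(a + k \<odot> s, z * w powi k) | a z k. (a, z) \<in> ?R}" (is "partial_char ?X")
    by (rule partial_char_adjoin[OF R w(1)]) (use w(2) in auto)
  obtain \<psi> where \<psi>: "odd_char \<psi>" "\<And>a z. (a, z) \<in> ?X \<Longrightarrow> \<psi> a = z"
    using partial_char_extend[OF X] by blast
  have "\<psi> h = 1" if "h \<in> H" for h
  proof -
    have "(h + 0 \<odot> s, 1 * w powi 0) \<in> ?X" using that by blast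
    then show ?thesis using \<psi>(2) by simp
  qed
  moreover have "(0 + 1 \<odot> s, 1 * w powi 1) \<in> ?X" using H(1) by blast
  then have "\<psi> s = w" using \<psi>(2) by simp
  ultimately show ?thesis using that \<psi>(1) by blast
qed

text \<open>Closure of \<open>H\<close> under halving makes the order n of s modulo \<open>H\<close>
  odd or infinite. So s may be sent to a primitive n-th root of unity or, in the infinite case, to
  any root of odd order other than 1; a cube root is taken.\<close>

lemma odd_char_separates:
  fixes H :: "'a::ab_group_add set"
  assumes H: "0 \<in> H" "\<And>x y. x \<in> H \<Longrightarrow> y \<in> H \<Longrightarrow> x + y \<in> H" "\<And>x. x \<in> H \<Longrightarrow> - x \<in> H"
    and pure: "\<And>x. x + x \<in> H \<Longrightarrow> x \<in> H" and s: "s \<notin> H"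
  obtains \<psi> where "odd_char \<psi>" "\<And>h. h \<in> H \<Longrightarrow> \<psi> h = 1" "\<psi> s \<noteq> 1"
proof -
  have neg: "(- k) \<odot> x \<in> H" if "k \<odot> x \<in> H" for k x using H(3)[OF that] by (simp add: imul_minus_left)
  have mulH: "int n \<odot> x \<in> H" if "x \<in> H" for n x
    by (induction n) (use H that in \<open>auto simp: imul_Suc simp del: of_nat_Suc\<close>)
  have mulHi: "k \<odot> x \<in> H" if "x \<in> H" for k x
    by (cases k rule: int_cases2) (use mulH[OF that] neg in auto)
  define root where "root = (\<lambda>n::nat. exp (2 * of_real pi * \<i> * of_nat 1 / of_nat n) :: complex)"
  have root: "root n ^ n = 1" "root n \<noteq> 1" if "n > 1" for n
    using that complex_root_unity[of n 1] complex_root_unity_eq_1[of n 1] by (auto simp: root_def)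
  have "\<exists>w. odd_root w \<and> w \<noteq> 1 \<and> (\<forall>k. k \<odot> s \<in> H \<longrightarrow> w powi k = 1)"
  proof (cases "\<exists>n>0. int n \<odot> s \<in> H")
    case True
    define n where "n = (LEAST n. n > 0 \<and> int n \<odot> s \<in> H)"
    have "n > 0 \<and> int n \<odot> s \<in> H" unfolding n_def by (rule LeastI_ex) (use True in blast)
    then have n: "n > 0" "int n \<odot> s \<in> H" by auto
    have least: "\<not> (m > 0 \<and> int m \<odot> s \<in> H)" if "m < n" for m
      using not_less_Least[OF that[unfolded n_def]] .
    have "odd n"
    proof
      assume "even n"
      then obtain m where m: "n = 2 * m" by (auto elim: evenE)
      then have "int m \<odot> s + int m \<odot> s \<in> H" using n(2) imul_2[of "int m \<odot> s"] by (simp add: imul_imul)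
      then have "int m \<odot> s \<in> H" by (rule pure)
      then show False using least[of m] m n(1) by simp
    qed
    have "n \<noteq> 1" using n(2) s by auto
    then have "n > 1" using n(1) by simp
    have "root n powi k = 1" if k: "k \<odot> s \<in> H" for k
    proof -
      define q r where "q = k div int n" and "r = k mod int n"
      have kq: "k = q * int n + r" by (simp add: q_def r_def)
      have r: "0 \<le> r" "r < int n" using n by (simp_all add: r_def)
      have "k \<odot> s + (- q) \<odot> int n \<odot> s \<in> H" by (intro H(2) k mulHi n)
      then have "int (nat r) \<odot> s \<in> H" using r by (simp add: imul_imul kq imul_add_left imul_minus_left)
      then have "r = 0" using least[of "nat r"] r by force
      then have "root n powi k = (root n ^ n) powi q" using kq by (simp add: power_int_power mult.commute)
      then show ?thesis using root[OF \<open>n > 1\<close>] by simp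
    qed
    moreover have "odd_root (root n)" unfolding odd_root_def using \<open>odd n\<close> root[OF \<open>n > 1\<close>] by blast
    ultimately show ?thesis using root[OF \<open>n > 1\<close>] by blast
  next
    case False
    have "k = 0" if "k \<odot> s \<in> H" for k
      using that neg[OF that] False by (cases k rule: int_cases2) auto
    moreover have "odd_root (root 3)" unfolding odd_root_def using root[of 3] by (intro exI[of _ 3]) simp
    ultimately show ?thesis using root[of 3] by (intro exI[of _ "root 3"]) force
  qed
  then obtain w where w: "odd_root w" "w \<noteq> 1" "\<And>k. k \<odot> s \<in> H \<Longrightarrow> w powi k = 1" by blast
  show ?thesis using odd_char_exists[OF H w(1,3)] that w(2) by metis
qed

lemma odd_charD:
  assumes "odd_char \<psi>"
  shows "\<psi> (x + y) = \<psi> x * \<psi> y" "odd_root (\<psi> x)"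
  using assms by (auto simp: odd_char_def)

lemma odd_char_0: "odd_char \<psi> \<Longrightarrow> \<psi> 0 = 1"
  using odd_charD(1)[of \<psi> 0 0] odd_root_nonzero[OF odd_charD(2), of \<psi> 0] by simp

lemma odd_char_minus: "odd_char \<psi> \<Longrightarrow> \<psi> (- x) = cnj (\<psi> x)"
proof -
  assume c: "odd_char \<psi>"
  have "\<psi> (- x) * \<psi> x = 1" using odd_charD(1)[OF c, of "- x" x] odd_char_0[OF c] by simp
  moreover have "cnj (\<psi> x) * \<psi> x = 1"
    using odd_root_norm[OF odd_charD(2)[OF c, of x]] by (simp add: complex_norm_square[symmetric] mult.commute)
  ultimately show ?thesis using odd_root_nonzero[OF odd_charD(2)[OF c, of x]] by (metis mult_right_cancel)
qed

lemma odd_char_one: "odd_char (\<lambda>_. 1)" by (simp add: odd_char_def)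

lemma odd_char_mult: "odd_char \<psi> \<Longrightarrow> odd_char \<phi> \<Longrightarrow> odd_char (\<lambda>x. \<psi> x * \<phi> x)"
  by (auto simp: odd_char_def odd_root_mult)

lemma odd_char_power: "odd_char \<psi> \<Longrightarrow> odd_char (\<lambda>x. \<psi> x ^ k)"
  by (auto simp: odd_char_def odd_root_power power_mult_distrib)

section \<open>Necessity of the linear conditions\<close>

lemma finite_copies: "finite (copies A)"
proof -
  have "copies A \<subseteq> set_mset A \<times> {..<size A}"
    unfolding copies_def using count_le_size[of A] by (auto simp: count_inI intro: less_le_trans)
  then show ?thesis by (rule finite_subset) simp
qed

lemma FS_empty: "FS {#} = {#0#}"
  by (simp add: FS_def copies_def)

text \<open>The copies of the larger multiset have the one new member (a, count A a); sets of copies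
  are split by whether they contain it. Further computations of \<open>FS\<close> rest on this
  recursion.\<close>

lemma FS_add_mset: "FS (add_mset a A) = FS A + translate (FS A) a"
proof -
  define p where "p = (a, count A a)"
  let ?f = "\<lambda>S. \<Sum>p\<in>S. fst p"
  have c: "copies (add_mset a A) = insert p (copies A)" by (auto simp: copies_def p_def less_Suc_eq split: if_splits)
  have p: "p \<notin> copies A" by (simp add: copies_def p_def)
  have fin: "finite (Pow (copies A))" by (simp add: finite_copies)
  have inj: "inj_on (insert p) (Pow (copies A))" using p by (auto simp: inj_on_def)
  have "FS (add_mset a A) = image_mset ?f (mset_set (Pow (copies A) \<union> insert p ` Pow (copies A)))"
    unfolding FS_def c Pow_insert ..
  also have "mset_set (Pow (copies A) \<union> insert p ` Pow (copies A)) = mset_set (Pow (copies A)) + mset_set (insert p ` Pow (copies A))"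
    by (rule mset_set_Union) (use fin p in auto)
  also have "image_mset ?f \<dots> = FS A + image_mset ?f (mset_set (insert p ` Pow (copies A)))"
    by (simp add: FS_def)
  also have "image_mset ?f (mset_set (insert p ` Pow (copies A))) = image_mset (\<lambda>S. ?f (insert p S)) (mset_set (Pow (copies A)))"
    by (simp add: image_mset_mset_set[OF inj, symmetric] multiset.map_comp o_def)
  also have "\<dots> = translate (FS A) a"
    unfolding FS_def translate_def multiset.map_comp o_def
  proof (rule image_mset_cong)
    fix S assume "S \<in># mset_set (Pow (copies A))"
    then have "S \<subseteq> copies A" using fin by simp
    then have "finite S" using finite_copies finite_subset by blast
    moreover have "p \<notin> S" using \<open>S \<subseteq> copies A\<close> p by blast
    ultimately show "?f (insert p S) = ?f S + a" by (simp add: p_def add.commute)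
  qed
  finally show ?thesis .
qed

lemma sum_FS_char:
  assumes "odd_char \<psi>"
  shows "(\<Sum>x\<in>#FS A. \<psi> x) = (\<Prod>a\<in>#A. 1 + \<psi> a)"
proof (induction A)
  case (add a A)
  have "(\<Sum>x\<in>#translate (FS A) a. \<psi> x) = \<psi> a * (\<Sum>x\<in>#FS A. \<psi> x)"
    using odd_charD(1)[OF assms] by (simp add: translate_def multiset.map_comp o_def mult.commute sum_mset_distrib_left)
  then show ?case using add by (simp add: FS_add_mset distrib_right)
qed (simp add: FS_empty odd_char_0[OF assms])

lemma odd_root_one_plus: "odd_root z \<Longrightarrow> 1 + z \<noteq> 0"
proof
  assume "odd_root z" "1 + z = 0"
  then obtain n where "odd n" "z ^ n = 1" by (auto simp: odd_root_def)
  moreover have "z = - 1" using \<open>1 + z = 0\<close> by (simp add: eq_neg_iff_add_eq_0 add.commute)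
  ultimately show False by (simp add: power_minus_odd)
qed

lemma odd_root_square_eq_1: "odd_root z \<Longrightarrow> z ^ 2 = 1 \<Longrightarrow> z = 1"
  using odd_root_one_plus[of z] by (auto simp: power2_eq_1_iff)

lemma ln_norm_prod_mset:
  assumes "\<And>a. f a \<noteq> (0::complex)"
  shows "ln (norm (\<Prod>a\<in>#A. f a)) = (\<Sum>a\<in>#A. ln (norm (f a)))"
  by (induction A) (use assms in \<open>auto simp: norm_mult ln_mult prod_mset_zero_iff\<close>)

lemma sum_mset_eq_sum_count:
  fixes f :: "'a \<Rightarrow> real"
  assumes "finite S" "set_mset A \<subseteq> S"
  shows "(\<Sum>a\<in>#A. f a) = (\<Sum>x\<in>S. real (count A x) * f x)"
  using assms(2)
proof (induction A)
  case (add a A)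
  then have "(\<Sum>x\<in>S. real (count (add_mset a A) x) * f x) = (\<Sum>x\<in>S. real (count A x) * f x + (if x = a then f x else 0))"
    by (intro sum.cong) (auto simp: algebra_simps)
  also have "\<dots> = (\<Sum>x\<in>S. real (count A x) * f x) + f a"
    using add.prems assms(1) by (simp add: sum.distrib)
  finally show ?case using add by simp
qed simp

text \<open>The character sum over FS(A) is the product of all 1 + \<psi>(a). The translation
  contributes the factor \<psi>(s), which has norm 1 and disappears.\<close>

lemma FS_translate_log:
  assumes FS: "FS A = translate (FS B) s" and \<psi>: "odd_char \<psi>" and S: "finite S" "set_mset A \<subseteq> S" "set_mset B \<subseteq> S"
  shows "(\<Sum>x\<in>S. of_int (int (count A x) - int (count B x)) * ln (norm (1 + \<psi> x))) = 0"
proof -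
  have "(\<Prod>a\<in>#A. 1 + \<psi> a) = (\<Sum>x\<in>#translate (FS B) s. \<psi> x)"
    unfolding sum_FS_char[OF \<psi>, symmetric] FS ..
  also have "\<dots> = \<psi> s * (\<Prod>a\<in>#B. 1 + \<psi> a)"
    unfolding sum_FS_char[OF \<psi>, symmetric] using odd_charD(1)[OF \<psi>]
    by (simp add: translate_def multiset.map_comp o_def sum_mset_distrib_left mult.commute)
  finally have "norm (\<Prod>a\<in>#A. 1 + \<psi> a) = norm (\<Prod>a\<in>#B. 1 + \<psi> a)"
    using odd_root_norm[OF odd_charD(2)[OF \<psi>]] by (simp add: norm_mult)
  then have "(\<Sum>a\<in>#A. ln (norm (1 + \<psi> a))) = (\<Sum>a\<in>#B. ln (norm (1 + \<psi> a)))"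
    using ln_norm_prod_mset[of "\<lambda>a. 1 + \<psi> a"] odd_root_one_plus[OF odd_charD(2)[OF \<psi>]] by metis
  then show ?thesis
    by (simp add: sum_mset_eq_sum_count[OF S(1,2)] sum_mset_eq_sum_count[OF S(1,3)] sum_subtractf left_diff_distrib)
qed

text \<open>Moebius inversion in the form of an induction: the j with gcd(j, N) = d correspond to
  the units modulo N/d, so for d > 1 their sum vanishes by induction, and what remains of the full
  sum is the class d = 1.\<close>

lemma coprime_sum_zero:
  fixes F :: "nat \<Rightarrow> 'b::comm_monoid_add"
  assumes "N > 0" "\<And>d. d dvd N \<Longrightarrow> (\<Sum>j<N div d. F (d * j)) = 0"
  shows "(\<Sum>j | j < N \<and> coprime j N. F j) = 0"
  using assms
proof (induction N arbitrary: F rule: less_induct)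
  case (less N)
  let ?D = "{d. d dvd N}"
  have fin: "finite ?D" using less.prems(1) by simp
  have part: "(\<Sum>j | j < N \<and> gcd j N = d. F j) = (\<Sum>i | i < N div d \<and> coprime i (N div d). F (d * i))" if d: "d dvd N" for d
  proof (rule sum.reindex_bij_witness[where i = "\<lambda>i. d * i" and j = "\<lambda>j. j div d"])
    obtain M where M: "N = d * M" using d by auto
    have pos: "d > 0" "M > 0" using less.prems(1) M by auto
    fix j assume j: "j \<in> {j. j < N \<and> gcd j N = d}"
    then have dj: "d dvd j" by auto
    then obtain i where i: "j = d * i" by auto
    show "d * (j div d) = j" using dj by simp
    have "gcd (d * i) (d * M) = d * gcd i M" by (simp add: gcd_mult_distrib_nat)
    then have "gcd i M = 1" using j i M pos by simp
    then show "j div d \<in> {i. i < N div d \<and> coprime i (N div d)}"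
      using i M pos j by (simp add: coprime_iff_gcd_eq_1)
    show "F (d * (j div d)) = F j" using dj by simp
  next
    obtain M where M: "N = d * M" using d by auto
    have pos: "d > 0" "M > 0" using less.prems(1) M by auto
    fix i assume i: "i \<in> {i. i < N div d \<and> coprime i (N div d)}"
    then have "gcd (d * i) (d * M) = d" using M pos by (simp add: gcd_mult_distrib_nat[symmetric] coprime_iff_gcd_eq_1)
    then show "d * i \<in> {j. j < N \<and> gcd j N = d}" using i M pos by simp
    show "d * i div d = i" using pos by simp
  qed
  have zero: "(\<Sum>j | j < N \<and> gcd j N = d. F j) = 0" if d: "d dvd N" "d \<noteq> 1" for d
  proof -
    obtain M where M: "N = d * M" using d by auto
    have pos: "d > 0" "M > 0" using less.prems(1) M by auto
    have "(\<Sum>i | i < M \<and> coprime i M. F (d * i)) = 0"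
    proof (rule less.IH)
      show "M < N" using M pos d(2) by simp
      fix e assume e: "e dvd M"
      then have "d * e dvd N" unfolding M by simp
      from less.prems(2)[OF this] have "(\<Sum>j<N div (d * e). F (d * e * j)) = 0" .
      then show "(\<Sum>j<M div e. F (d * (e * j))) = 0" using M pos by (simp add: div_mult2_eq mult.assoc)
    qed (rule pos)
    then show ?thesis using part[OF d(1)] M pos by simp
  qed
  have "0 = (\<Sum>j<N. F j)" using less.prems(2)[of 1] by simp
  also have "\<dots> = (\<Sum>d\<in>?D. \<Sum>j | j \<in> {..<N} \<and> gcd j N = d. F j)"
    by (rule sum.group[symmetric, unfolded]) (use fin in auto)
  also have "\<dots> = (\<Sum>d\<in>?D. if d = 1 then (\<Sum>j | j < N \<and> coprime j N. F j) else 0)"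
    by (intro sum.cong refl) (use zero in \<open>auto simp: coprime_iff_gcd_eq_1\<close>)
  also have "\<dots> = (\<Sum>j | j < N \<and> coprime j N. F j)" using fin by simp
  finally show ?case by simp
qed

lemma root_unity_coprime_power:
  fixes z :: complex
  assumes "z ^ N = 1" "coprime j N" "z ^ j = 1"
  shows "z = 1"
proof (cases "j = 0")
  case True then show ?thesis using assms by simp
next
  case False
  obtain a b where "j * a = N * b + 1" using bezout_nat[OF False, of N] assms(2)
    by (auto simp: coprime_iff_gcd_eq_1)
  then have "(z ^ j) ^ a = (z ^ N) ^ b * z" by (simp add: power_mult[symmetric] power_add)
  then show ?thesis using assms by simp
qed

text \<open>Since 1 + z^j = (1 - z^(2j)) / (1 - z^j), the sum is a difference of two sums of
  \<open>g\<close> over the units, related by the permutation j -> 2j. Here z need not be primitive: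
  its powers with exponent prime to N are still different from 1.\<close>

lemma sum_ln_one_plus_root:
  fixes z :: complex
  assumes N: "odd N" "z ^ N = 1" "z \<noteq> 1"
  shows "(\<Sum>j | j < N \<and> coprime j N. ln (norm (1 + z ^ j))) = 0"
proof -
  \<comment> \<open>Extended by 0 to nonunits, so that sums over units become sums of a periodic
    function over a full period.\<close>
  define g where "g = (\<lambda>m. if coprime m N then ln (norm (1 - z ^ m)) else 0)"
  have N0: "N > 0" using N(1) by (rule odd_pos)
  have per: "g (m + N) = g m" for m by (simp add: g_def power_add N coprime_iff_gcd_eq_1)
  have cop2: "coprime 2 N" using N(1) by simp
  have ne: "1 - z ^ j \<noteq> 0" if "coprime j N" for j using root_unity_coprime_power[OF N(2) that] N(3) by auto
  have "ln (norm (1 + z ^ j)) = g (2 * j) - g j" if j: "coprime j N" for j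
  proof -
    have c: "coprime (2 * j) N" using j cop2 by simp
    have e: "1 - z ^ (2 * j) = (1 + z ^ j) * (1 - z ^ j)"
      by (simp add: mult.commute[of 2] power_mult power2_eq_square algebra_simps)
    then have "1 + z ^ j \<noteq> 0" using ne[OF c] by auto
    then show ?thesis using ne[OF j] j c by (simp add: g_def e norm_mult ln_mult)
  qed
  then have "(\<Sum>j | j < N \<and> coprime j N. ln (norm (1 + z ^ j))) = (\<Sum>j | j < N \<and> coprime j N. g (2 * j) - g j)"
    by (intro sum.cong) auto
  also have "\<dots> = (\<Sum>j<N. g (2 * j) - g j)"
    using cop2 by (intro sum.mono_neutral_left) (auto simp: g_def)
  also have "\<dots> = 0" using sum_dilate_periodic[of N 2 g, OF N0 cop2 per] by (simp add: sum_subtractf)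
  finally show ?thesis .
qed

lemma odd_char_common_exponent:
  assumes "finite X" "\<And>z. z \<in> X \<Longrightarrow> odd_root z"
  shows "\<exists>N. odd N \<and> (\<forall>z\<in>X. z ^ N = 1)"
  using assms
proof (induction X rule: finite_induct)
  case (insert z X)
  then obtain N where N: "odd N" "\<And>w. w \<in> X \<Longrightarrow> w ^ N = 1" by auto
  obtain n where n: "odd n" "z ^ n = 1" using insert by (auto simp: odd_root_def)
  show ?case
    by (intro exI[of _ "N * n"]) (use N n in \<open>auto simp: power_mult mult.commute[of N n]\<close>, metis N(2) mult.commute power_mult power_one)
qed (auto intro: exI[of _ 1])

text \<open>All 2^i g lie in the finite support, so 2^i g = 2^j g for some i < j. As there is no
  2-torsion, the factor 2^i can be cancelled and 2^(j-i) - 1 annihilates g.\<close>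

lemma double_invariant_torsion:
  fixes \<nu> :: "'a::ab_group_add \<Rightarrow> int"
  assumes no_order_two: "\<And>g::'a. g + g = 0 \<Longrightarrow> g = 0"
    and fin: "finite {x. \<nu> x \<noteq> 0}" and nu_double: "\<And>x. \<nu> (x + x) = \<nu> x" and "\<nu> g \<noteq> 0"
  shows "\<exists>k. odd k \<and> int k \<odot> g = 0"
proof -
  have "\<nu> ((2 ^ i) \<odot> g) = \<nu> g" for i :: nat
    using nu_double by (rule double_invariant_pow2)
  then have "range (\<lambda>i::nat. (2 ^ i) \<odot> g) \<subseteq> {x. \<nu> x \<noteq> 0}" using \<open>\<nu> g \<noteq> 0\<close> by auto
  then have "finite (range (\<lambda>i::nat. (2 ^ i) \<odot> g))" using fin finite_subset by blast
  then have "\<not> inj (\<lambda>i::nat. (2 ^ i) \<odot> g)" using finite_imageD infinite_UNIV_nat by blast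
  then obtain i j :: nat where ij: "(2 ^ i) \<odot> g = (2 ^ j) \<odot> g" "i < j"
    unfolding inj_def by (metis linorder_neqE_nat)
  define m where "m = j - i"
  have j: "j = i + m" "m > 0" using ij by (auto simp: m_def)
  have "(2 ^ i) \<odot> (2 ^ m - 1) \<odot> g = 0"
  proof -
    have e: "(2::int) ^ i * (2 ^ m - 1) = 2 ^ j - 2 ^ i" by (simp add: j power_add right_diff_distrib)
    have "(2 ^ i) \<odot> (2 ^ m - 1) \<odot> g = (2 ^ j - 2 ^ i) \<odot> g" unfolding imul_imul e ..
    also have "\<dots> = (2 ^ j) \<odot> g - (2 ^ i) \<odot> g" by (rule imul_diff_left)
    finally show ?thesis using ij(1) by simp
  qed
  then have "(2 ^ m - 1) \<odot> g = 0" by (rule imul_pow2_zero[rotated]) (erule no_order_two)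
  moreover have "int (2 ^ m - 1) = 2 ^ m - 1" by (simp add: of_nat_diff)
  ultimately show ?thesis using j by (intro exI[of _ "2 ^ m - 1"]) simp
qed

text \<open>What the necessity argument retains of the two multisets: the logarithmic relations for
  all characters. \<open>S\<close> contains the support of \<mu> and is symmetric, so that negation
  permutes it.\<close>

locale log_null =
  fixes \<mu> :: "'a::ab_group_add \<Rightarrow> int" and S :: "'a set"
  assumes no_order_two: "\<And>g::'a. g + g = 0 \<Longrightarrow> g = 0"
    and fin: "finite S" and supp: "\<And>x. \<mu> x \<noteq> 0 \<Longrightarrow> x \<in> S" and sym: "\<And>x. x \<in> S \<Longrightarrow> - x \<in> S"
    and log: "\<And>\<psi>. odd_char \<psi> \<Longrightarrow> (\<Sum>x\<in>S. of_int (\<mu> x) * ln (norm (1 + \<psi> x))) = 0"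
begin

definition \<nu> :: "'a \<Rightarrow> int" where "\<nu> x = \<mu> x + \<mu> (- x)"

lemma ker_sum_zero:
  assumes \<psi>: "odd_char \<psi>"
  shows "(\<Sum>x | x \<in> S \<and> \<psi> x = 1. \<mu> x) = 0"
proof -
  obtain N where N: "odd N" "\<And>x. x \<in> S \<Longrightarrow> \<psi> x ^ N = 1"
    using odd_char_common_exponent[of "\<psi> ` S"] fin odd_charD(2)[OF \<psi>] by auto
  have N0: "N > 0" using N(1) by (rule odd_pos)
  let ?J = "{j. j < N \<and> coprime j N}"
  \<comment> \<open>Written with \<open>mod\<close> because for N = 1 the only member of
    \<open>?J\<close> is 0.\<close>
  have "1 mod N \<in> ?J" using N0 by (simp add: coprime_commute)
  then have J: "card ?J > 0" by (auto simp: card_gt_0_iff)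
  define c where "c = real (card ?J) * ln 2"
  define X where "X = (\<Sum>x | x \<in> S \<and> \<psi> x = 1. \<mu> x)"
  \<comment> \<open>The powers \<psi>^j are characters as well; for j prime to N they are the Galois
    conjugates of \<psi>.\<close>
  have "0 = (\<Sum>j\<in>?J. \<Sum>x\<in>S. of_int (\<mu> x) * ln (norm (1 + \<psi> x ^ j)))"
    using log[OF odd_char_power[OF \<psi>]] by simp
  also have "\<dots> = (\<Sum>x\<in>S. of_int (\<mu> x) * (\<Sum>j\<in>?J. ln (norm (1 + \<psi> x ^ j))))"
    by (subst sum.swap) (simp add: sum_distrib_left)
  also have "\<dots> = (\<Sum>x\<in>S. if \<psi> x = 1 then of_int (\<mu> x) * (real (card ?J) * ln 2) else 0)"
    using sum_ln_one_plus_root[OF N(1) N(2)] by (intro sum.cong refl) auto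
  also have "\<dots> = (\<Sum>x | x \<in> S \<and> \<psi> x = 1. of_int (\<mu> x) * (real (card ?J) * ln 2))"
    using fin by (simp add: sum.inter_filter)
  also have "\<dots> = of_int (\<Sum>x | x \<in> S \<and> \<psi> x = 1. \<mu> x) * (real (card ?J) * ln 2)"
    by (simp add: sum_distrib_right)
  also have "\<dots> = of_int X * c" by (simp only: X_def c_def)
  finally have "of_int X * c = 0" by simp
  moreover have "c > 0" unfolding c_def using J by (intro mult_pos_pos) auto
  ultimately have "X = 0" by simp
  then show ?thesis by (simp only: X_def)
qed

text \<open>The logarithmic relation expanded term by term. At points with \<psi>(x) = 1 the series
  gives 0 while the logarithm is ln 2; these points have total weight 0 by
  \<open>ker_sum_zero\<close> and may be dropped.\<close>

lemma series_sums_zero: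
  assumes \<psi>: "odd_char \<psi>"
  shows "(\<lambda>k. (\<Sum>x\<in>S. of_int (\<mu> x) * (Re (\<psi> x ^ Suc k) - Re (\<psi> x ^ (2 * Suc k)))) / real (Suc k)) sums 0"
proof -
  have one: "(\<lambda>k. (Re (z ^ Suc k) - Re (z ^ (2 * Suc k))) / real (Suc k)) sums (if z = 1 then 0 else ln (norm (1 + z)))"
    if z: "odd_root z" for z
  proof (cases "z = 1")
    case False
    have z2: "z ^ 2 \<noteq> 1" using odd_root_square_eq_1[OF z] False by blast
    have n: "norm z = 1" "norm (z ^ 2) = 1" using odd_root_norm[OF z] by (simp_all add: norm_power)
    have ser: "(\<lambda>k. Re (w ^ Suc k) / real (Suc k)) sums (- ln (norm (1 - w)))" if "norm w = 1" "w \<noteq> 1" for w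
    proof -
      from sums_Re[OF log_series_boundary[OF that]]
      have "(\<lambda>k. Re (w ^ Suc k / of_nat (Suc k))) sums (- Re (Ln (1 - w)))" by simp
      then show ?thesis using that by (simp del: of_nat_Suc power_Suc add: Re_divide_of_nat)
    qed
    have "(\<lambda>k. Re (z ^ Suc k) / real (Suc k) - Re ((z ^ 2) ^ Suc k) / real (Suc k)) sums
        (- ln (norm (1 - z)) - - ln (norm (1 - z ^ 2)))"
      by (intro sums_diff ser n z2 False)
    moreover have "- ln (norm (1 - z)) - - ln (norm (1 - z ^ 2)) = ln (norm (1 + z))"
    proof -
      have "1 - z ^ 2 = (1 + z) * (1 - z)" by (simp add: power2_eq_square algebra_simps)
      then show ?thesis using odd_root_one_plus[OF z] False by (simp add: norm_mult ln_mult)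
    qed
    ultimately show ?thesis using False by (simp only: if_False power_mult[symmetric] diff_divide_distrib)
  qed simp
  have "(\<lambda>k. \<Sum>x\<in>S. of_int (\<mu> x) * ((Re (\<psi> x ^ Suc k) - Re (\<psi> x ^ (2 * Suc k))) / real (Suc k))) sums
      (\<Sum>x\<in>S. of_int (\<mu> x) * (if \<psi> x = 1 then 0 else ln (norm (1 + \<psi> x))))"
    by (intro sums_sum sums_mult one odd_charD(2)[OF \<psi>])
  moreover have "(\<Sum>x\<in>S. of_int (\<mu> x) * (if \<psi> x = 1 then 0 else ln (norm (1 + \<psi> x)))) = 0"
  proof -
    have "(\<Sum>x\<in>S. of_int (\<mu> x) * (if \<psi> x = 1 then 0 else ln (norm (1 + \<psi> x))))
        = (\<Sum>x\<in>S. of_int (\<mu> x) * ln (norm (1 + \<psi> x)) - (if \<psi> x = 1 then of_int (\<mu> x) * ln 2 else 0))"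
      by (intro sum.cong) auto
    also have "\<dots> = - (\<Sum>x\<in>S. if \<psi> x = 1 then of_int (\<mu> x) * ln 2 else 0)"
      using log[OF \<psi>] by (simp add: sum_subtractf)
    also have "(\<Sum>x\<in>S. if \<psi> x = 1 then of_int (\<mu> x) * ln 2 else 0) = of_int (\<Sum>x | x \<in> S \<and> \<psi> x = 1. \<mu> x) * ln 2"
      using fin by (simp add: sum.inter_filter[symmetric] sum_distrib_right)
    finally show ?thesis using ker_sum_zero[OF \<psi>] by simp
  qed
  ultimately show ?thesis by (simp add: sum_divide_distrib del: of_nat_Suc power_Suc)
qed

text \<open>The dilate of \<open>h\<close> by j is the same function formed with \<psi>^j, so
  \<open>h\<close> is \<open>harmonic_null\<close> and h(1) = 0. Real parts appear because
  conjugation is \<psi>(x) -> \<psi>(-x), which turns the weights \<mu> into \<nu>.\<close>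

lemma char_sum_square:
  assumes \<psi>: "odd_char \<psi>"
  shows "(\<Sum>x\<in>S. of_int (\<nu> x) * \<psi> x) = (\<Sum>x\<in>S. of_int (\<nu> x) * \<psi> (x + x))"
proof -
  obtain N where N: "odd N" "\<And>x. x \<in> S \<Longrightarrow> \<psi> x ^ N = 1"
    using odd_char_common_exponent[of "\<psi> ` S"] fin odd_charD(2)[OF \<psi>] by auto
  define h where "h = (\<lambda>m. complex_of_real (\<Sum>x\<in>S. of_int (\<mu> x) * (Re (\<psi> x ^ m) - Re (\<psi> x ^ (2 * m)))))"
  have "h 1 = 0"
  proof (rule harmonic_null_periodic_zero)
    show "N > 0" using N(1) by (rule odd_pos)
    show "h (m + N) = h m" for m
      unfolding h_def by (intro arg_cong[of _ _ of_real] sum.cong refl)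
        (simp add: N(2) distrib_left power_add power_mult mult.commute[of 2])
    show "harmonic_null h" unfolding harmonic_null_def
    proof
      fix j
      have "(\<lambda>k. complex_of_real ((\<Sum>x\<in>S. of_int (\<mu> x) * (Re ((\<psi> x ^ j) ^ Suc k) - Re ((\<psi> x ^ j) ^ (2 * Suc k)))) / real (Suc k))) sums of_real 0"
        by (intro sums_of_real series_sums_zero odd_char_power \<psi>)
      then show "(\<lambda>k. h (j * Suc k) / of_nat (Suc k)) sums 0"
        by (simp only: h_def power_mult[symmetric] of_real_divide of_real_of_nat_eq of_real_0 mult.left_commute[of 2])
    qed
  qed
  then have eq: "(\<Sum>x\<in>S. of_int (\<mu> x) * Re (\<psi> x)) = (\<Sum>x\<in>S. of_int (\<mu> x) * Re (\<psi> x ^ 2))"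
    unfolding h_def of_real_eq_0_iff by (simp add: right_diff_distrib sum_subtractf numeral_2_eq_2)
  have bij: "bij_betw uminus S S" using sym by (intro bij_betwI[of _ _ _ uminus]) auto
  have re: "(\<Sum>x\<in>S. of_int (\<nu> x) * \<phi> x) = of_real (2 * (\<Sum>x\<in>S. of_int (\<mu> x) * Re (\<phi> x)))" if \<phi>: "odd_char \<phi>" for \<phi>
  proof -
    have "(\<Sum>x\<in>S. of_int (\<mu> (- x)) * \<phi> x) = (\<Sum>x\<in>S. of_int (\<mu> x) * \<phi> (- x))"
      using sum.reindex_bij_betw[OF bij, of "\<lambda>x. of_int (\<mu> (- x)) * \<phi> x"] by simp
    then have "(\<Sum>x\<in>S. of_int (\<nu> x) * \<phi> x) = (\<Sum>x\<in>S. of_int (\<mu> x) * (\<phi> x + cnj (\<phi> x)))"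
      by (simp add: \<nu>_def distrib_left distrib_right sum.distrib odd_char_minus[OF \<phi>])
    also have "\<dots> = (\<Sum>x\<in>S. of_int (\<mu> x) * of_real (2 * Re (\<phi> x)))"
      by (simp only: complex_add_cnj)
    also have "\<dots> = of_real (\<Sum>x\<in>S. of_int (\<mu> x) * (2 * Re (\<phi> x)))" by simp
    finally show ?thesis by (simp add: sum_distrib_left algebra_simps)
  qed
  have "(\<Sum>x\<in>S. of_int (\<nu> x) * \<psi> (x + x)) = (\<Sum>x\<in>S. of_int (\<nu> x) * \<psi> x ^ 2)"
    using odd_charD(1)[OF \<psi>] by (simp add: power2_eq_square)
  then show ?thesis using re[OF \<psi>] re[OF odd_char_power[OF \<psi>], of 2] eq by simp
qed

lemma supp_nu: "\<nu> x \<noteq> 0 \<Longrightarrow> x \<in> S"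
  using supp[of x] supp[of "- x"] sym[of "- x"] by (cases "\<mu> x = 0") (auto simp: \<nu>_def)

lemma double_inj: "x + x = y + y \<Longrightarrow> x = (y::'a)"
  using no_order_two[of "x - y"] by (simp add: algebra_simps)

lemma odd_char_separates_points:
  assumes "x \<noteq> (y::'a)"
  obtains \<psi> where "odd_char \<psi>" "\<psi> x \<noteq> \<psi> y"
proof -
  have "\<exists>\<psi>. odd_char \<psi> \<and> \<psi> (x - y) \<noteq> 1"
  proof (rule odd_char_separates[of "{0::'a}" "x - y"])
    show "z \<in> {0}" if "z + z \<in> {0}" for z :: 'a using no_order_two that by blast
  qed (use assms in auto)
  then obtain \<psi> where \<psi>: "odd_char \<psi>" "\<psi> (x - y) \<noteq> 1" by blast
  then show ?thesis using that odd_charD(1)[OF \<psi>(1), of "x - y" y] odd_root_nonzero[OF odd_charD(2)[OF \<psi>(1)]] by auto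
qed

text \<open>The functions \<open>p\<close> occurring here are products of factors \<open>\<phi> - c\<close> with \<open>\<phi>\<close> a character; they can be
  made to vanish at all points of a finite set except one.\<close>

lemma nu_double: "\<nu> (g + g) = \<nu> g"
proof -
  \<comment> \<open>\<open>K p\<close> demands the identity for p times every character. With this
    twist built in, \<open>K\<close> is preserved by factors \<phi> - c, as products of characters
    are characters.\<close>
  define K where "K = (\<lambda>p. \<forall>\<psi>. odd_char \<psi> \<longrightarrow>
    (\<Sum>x\<in>S. of_int (\<nu> x) * (p x * \<psi> x - p (x + x) * \<psi> (x + x))) = (0::complex))"
  have K1: "K (\<lambda>_. 1)" unfolding K_def using char_sum_square by (simp add: right_diff_distrib sum_subtractf)
  have Kstep: "K (\<lambda>x. p x * (\<phi> x - c))" if "K p" "odd_char \<phi>" for p \<phi> c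
    unfolding K_def
  proof (intro allI impI)
    fix \<psi> :: "'a \<Rightarrow> complex" assume \<psi>: "odd_char \<psi>"
    have "(\<Sum>x\<in>S. of_int (\<nu> x) * (p x * (\<phi> x - c) * \<psi> x - p (x + x) * (\<phi> (x + x) - c) * \<psi> (x + x)))
       = (\<Sum>x\<in>S. of_int (\<nu> x) * (p x * (\<phi> x * \<psi> x) - p (x + x) * (\<phi> (x + x) * \<psi> (x + x))))
         - c * (\<Sum>x\<in>S. of_int (\<nu> x) * (p x * \<psi> x - p (x + x) * \<psi> (x + x)))"
      by (simp add: sum_distrib_left sum_subtractf[symmetric] algebra_simps)
    also have "\<dots> = 0"
      using that(1)[unfolded K_def, rule_format, OF odd_char_mult[OF that(2) \<psi>]] that(1)[unfolded K_def, rule_format, OF \<psi>]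
      by simp
    finally show "(\<Sum>x\<in>S. of_int (\<nu> x) * (p x * (\<phi> x - c) * \<psi> x - p (x + x) * (\<phi> (x + x) - c) * \<psi> (x + x))) = 0" .
  qed
  define x0 where "x0 = g + g"
  have ex: "\<exists>p. K p \<and> (\<forall>t\<in>T. p t = 0) \<and> p x0 \<noteq> 0" if "finite T" "x0 \<notin> T" for T
    using that
  proof (induction T rule: finite_induct)
    case empty then show ?case using K1 by auto
  next
    case (insert t T)
    then obtain p where p: "K p" "\<forall>t\<in>T. p t = 0" "p x0 \<noteq> 0" by auto
    obtain \<phi> where \<phi>: "odd_char \<phi>" "\<phi> x0 \<noteq> \<phi> t" using odd_char_separates_points[of x0 t] insert by auto
    then show ?case using p Kstep[OF p(1) \<phi>(1), of "\<phi> t"]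
      by (intro exI[of _ "\<lambda>x. p x * (\<phi> x - \<phi> t)"]) auto
  qed
  obtain p where p: "K p" "\<And>t. t \<in> (S \<union> (\<lambda>x. x + x) ` S) - {x0} \<Longrightarrow> p t = 0" "p x0 \<noteq> 0"
    using ex[of "(S \<union> (\<lambda>x. x + x) ` S) - {x0}"] fin by auto
  have "0 = (\<Sum>x\<in>S. of_int (\<nu> x) * (p x - p (x + x)))"
    using p(1) odd_char_one by (auto simp: K_def)
  \<comment> \<open>Among the points of S and their doubles, p is nonzero only at x0 = g + g. By
    injectivity of doubling, x + x = x0 only for x = g.\<close>
  also have "\<dots> = (\<Sum>x\<in>S. if x = x0 then of_int (\<nu> x0) * p x0 else 0) - (\<Sum>x\<in>S. if x = g then of_int (\<nu> g) * p x0 else 0)"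
    unfolding sum_subtractf[symmetric]
  proof (intro sum.cong refl)
    fix x assume x: "x \<in> S"
    have "p x = 0" if "x \<noteq> x0" using p(2)[of x] x that by auto
    moreover have "p (x + x) = 0" if "x \<noteq> g" using p(2)[of "x + x"] x that double_inj[of x g] by (auto simp: x0_def)
    ultimately show "of_int (\<nu> x) * (p x - p (x + x)) = (if x = x0 then of_int (\<nu> x0) * p x0 else 0) - (if x = g then of_int (\<nu> g) * p x0 else 0)"
      by (auto simp: x0_def algebra_simps)
  qed
  also have "\<dots> = of_int (\<nu> x0) * p x0 - of_int (\<nu> g) * p x0"
    using fin supp_nu[of x0] supp_nu[of g] by (simp add: sum.delta) fastforce
  finally have "(of_int (\<nu> x0) - of_int (\<nu> g)) * p x0 = 0" by (simp add: left_diff_distrib)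
  then show ?thesis using p(3) by (simp add: x0_def)
qed

text \<open>Within S, the subgroup \<open>H\<close> is the common kernel of finitely many
  characters, one for each point of S - H. Vanishing sums over single kernels do not pass to
  intersections, so the stronger property \<open>Q\<close> is propagated: over the given part of S,
  the Galois traces of the sums twisted by any character of \<open>\<Gamma>\<close> vanish. The
  trivial twist gives the claim.\<close>

lemma pure_subgroup_sum_zero:
  assumes H: "0 \<in> H" "\<And>x y. x \<in> H \<Longrightarrow> y \<in> H \<Longrightarrow> x + y \<in> H" "\<And>x. x \<in> H \<Longrightarrow> - x \<in> H"
    and pure: "\<And>x. x + x \<in> H \<Longrightarrow> x \<in> H"
  shows "(\<Sum>x\<in>S \<inter> H. \<mu> x) = 0"
proof -
  have "\<forall>y. \<exists>\<phi>. y \<notin> H \<longrightarrow> odd_char \<phi> \<and> (\<forall>h\<in>H. \<phi> h = 1) \<and> \<phi> y \<noteq> 1"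
    using odd_char_separates[OF H pure] by metis
  then obtain \<phi> where \<phi>: "\<And>y. y \<notin> H \<Longrightarrow> odd_char (\<phi> y)" "\<And>y h. y \<notin> H \<Longrightarrow> h \<in> H \<Longrightarrow> \<phi> y h = 1"
    "\<And>y. y \<notin> H \<Longrightarrow> \<phi> y y \<noteq> 1" by metis
  have "finite ((\<lambda>(y, x). \<phi> y x) ` ((S - H) \<times> S))" using fin by simp
  moreover have "odd_root z" if "z \<in> (\<lambda>(y, x). \<phi> y x) ` ((S - H) \<times> S)" for z
    using that odd_charD(2)[OF \<phi>(1)] by auto
  ultimately obtain N where N: "odd N" "\<And>x y. y \<in> S - H \<Longrightarrow> x \<in> S \<Longrightarrow> \<phi> y x ^ N = 1"
    using odd_char_common_exponent[of "(\<lambda>(y, x). \<phi> y x) ` ((S - H) \<times> S)"] by auto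
  have N0: "N > 0" using N(1) by (rule odd_pos)
  let ?J = "{j. j < N \<and> coprime j N}"
  have "1 mod N \<in> ?J" using N0 by (simp add: coprime_commute)
  then have J: "card ?J > 0" by (auto simp: card_gt_0_iff)
  define \<Gamma> where "\<Gamma> = {\<psi>. odd_char \<psi> \<and> (\<forall>x\<in>S. \<psi> x ^ N = 1)}"
  have \<Gamma>_mult: "(\<lambda>x. \<psi> x * \<phi> x ^ e) \<in> \<Gamma>" if "\<psi> \<in> \<Gamma>" "\<phi> \<in> \<Gamma>" for \<psi> \<phi> e
    using that by (auto simp: \<Gamma>_def odd_char_mult odd_char_power power_mult_distrib power_mult[symmetric] mult.commute[of e])
       (simp add: power_mult)
  have \<phi>\<Gamma>: "\<phi> y \<in> \<Gamma>" if "y \<in> S - H" for y using that \<phi>(1) N by (auto simp: \<Gamma>_def)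
  define Q where "Q = (\<lambda>T. \<forall>\<psi>\<in>\<Gamma>. (\<Sum>j\<in>?J. \<Sum>x\<in>T. of_int (\<mu> x) * \<psi> x ^ j) = (0::complex))"
  have geom: "(\<Sum>e<M. z ^ e) = (if z = 1 then of_nat M else 0)" if "z ^ M = 1" for z :: complex and M
    using geometric_sum[of z M] that by auto
  \<comment> \<open>By orthogonality, the sum over the multiples of d picks out the kernel of
    \<psi>^d, where \<open>ker_sum_zero\<close> applies; \<open>coprime_sum_zero\<close> then
    isolates the units.\<close>
  have Q_S: "Q S" unfolding Q_def
  proof
    fix \<psi> assume \<psi>: "\<psi> \<in> \<Gamma>"
    show "(\<Sum>j\<in>?J. \<Sum>x\<in>S. of_int (\<mu> x) * \<psi> x ^ j) = 0"
    proof (rule coprime_sum_zero[OF N0])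
      fix d assume d: "d dvd N"
      have "(\<Sum>j<N div d. \<Sum>x\<in>S. of_int (\<mu> x) * \<psi> x ^ (d * j)) = (\<Sum>x\<in>S. of_int (\<mu> x) * (\<Sum>j<N div d. (\<psi> x ^ d) ^ j))"
        by (subst sum.swap) (simp add: sum_distrib_left power_mult)
      also have "\<dots> = (\<Sum>x\<in>S. if \<psi> x ^ d = 1 then of_int (\<mu> x) * of_nat (N div d) else 0)"
      proof (intro sum.cong refl)
        fix x assume "x \<in> S"
        then have "(\<psi> x ^ d) ^ (N div d) = 1" using \<psi> d by (simp add: \<Gamma>_def power_mult[symmetric])
        from geom[OF this] show "of_int (\<mu> x) * (\<Sum>j<N div d. (\<psi> x ^ d) ^ j) = (if \<psi> x ^ d = 1 then of_int (\<mu> x) * of_nat (N div d) else 0)"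
          by simp
      qed
      also have "\<dots> = of_int (\<Sum>x | x \<in> S \<and> \<psi> x ^ d = 1. \<mu> x) * of_nat (N div d)"
        using fin by (simp add: sum.inter_filter[symmetric] sum_distrib_right)
      also have "\<dots> = 0" using ker_sum_zero[OF odd_char_power, of \<psi> d] \<psi> by (simp add: \<Gamma>_def)
      finally show "(\<Sum>j<N div d. \<Sum>x\<in>S. of_int (\<mu> x) * \<psi> x ^ (d * j)) = 0" .
    qed
  qed
  \<comment> \<open>Summing the twists by \<rho>^e over e < N detects \<rho>(x)^j = 1, which for j
    prime to N means \<rho>(x) = 1.\<close>
  have Q_step: "Q {x \<in> T. \<rho> x = 1}" if T: "T \<subseteq> S" "Q T" and \<rho>: "\<rho> \<in> \<Gamma>" for T \<rho>
    unfolding Q_def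
  proof
    fix \<psi> assume \<psi>: "\<psi> \<in> \<Gamma>"
    have fT: "finite T" using T fin finite_subset by blast
    have "0 = (\<Sum>e<N. \<Sum>j\<in>?J. \<Sum>x\<in>T. of_int (\<mu> x) * (\<psi> x * \<rho> x ^ e) ^ j)"
      using \<Gamma>_mult[OF \<psi> \<rho>] T(2) by (simp add: Q_def)
    also have "\<dots> = (\<Sum>j\<in>?J. \<Sum>e<N. \<Sum>x\<in>T. of_int (\<mu> x) * (\<psi> x * \<rho> x ^ e) ^ j)"
      by (rule sum.swap)
    also have "\<dots> = (\<Sum>j\<in>?J. \<Sum>x\<in>T. \<Sum>e<N. of_int (\<mu> x) * (\<psi> x * \<rho> x ^ e) ^ j)"
      by (intro sum.cong refl sum.swap)
    also have "\<dots> = (\<Sum>j\<in>?J. \<Sum>x\<in>T. if \<rho> x = 1 then of_nat N * (of_int (\<mu> x) * \<psi> x ^ j) else 0)"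
    proof (intro sum.cong refl)
      fix j x assume j: "j \<in> ?J" and x: "x \<in> T"
      have r: "\<rho> x ^ N = 1" using x T \<rho> by (auto simp: \<Gamma>_def)
      have rj: "(\<rho> x ^ j) ^ N = 1" by (simp add: power_mult[symmetric] mult.commute[of j]) (simp add: power_mult r)
      have "(\<Sum>e<N. of_int (\<mu> x) * (\<psi> x * \<rho> x ^ e) ^ j) = of_int (\<mu> x) * \<psi> x ^ j * (\<Sum>e<N. (\<rho> x ^ j) ^ e)"
      proof -
        have "(\<rho> x ^ e) ^ j = (\<rho> x ^ j) ^ e" for e by (simp add: power_mult[symmetric] mult.commute)
        then show ?thesis by (simp add: sum_distrib_left power_mult_distrib mult.assoc)
      qed
      also have "\<dots> = (if \<rho> x = 1 then of_nat N * (of_int (\<mu> x) * \<psi> x ^ j) else 0)"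
        using geom[OF rj] root_unity_coprime_power[OF r, of j] j by auto
      finally show "(\<Sum>e<N. of_int (\<mu> x) * (\<psi> x * \<rho> x ^ e) ^ j) = (if \<rho> x = 1 then of_nat N * (of_int (\<mu> x) * \<psi> x ^ j) else 0)" .
    qed
    also have "\<dots> = of_nat N * (\<Sum>j\<in>?J. \<Sum>x | x \<in> T \<and> \<rho> x = 1. of_int (\<mu> x) * \<psi> x ^ j)"
      using fT by (simp add: sum.inter_filter[symmetric] sum_distrib_left)
    finally show "(\<Sum>j\<in>?J. \<Sum>x | x \<in> T \<and> \<rho> x = 1. of_int (\<mu> x) * \<psi> x ^ j) = 0" using N0 by simp
  qed
  have "Q {x \<in> S. \<forall>y\<in>Y. \<phi> y x = 1}" if "finite Y" "Y \<subseteq> S - H" for Y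
    using that
  proof (induction Y rule: finite_induct)
    case (insert y Y)
    then have "Q {x \<in> {x \<in> S. \<forall>y\<in>Y. \<phi> y x = 1}. \<phi> y x = 1}" by (intro Q_step \<phi>\<Gamma>) auto
    moreover have "{x \<in> {x \<in> S. \<forall>y\<in>Y. \<phi> y x = 1}. \<phi> y x = 1} = {x \<in> S. \<forall>y\<in>insert y Y. \<phi> y x = 1}" by auto
    ultimately show ?case by simp
  qed (use Q_S in simp)
  from this[of "S - H"] have "Q {x \<in> S. \<forall>y\<in>S - H. \<phi> y x = 1}" using fin by simp
  also have "{x \<in> S. \<forall>y\<in>S - H. \<phi> y x = 1} = S \<inter> H" using \<phi>(2,3) by blast
  finally have "Q (S \<inter> H)" .
  moreover have "(\<lambda>_. 1) \<in> \<Gamma>" by (simp add: \<Gamma>_def odd_char_one)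
  ultimately have "of_nat (card ?J) * (of_int (\<Sum>x\<in>S \<inter> H. \<mu> x) :: complex) = 0"
    unfolding Q_def by (fastforce simp: sum_distrib_left)
  then show ?thesis using J by (metis mult_eq_0_iff of_int_eq_0_iff of_nat_eq_0_iff less_irrefl)
qed

lemma nu_torsion: "\<nu> g \<noteq> 0 \<Longrightarrow> \<exists>k. odd k \<and> int k \<odot> g = 0"
  by (rule double_invariant_torsion[of \<nu> g, OF no_order_two _ nu_double])
     (use supp_nu fin in \<open>auto intro: finite_subset\<close>)

text \<open>The elements of odd order in \<open>H\<close> form a subgroup \<open>T\<close> closed
  under halving, and \<nu> vanishes on the rest of \<open>H\<close>. For symmetric sets the sum of
  \<nu> is twice that of \<mu>, so the sum over \<open>H\<close> reduces to that over
  \<open>T\<close>.\<close>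

lemma subgroup_sum_zero:
  assumes H: "0 \<in> H" "\<And>x y. x \<in> H \<Longrightarrow> y \<in> H \<Longrightarrow> x + y \<in> H" "\<And>x. x \<in> H \<Longrightarrow> - x \<in> H"
  shows "(\<Sum>x\<in>S \<inter> H. \<mu> x) = 0"
proof -
  define T where "T = {x \<in> H. \<exists>k. odd k \<and> int k \<odot> x = 0}"
  have mulH: "int n \<odot> x \<in> H" if "x \<in> H" for n x
    by (induction n) (use H that in \<open>auto simp: imul_Suc simp del: of_nat_Suc\<close>)
  have sum2: "(\<Sum>x\<in>S \<inter> X. \<nu> x) = 2 * (\<Sum>x\<in>S \<inter> X. \<mu> x)" if "\<And>x. x \<in> X \<Longrightarrow> - x \<in> X" for X
  proof -
    have "bij_betw uminus (S \<inter> X) (S \<inter> X)" using sym that by (intro bij_betwI[of _ _ _ uminus]) auto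
    from sum.reindex_bij_betw[OF this, of \<mu>] show ?thesis by (simp add: \<nu>_def sum.distrib)
  qed
  have Tneg: "- x \<in> T" if "x \<in> T" for x using that H(3) by (auto simp: T_def imul_minus_right)
  have "(\<Sum>x\<in>S \<inter> H. \<nu> x) = (\<Sum>x\<in>S \<inter> T. \<nu> x)"
    using fin nu_torsion by (intro sum.mono_neutral_right) (auto simp: T_def)
  moreover have "(\<Sum>x\<in>S \<inter> T. \<mu> x) = 0"
  proof (rule pure_subgroup_sum_zero)
    show "0 \<in> T" using H(1) by (auto simp: T_def intro: exI[of _ 1])
    show "- x \<in> T" if "x \<in> T" for x using that by (rule Tneg)
    fix x y assume "x \<in> T" "y \<in> T"
    then obtain k l where kl: "x \<in> H" "y \<in> H" "odd k" "int k \<odot> x = 0" "odd l" "int l \<odot> y = 0" by (auto simp: T_def)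
    have "int (k * l) \<odot> (x + y) = int l \<odot> int k \<odot> x + int k \<odot> int l \<odot> y"
      by (simp add: imul_add_right imul_imul mult.commute)
    then have "int (k * l) \<odot> (x + y) = 0" using kl by simp
    then show "x + y \<in> T" using kl H(2) by (auto simp: T_def intro!: exI[of _ "k * l"] simp del: of_nat_mult)
  next
    fix x assume "x + x \<in> T"
    then obtain k where k: "x + x \<in> H" "odd k" "int k \<odot> (x + x) = 0" by (auto simp: T_def)
    have "int k \<odot> x + int k \<odot> x = 0" using k(3) by (simp add: imul_add_right)
    then have kx: "int k \<odot> x = 0" by (rule no_order_two)
    \<comment> \<open>If k x = 0 with k odd, then x is (k+1)/2 times 2x, hence lies in
      \<open>H\<close>.\<close>
    obtain i where i: "k + 1 = 2 * i" using k(2) by (metis evenE odd_even_add odd_one)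
    have "int i \<odot> (x + x) = int (k + 1) \<odot> x" unfolding i by (simp add: imul_2[symmetric] imul_imul mult.commute)
    also have "\<dots> = x" using kx by (simp add: imul_add_left)
    finally show "x \<in> T" using mulH[OF k(1), of i] k(2) kx by (auto simp: T_def)
  qed
  ultimately show ?thesis using sum2[of H] sum2[of T] H(3) Tneg by simp
qed

lemma mem_V: "\<mu> \<in> V"
proof -
  have f: "finite {g. \<mu> g \<noteq> 0}" using fin supp by (auto intro: finite_subset)
  moreover have "\<mu> g + \<mu> (- g) = \<mu> (g + g) + \<mu> (- (g + g))" for g using nu_double[of g] by (simp add: \<nu>_def)
  moreover have "(\<Sum>g | g \<in> H \<and> \<mu> g \<noteq> 0. \<mu> g) = 0" if "subgroup H add_grp" for H
  proof -
    have "0 \<in> H" "\<And>x y. x \<in> H \<Longrightarrow> y \<in> H \<Longrightarrow> x + y \<in> H" "\<And>x. x \<in> H \<Longrightarrow> - x \<in> H"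
      using subgroup.one_closed[OF that] subgroup.m_closed[OF that] subgroup.m_inv_closed[OF that] by auto
    from subgroup_sum_zero[OF this] have "(\<Sum>x\<in>S \<inter> H. \<mu> x) = 0" .
    moreover have "(\<Sum>g | g \<in> H \<and> \<mu> g \<noteq> 0. \<mu> g) = (\<Sum>x\<in>S \<inter> H. \<mu> x)"
      using fin supp by (intro sum.mono_neutral_left) auto
    ultimately show ?thesis by simp
  qed
  ultimately show ?thesis unfolding V_def by blast
qed

end

lemma FS_translate_imp_V:
  fixes A B :: "'a::ab_group_add multiset"
  assumes "\<And>g::'a. g + g = 0 \<Longrightarrow> g = 0" and "FS A = translate (FS B) s"
  shows "(\<lambda>g. int (count A g) - int (count B g)) \<in> V"
proof -
  define T where "T = set_mset A \<union> set_mset B"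
  have "log_null (\<lambda>g. int (count A g) - int (count B g)) (T \<union> uminus ` T)"
  proof
    show "finite (T \<union> uminus ` T)" by (simp add: T_def)
    show "x \<in> T \<union> uminus ` T" if "int (count A x) - int (count B x) \<noteq> 0" for x
    proof -
      have "count A x \<noteq> 0 \<or> count B x \<noteq> 0" using that by (cases "count A x = 0") auto
      then show ?thesis by (auto simp: T_def)
    qed
    show "- x \<in> T \<union> uminus ` T" if "x \<in> T \<union> uminus ` T" for x using that by auto
    show "(\<Sum>x\<in>T \<union> uminus ` T. of_int (int (count A x) - int (count B x)) * ln (norm (1 + \<psi> x))) = 0" if "odd_char \<psi>" for \<psi>
      by (rule FS_translate_log[OF assms(2) that]) (auto simp: T_def)
  qed (fact assms(1))
  then show ?thesis by (rule log_null.mem_V)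
qed

section \<open>Effect of the moves on subset sums\<close>

lemma translate_0 [simp]: "translate S 0 = S"
  by (simp add: translate_def)

lemma translate_translate: "translate (translate S a) b = translate S (a + b)"
  by (simp add: translate_def multiset.map_comp o_def add.assoc)

lemma translate_add [simp]: "translate (S + T) a = translate S a + translate T a"
  by (simp add: translate_def)

lemma translate_add_mset [simp]: "translate (add_mset x S) a = add_mset (x + a) (translate S a)"
  by (simp add: translate_def)

lemma size_translate [simp]: "size (translate S a) = size S"
  by (simp add: translate_def)

lemma size_FS: "size (FS A) = 2 ^ size A"
  by (induction A) (simp_all add: FS_empty FS_add_mset)

lemma sum_translate: "sum_mset (translate S a) = sum_mset S + int (size S) \<odot> a"
  by (induction S) (simp_all add: translate_def imul_Suc algebra_simps del: of_nat_Suc)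

text \<open>Every element lies in half of all sub-collections. The sum is doubled so that the factor
  is a power of 2 for the empty multiset as well.\<close>

lemma sum_FS: "sum_mset (FS A) + sum_mset (FS A) = (2 ^ size A) \<odot> sum_mset A"
proof (induction A)
  case (add a A)
  have "sum_mset (FS (add_mset a A)) + sum_mset (FS (add_mset a A)) =
      2 \<odot> (sum_mset (FS A) + sum_mset (FS A)) + 2 \<odot> (2 ^ size A) \<odot> a"
    by (simp add: FS_add_mset sum_translate size_FS imul_2 algebra_simps)
  also have "\<dots> = (2 ^ size (add_mset a A)) \<odot> sum_mset (add_mset a A)"
    unfolding add by (simp add: imul_imul imul_add_right add.commute)
  finally show ?case .
qed (simp add: FS_empty)

lemma FS_translate_union:
  assumes "FS X = translate (FS Y) s"
  shows "FS (C + X) = translate (FS (C + Y)) s"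
proof (induction C)
  case (add c C)
  then show ?case by (simp add: FS_add_mset translate_translate add.commute)
qed (use assms in simp)

lemma move_neg_FS:
  assumes "move_neg A A'"
  shows "\<exists>s. FS A' = translate (FS A) s"
proof -
  obtain g where g: "g \<in># A" "A' = (A - {#g#}) + {#- g#}" using assms by (auto simp: move_neg_def)
  obtain C where C: "A = add_mset g C" using multi_member_split[OF g(1)] by blast
  have "FS A' = translate (FS A) (- g)" using g(2) C by (simp add: FS_add_mset translate_translate)
  then show ?thesis by blast
qed

text \<open>Binary expansion: every j < 2^k is a sum of distinct powers 2^i with i < k in exactly
  one way.\<close>

lemma FS_doubling:
  "FS (image_mset (\<lambda>i. (2 ^ i) \<odot> y) (mset_set {..<k})) = image_mset (\<lambda>j. int j \<odot> y) (mset_set {..<2 ^ k})"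
proof (induction k)
  case 0 then show ?case by (simp add: FS_empty lessThan_Suc)
next
  case (Suc k)
  let ?f = "\<lambda>j. int j \<odot> y"
  have split: "{..<2 ^ Suc k} = {..<2 ^ k} \<union> (\<lambda>j. j + 2 ^ k) ` {..<(2::nat) ^ k}"
  proof (intro equalityI subsetI)
    fix j :: nat assume "j \<in> {..<2 ^ Suc k}"
    then show "j \<in> {..<2 ^ k} \<union> (\<lambda>j. j + 2 ^ k) ` {..<2 ^ k}"
      by (cases "j < 2 ^ k") (auto intro!: image_eqI[of _ _ "j - 2 ^ k"])
  qed auto
  have "mset_set {..<(2::nat) ^ Suc k} = mset_set {..<2 ^ k} + mset_set ((\<lambda>j. j + 2 ^ k) ` {..<2 ^ k})"
    unfolding split by (rule mset_set_Union) auto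
  also have "mset_set ((\<lambda>j. j + 2 ^ k) ` {..<(2::nat) ^ k}) = image_mset (\<lambda>j. j + 2 ^ k) (mset_set {..<2 ^ k})"
    by (rule image_mset_mset_set[symmetric]) (simp add: inj_on_def)
  finally have "image_mset ?f (mset_set {..<2 ^ Suc k}) = image_mset ?f (mset_set {..<2 ^ k}) + translate (image_mset ?f (mset_set {..<2 ^ k})) ((2 ^ k) \<odot> y)"
    by (simp add: translate_def multiset.map_comp o_def imul_add_left)
  then show ?case using Suc by (simp add: lessThan_Suc FS_add_mset)
qed

section \<open>Cyclic subgroups and doubling orbits\<close>

definition has_order :: "'a::ab_group_add \<Rightarrow> nat \<Rightarrow> bool" where
  "has_order y n \<longleftrightarrow> n > 0 \<and> (\<forall>m. m \<odot> y = 0 \<longleftrightarrow> int n dvd m)"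

lemma has_order_eq_iff:
  assumes "has_order y n"
  shows "j \<odot> y = k \<odot> y \<longleftrightarrow> j mod int n = k mod int n"
proof -
  have "j \<odot> y = k \<odot> y \<longleftrightarrow> (j - k) \<odot> y = 0" by (simp add: imul_diff_left)
  then show ?thesis using assms by (simp add: has_order_def mod_eq_dvd_iff)
qed

lemma has_order_imul_coprime:
  assumes "has_order g n" "coprime a (int n)"
  shows "has_order (a \<odot> g) n" "range (\<lambda>m. m \<odot> (a \<odot> g)) = range (\<lambda>m. m \<odot> g)"
proof -
  show "has_order (a \<odot> g) n"
    using assms by (auto simp: has_order_def imul_imul coprime_commute coprime_dvd_mult_left_iff)
  obtain b where b: "[a * b = 1] (mod int n)" using cong_solve_coprime_int[OF assms(2)] by blast
  have "m \<odot> g = (m * b) \<odot> (a \<odot> g)" for m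
  proof -
    have "[m * (a * b) = m * 1] (mod int n)" by (rule cong_scalar_left[OF b])
    then have "(m * (a * b)) mod int n = m mod int n" by (simp add: unique_euclidean_semiring_class.cong_def)
    then have "(m * (a * b)) \<odot> g = m \<odot> g" using has_order_eq_iff[OF assms(1)] by blast
    then show ?thesis by (simp add: imul_imul mult_ac)
  qed
  then show "range (\<lambda>m. m \<odot> (a \<odot> g)) = range (\<lambda>m. m \<odot> g)"
    by (auto simp: imul_imul intro: range_eqI)
qed

lemma has_order_cyclic:
  assumes "has_order y n"
  shows "inj_on (\<lambda>j. int j \<odot> y) {..<n}" "(\<lambda>j. int j \<odot> y) ` {..<n} = range (\<lambda>m. m \<odot> y)"
proof -
  show "inj_on (\<lambda>j. int j \<odot> y) {..<n}"
    by (rule inj_onI) (simp add: has_order_eq_iff[OF assms] flip: zmod_int)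
  show "(\<lambda>j. int j \<odot> y) ` {..<n} = range (\<lambda>m. m \<odot> y)"
  proof (intro equalityI subsetI)
    fix x assume "x \<in> range (\<lambda>m. m \<odot> y)"
    then obtain m where m: "x = m \<odot> y" by blast
    have n: "n > 0" using assms by (simp add: has_order_def)
    then have "m \<odot> y = int (nat (m mod int n)) \<odot> y" using has_order_eq_iff[OF assms] by simp
    moreover have "nat (m mod int n) \<in> {..<n}" using n by (simp add: nat_less_iff)
    ultimately show "x \<in> (\<lambda>j. int j \<odot> y) ` {..<n}" using m by blast
  qed auto
qed

lemma multiples_mset:
  assumes "has_order y n"
  shows "image_mset (\<lambda>j. int j \<odot> y) (mset_set {..<q * n}) = repeat_mset q (mset_set (range (\<lambda>m. m \<odot> y)))"
proof (induction q)
  case (Suc q)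
  have "{..<Suc q * n} = {..<q * n} \<union> (\<lambda>j. j + q * n) ` {..<n}"
  proof (intro equalityI subsetI)
    fix j assume "j \<in> {..<Suc q * n}"
    then show "j \<in> {..<q * n} \<union> (\<lambda>j. j + q * n) ` {..<n}"
      by (cases "j < q * n") (auto intro!: image_eqI[of _ _ "j - q * n"])
  qed auto
  then have "mset_set {..<Suc q * n} = mset_set {..<q * n} + mset_set ((\<lambda>j. j + q * n) ` {..<n})"
    by (simp only:) (rule mset_set_Union, auto)
  also have "mset_set ((\<lambda>j. j + q * n) ` {..<n}) = image_mset (\<lambda>j. j + q * n) (mset_set {..<n})"
    by (rule image_mset_mset_set[symmetric]) (simp add: inj_on_def)
  finally have "image_mset (\<lambda>j. int j \<odot> y) (mset_set {..<Suc q * n}) =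
      image_mset (\<lambda>j. int j \<odot> y) (mset_set {..<q * n}) + image_mset (\<lambda>j. int (j + q * n) \<odot> y) (mset_set {..<n})"
    by (simp add: multiset.map_comp o_def)
  also have "image_mset (\<lambda>j. int (j + q * n) \<odot> y) (mset_set {..<n}) = image_mset (\<lambda>j. int j \<odot> y) (mset_set {..<n})"
    by (intro image_mset_cong) (simp add: has_order_eq_iff[OF assms])
  also have "\<dots> = mset_set (range (\<lambda>m. m \<odot> y))"
    using image_mset_mset_set[OF has_order_cyclic(1)[OF assms]] has_order_cyclic(2)[OF assms] by simp
  finally show ?case using Suc by simp
qed simp

lemma translate_cyclic:
  assumes "has_order g n"
  shows "translate (repeat_mset q (mset_set (range (\<lambda>m. m \<odot> g)))) (a \<odot> g) = repeat_mset q (mset_set (range (\<lambda>m. m \<odot> g)))"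
proof -
  let ?C = "range (\<lambda>m. m \<odot> g)"
  have "(\<lambda>x. x + a \<odot> g) ` ?C = ?C"
  proof (intro equalityI subsetI)
    fix x assume "x \<in> ?C"
    then obtain m where "x = m \<odot> g" by blast
    then have "x = (m - a) \<odot> g + a \<odot> g" by (simp add: imul_diff_left)
    then show "x \<in> (\<lambda>x. x + a \<odot> g) ` ?C" by blast
  next
    fix x assume "x \<in> (\<lambda>x. x + a \<odot> g) ` ?C"
    then obtain m where "x = m \<odot> g + a \<odot> g" by blast
    then have "x = (m + a) \<odot> g" by (simp add: imul_add_left)
    then show "x \<in> ?C" by blast
  qed
  then have "translate (mset_set ?C) (a \<odot> g) = mset_set ?C"
    unfolding translate_def by (subst image_mset_mset_set) (auto simp: inj_on_def)
  then show ?thesis by (induction q) (simp_all, simp_all add: translate_def)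
qed

lemma U_exp_props:
  assumes "odd n" "3 \<le> n"
  shows "1 \<le> U_exp n" "[2 ^ U_exp n = 1] (mod n) \<or> [2 ^ U_exp n = - 1] (mod n)"
    and "\<And>j. 1 \<le> j \<Longrightarrow> j < U_exp n \<Longrightarrow> \<not> [2 ^ j = 1] (mod n) \<and> \<not> [2 ^ j = - 1] (mod n)"
proof -
  let ?P = "\<lambda>k. 1 \<le> k \<and> ([2 ^ k = 1] (mod n) \<or> [2 ^ k = - 1] (mod n))"
  have "coprime 2 (nat n)" using assms by (simp add: even_nat_iff)
  then have "[2 ^ totient (nat n) = 1] (mod nat n)" by (rule euler_theorem)
  then have "[int (2 ^ totient (nat n)) = int 1] (mod int (nat n))" by (subst cong_int_iff)
  then have "[2 ^ totient (nat n) = 1] (mod n)" using assms by simp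
  moreover have "totient (nat n) \<ge> 1" using assms by (simp add: Suc_le_eq)
  ultimately have "?P (totient (nat n))" by blast
  then have "?P (U_exp n)" unfolding U_exp_def by (rule LeastI)
  then show "1 \<le> U_exp n" "[2 ^ U_exp n = 1] (mod n) \<or> [2 ^ U_exp n = - 1] (mod n)" by auto
  show "\<not> [2 ^ j = 1] (mod n) \<and> \<not> [2 ^ j = - 1] (mod n)" if "1 \<le> j" "j < U_exp n" for j
    using not_less_Least[OF that(2)[unfolded U_exp_def]] that(1) by blast
qed

text \<open>For i < j a coincidence up to sign would give 2^(j-i) = 1 or -1 modulo n, against the
  minimality of \<open>U_exp\<close>; for i = j the sign case would make n divide 2. Sign changes
  thus never spoil one another within an orbit, and orbits are multiplicity free.\<close>

lemma doubling_orbit_distinct: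
  assumes y: "has_order y n" and n: "odd n" "3 \<le> n" and ij: "i < U_exp (int n)" "j < U_exp (int n)"
  shows "(2 ^ i) \<odot> y \<noteq> - ((2 ^ j) \<odot> y)" "(2 ^ i) \<odot> y = (2 ^ j) \<odot> y \<Longrightarrow> i = j"
proof -
  have o: "\<And>m. m \<odot> y = 0 \<longleftrightarrow> int n dvd m" using y by (simp add: has_order_def)
  have odd: "odd (int n)" "3 \<le> int n" using n by auto
  have cop: "coprime (int n) (2 ^ i)" for i using n by (simp add: coprime_commute)
  have neq: "\<not> int n dvd 2 ^ j - 2 ^ i \<and> \<not> int n dvd 2 ^ j + 2 ^ i" if "i < j" "j < U_exp (int n)" for i j
  proof -
    define m where "m = j - i"
    have j: "j = i + m" "1 \<le> m" "m < U_exp (int n)" using that by (auto simp: m_def)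
    have e: "2 ^ j - 2 ^ i = (2 ^ i * (2 ^ m - 1) :: int)" "2 ^ j + 2 ^ i = (2 ^ i * (2 ^ m - - 1) :: int)"
      by (simp_all add: j power_add algebra_simps)
    have "\<not> int n dvd 2 ^ m - 1" "\<not> int n dvd 2 ^ m - - 1"
      using U_exp_props(3)[OF odd j(2,3)] unfolding cong_iff_dvd_diff by auto
    then show ?thesis unfolding e using cop by (simp add: coprime_dvd_mult_right_iff)
  qed
  have two: "\<not> int n dvd 2 ^ i + 2 ^ i" for i
  proof
    assume "int n dvd 2 ^ i + 2 ^ i"
    then have "int n dvd 2 ^ i * 2" by (simp only: mult_2_right)
    then have "int n dvd 2" using cop by (simp add: coprime_dvd_mult_right_iff)
    then show False using odd by (auto dest: zdvd_imp_le)
  qed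
  show "(2 ^ i) \<odot> y \<noteq> - ((2 ^ j) \<odot> y)"
  proof
    assume "(2 ^ i) \<odot> y = - ((2 ^ j) \<odot> y)"
    then have "(2 ^ i + 2 ^ j) \<odot> y = 0" by (simp add: imul_add_left)
    then have "int n dvd 2 ^ i + 2 ^ j" using o by blast
    then show False using neq[of i j] neq[of j i] two[of i] ij by (cases i j rule: linorder_cases) (auto simp: add.commute)
  qed
  assume "(2 ^ i) \<odot> y = (2 ^ j) \<odot> y"
  then have "(2 ^ i - 2 ^ j) \<odot> y = 0" "(2 ^ j - 2 ^ i) \<odot> y = 0" by (simp_all add: imul_diff_left)
  then have "int n dvd 2 ^ i - 2 ^ j \<and> int n dvd 2 ^ j - 2 ^ i" using o by blast
  then show "i = j" using neq[of i j] neq[of j i] ij by (cases i j rule: linorder_cases) auto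
qed

text \<open>For y of odd order n >= 3 this holds one element from each pair {x, -x} in the orbit of
  y under doubling and negation. It is the multiset exchanged by a move of type (2).\<close>

definition doubling_orbit :: "nat \<Rightarrow> 'a::ab_group_add \<Rightarrow> 'a multiset" where
  "doubling_orbit n y = image_mset (\<lambda>i. (2 ^ i) \<odot> y) (mset_set {..<U_exp (int n)})"

text \<open>The subset sums are j y for 0 <= j < 2^k. If 2^k = 1 modulo n, these are full periods
  plus one extra 0. If 2^k = -1, the term j = 2^k, which is -y, is missing from full
  periods.\<close>

lemma FS_doubling_orbit:
  assumes y: "has_order y n" and n: "odd n" "3 \<le> n"
  obtains q where "2 ^ U_exp (int n) = q * n + 1" "FS (doubling_orbit n y) = add_mset 0 (repeat_mset q (mset_set (range (\<lambda>m. m \<odot> y))))"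
  | q where "2 ^ U_exp (int n) + 1 = q * n" "add_mset (- y) (FS (doubling_orbit n y)) = repeat_mset q (mset_set (range (\<lambda>m. m \<odot> y)))"
proof -
  let ?k = "U_exp (int n)"
  let ?f = "\<lambda>j. int j \<odot> y"
  have odd: "odd (int n)" "3 \<le> int n" using n by auto
  have FS: "FS (doubling_orbit n y) = image_mset ?f (mset_set {..<2 ^ ?k})"
    unfolding doubling_orbit_def by (rule FS_doubling)
  have o: "\<And>m. m \<odot> y = 0 \<longleftrightarrow> int n dvd m" using y by (simp add: has_order_def)
  from U_exp_props(2)[OF odd] show thesis
  proof
    assume "[2 ^ ?k = 1] (mod int n)"
    then have "int n dvd int (2 ^ ?k - 1)" by (simp add: cong_iff_dvd_diff of_nat_diff)
    then have "n dvd 2 ^ ?k - 1" by (simp only: of_nat_dvd_iff)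
    then obtain q where "2 ^ ?k - 1 = n * q" unfolding dvd_def by blast
    moreover have "(2::nat) ^ ?k \<ge> 1" by simp
    ultimately have q: "2 ^ ?k = q * n + 1" by (metis le_add_diff_inverse2 mult.commute)
    have z: "?f (q * n) = 0" using o by simp
    have "FS (doubling_orbit n y) = add_mset 0 (repeat_mset q (mset_set (range (\<lambda>m. m \<odot> y))))"
      unfolding FS q multiples_mset[OF y, symmetric] using z by (simp add: lessThan_Suc del: of_nat_mult)
    then show thesis using that(1)[of q] q by blast
  next
    assume "[2 ^ ?k = - 1] (mod int n)"
    then have "int n dvd int (2 ^ ?k + 1)" by (simp add: cong_iff_dvd_diff add.commute)
    then have "n dvd 2 ^ ?k + 1" by (simp only: of_nat_dvd_iff)
    then obtain q where "2 ^ ?k + 1 = n * q" unfolding dvd_def by blast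
    then have q: "2 ^ ?k + 1 = q * n" by (simp add: mult.commute)
    have "int (q * n) \<odot> y = 0" using o by simp
    then have "int (Suc (2 ^ ?k)) \<odot> y = 0" by (simp only: q[symmetric] Suc_eq_plus1)
    then have "?f (2 ^ ?k) + y = 0" by (simp only: imul_Suc)
    then have "?f (2 ^ ?k) = - y" by (simp only: eq_neg_iff_add_eq_0)
    then have "add_mset (- y) (FS (doubling_orbit n y)) = image_mset ?f (mset_set {..<2 ^ ?k + 1})"
      unfolding FS by (simp add: lessThan_Suc)
    then show thesis using that(2)[of q] q multiples_mset[OF y] by metis
  qed
qed

text \<open>Both generators have the same exponent, and the sign of 2^k modulo n cannot differ
  between them since n does not divide 2. In the case of sign + the subset sums agree; otherwise the
  missing elements are - a g and - b g, and a translation by their difference matches them while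
  preserving the full periods.\<close>

lemma FS_doubling_orbit_translate:
  assumes g: "has_order g n" and n: "odd n" "3 \<le> n" and a: "coprime a (int n)" and b: "coprime b (int n)"
  shows "\<exists>s. FS (doubling_orbit n (b \<odot> g)) = translate (FS (doubling_orbit n (a \<odot> g))) s"
proof -
  note ga = has_order_imul_coprime[OF g a] and gb = has_order_imul_coprime[OF g b]
  let ?C = "mset_set (range (\<lambda>m. m \<odot> g))"
  have n0: "n > 0" using n by simp
  show ?thesis
  proof (cases rule: FS_doubling_orbit[OF ga(1) n])
    case (1 q)
    note A = this
    show ?thesis
    proof (cases rule: FS_doubling_orbit[OF gb(1) n])
      case (1 r)
      then have "q = r" using A n0 by simp
      then show ?thesis using 1 A ga gb by (intro exI[of _ 0]) simp
    next
      case (2 r)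
      then have "q * n + 2 = r * n" using A by simp
      then have "n dvd 2" by (metis dvd_add_right_iff dvd_triv_right)
      then show ?thesis using n by (auto dest: dvd_imp_le)
    qed
  next
    case (2 q)
    note A = this
    show ?thesis
    proof (cases rule: FS_doubling_orbit[OF gb(1) n])
      case (1 r)
      then have "r * n + 2 = q * n" using A by simp
      then have "n dvd 2" by (metis dvd_add_right_iff dvd_triv_right)
      then show ?thesis using n by (auto dest: dvd_imp_le)
    next
      case (2 r)
      then have qr: "q = r" using A n0 by simp
      define s where "s = a \<odot> g - b \<odot> g"
      have "translate (repeat_mset q ?C) ((a - b) \<odot> g) = repeat_mset q ?C" by (rule translate_cyclic[OF g])
      then have t: "translate (repeat_mset q ?C) s = repeat_mset q ?C" by (simp add: s_def imul_diff_left)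
      have "add_mset (- (b \<odot> g)) (translate (FS (doubling_orbit n (a \<odot> g))) s)
          = translate (add_mset (- (a \<odot> g)) (FS (doubling_orbit n (a \<odot> g)))) s" by (simp add: s_def)
      also have "\<dots> = repeat_mset q ?C" unfolding A(2) ga(2) by (rule t)
      also have "\<dots> = add_mset (- (b \<odot> g)) (FS (doubling_orbit n (b \<odot> g)))" unfolding 2(2) gb(2) qr ..
      finally show ?thesis by (intro exI[of _ s]) simp
    qed
  qed
qed

lemma coprime_of_Units:
  assumes "1 < n" "a \<in> Units (residue_ring n)"
  shows "coprime a n"
proof -
  have r: "residues n" using assms(1) by (simp add: residues_def)
  show ?thesis using residues.res_units_eq[OF r] assms(2) by simp
qed

lemma Units_of_coprime:
  assumes "1 < n" "0 < a" "a < n" "coprime a n"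
  shows "a \<in> Units (residue_ring n)"
proof -
  have r: "residues n" using assms(1) by (simp add: residues_def)
  show ?thesis using residues.res_units_eq[OF r] assms by simp
qed

lemma unit_U_image:
  assumes g: "has_order g n" and \<iota>: "\<And>x. x \<in> {0..int n - 1} \<Longrightarrow> \<iota> x = x \<odot> g"
    and n: "odd n" "3 \<le> n" and a: "coprime a (int n)"
  shows "mset_set (\<iota> ` unit_U (int n) a) = doubling_orbit n (a \<odot> g)"
proof -
  let ?k = "U_exp (int n)"
  let ?h = "\<lambda>i. (2 ^ i) \<odot> (a \<odot> g)"
  have "unit_U (int n) a = (\<lambda>i. (a * (2 ^ i mod int n)) mod int n) ` {..<?k}"
    by (auto simp: unit_U_def U_set_def residue_ring_def)
  moreover have "\<iota> ((a * (2 ^ i mod int n)) mod int n) = ?h i" for i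
  proof -
    have "(a * (2 ^ i mod int n)) mod int n \<in> {0..int n - 1}" using n by simp
    then have "\<iota> ((a * (2 ^ i mod int n)) mod int n) = ((a * (2 ^ i mod int n)) mod int n) \<odot> g" by (rule \<iota>)
    also have "\<dots> = (a * 2 ^ i) \<odot> g" unfolding has_order_eq_iff[OF g] by (simp add: mod_mult_right_eq)
    finally show ?thesis by (simp add: imul_imul mult.commute)
  qed
  ultimately have "\<iota> ` unit_U (int n) a = ?h ` {..<?k}" by (simp add: image_image)
  moreover have "inj_on ?h {..<?k}"
    using doubling_orbit_distinct(2)[OF has_order_imul_coprime(1)[OF g a] n] by (intro inj_onI) auto
  ultimately show ?thesis unfolding doubling_orbit_def by (simp add: image_mset_mset_set)
qed

text \<open>An embedding of Z/n is multiplication of the element \<open>\<iota> 1\<close> of order n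
  by integers. This reduces moves of type (2) to doubling orbits.\<close>

lemma residue_hom_eq_imul:
  fixes \<iota> :: "int \<Rightarrow> 'a::ab_group_add"
  assumes n: "3 \<le> n" and hom: "\<iota> \<in> hom (add_monoid (residue_ring n)) add_grp" and inj: "inj_on \<iota> (carrier (residue_ring n))"
  shows "has_order (\<iota> 1) (nat n)" "\<And>x. x \<in> {0..n - 1} \<Longrightarrow> \<iota> x = x \<odot> \<iota> 1"
proof -
  have car: "carrier (residue_ring n) = {0..n - 1}" by (simp add: residue_ring_def)
  have add: "\<iota> ((x + y) mod n) = \<iota> x + \<iota> y" if "x \<in> {0..n - 1}" "y \<in> {0..n - 1}" for x y
    using hom_mult[OF hom, of x y] that by (simp add: residue_ring_def)
  have i0: "\<iota> 0 = 0" using add[of 0 0] n by simp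
  have nat: "\<iota> (int k) = int k \<odot> \<iota> 1" if "int k < n" for k
    using that
  proof (induction k)
    case (Suc k)
    have "(int k + 1) mod n = int (Suc k)" using Suc.prems by (simp add: mod_pos_pos_trivial)
    then have "\<iota> (int (Suc k)) = \<iota> (int k) + \<iota> 1" using add[of "int k" 1] Suc.prems n by (simp add: add.commute)
    also have "\<dots> = int k \<odot> \<iota> 1 + \<iota> 1" using Suc by simp
    finally show ?case by (simp only: imul_Suc)
  qed (simp add: i0)
  show eq: "\<iota> x = x \<odot> \<iota> 1" if "x \<in> {0..n - 1}" for x
    using nat[of "nat x"] that by simp
  have "\<iota> 0 = \<iota> (n - 1) + \<iota> 1" using add[of "n - 1" 1] n by simp
  then have n1: "n \<odot> \<iota> 1 = 0" using eq[of "n - 1"] n i0 by (simp add: imul_diff_left)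
  have red: "m \<odot> \<iota> 1 = \<iota> (m mod n)" for m
  proof -
    have "m \<odot> \<iota> 1 = (m mod n + (m div n) * n) \<odot> \<iota> 1" by simp
    also have "\<dots> = (m mod n) \<odot> \<iota> 1 + (m div n) \<odot> n \<odot> \<iota> 1" by (simp only: imul_add_left imul_imul)
    also have "\<dots> = \<iota> (m mod n)" using n1 eq[of "m mod n"] n by simp
    finally show ?thesis .
  qed
  have "m \<odot> \<iota> 1 = 0 \<longleftrightarrow> n dvd m" for m
  proof -
    have "m \<odot> \<iota> 1 = 0 \<longleftrightarrow> \<iota> (m mod n) = \<iota> 0" by (simp add: red i0)
    also have "\<dots> \<longleftrightarrow> m mod n = 0" using inj_on_eq_iff[OF inj, of "m mod n" 0] n by (simp add: car)
    finally show ?thesis by (simp add: dvd_eq_mod_eq_0)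
  qed
  then show "has_order (\<iota> 1) (nat n)" using n by (simp add: has_order_def)
qed

lemma move_U_FS:
  assumes "move_U A A'"
  shows "\<exists>s. FS A' = translate (FS A) s"
proof -
  obtain n :: int and a b \<iota> where n: "odd n" "3 \<le> n" and ab: "a \<in> Units (residue_ring n)" "b \<in> Units (residue_ring n)"
    and \<iota>: "\<iota> \<in> hom (add_monoid (residue_ring n)) add_grp" "inj_on \<iota> (carrier (residue_ring n))"
    and sub: "mset_set (\<iota> ` unit_U n a) \<subseteq># A"
    and A': "A' = (A - mset_set (\<iota> ` unit_U n a)) + mset_set (\<iota> ` unit_U n b)"
    using assms by (auto simp: move_U_def)
  define m where "m = nat n"
  have nm: "n = int m" "odd m" "3 \<le> m" using n by (auto simp: m_def even_nat_iff)
  note h = residue_hom_eq_imul[OF n(2) \<iota>]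
  have g: "has_order (\<iota> 1) m" using h(1) by (simp add: m_def)
  have c: "coprime a (int m)" "coprime b (int m)" using coprime_of_Units[of n] ab n nm(1) by auto
  have Ua: "mset_set (\<iota> ` unit_U n a) = doubling_orbit m (a \<odot> \<iota> 1)"
    unfolding nm(1) by (rule unit_U_image[OF g _ nm(2,3) c(1)]) (use h(2) nm(1) in auto)
  have Ub: "mset_set (\<iota> ` unit_U n b) = doubling_orbit m (b \<odot> \<iota> 1)"
    unfolding nm(1) by (rule unit_U_image[OF g _ nm(2,3) c(2)]) (use h(2) nm(1) in auto)
  obtain s where "FS (doubling_orbit m (b \<odot> \<iota> 1)) = translate (FS (doubling_orbit m (a \<odot> \<iota> 1))) s"
    using FS_doubling_orbit_translate[OF g nm(2,3) c] by blast
  from FS_translate_union[OF this, of "A - doubling_orbit m (a \<odot> \<iota> 1)"]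
  have "FS A' = translate (FS A) s" using sub unfolding A' Ua Ub by simp
  then show ?thesis by blast
qed

definition move :: "'a::ab_group_add multiset \<Rightarrow> 'a multiset \<Rightarrow> bool" where
  "move A A' \<longleftrightarrow> move_neg A A' \<or> move_U A A'"

lemma move_FS: "move A A' \<Longrightarrow> \<exists>s. FS A' = translate (FS A) s"
  unfolding move_def using move_neg_FS move_U_FS by blast

lemma moves_FS: "move\<^sup>*\<^sup>* A A' \<Longrightarrow> \<exists>s. FS A' = translate (FS A) s"
proof (induction rule: rtranclp_induct)
  case base show ?case by (intro exI[of _ 0]) simp
next
  case (step B C)
  then obtain s t where "FS B = translate (FS A) s" "FS C = translate (FS B) t" using move_FS by blast
  then show ?case by (intro exI[of _ "s + t"]) (simp add: translate_translate)
qed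

section \<open>Sufficiency of the linear conditions\<close>

text \<open>The invariant of sign changes: its multiplicities for A and B differ by \<nu>. The size
  of \<open>symm A - symm B\<close>, the sum of the positive part of \<nu>, is the measure of the
  induction below.\<close>

definition symm :: "'a::ab_group_add multiset \<Rightarrow> 'a multiset" where
  "symm A = A + image_mset uminus A"

lemma count_symm: "count (symm A) x = count A x + count A (- x)"
proof -
  have "count (image_mset uminus A) x = count A (- x)"
    by (induction A) (auto simp: equation_minus_iff)
  then show ?thesis by (simp add: symm_def)
qed

lemma symm_flip: "g \<in># A \<Longrightarrow> symm (A - {#g#} + {#- g#}) = symm A"
  by (auto dest!: multi_member_split simp: symm_def)

text \<open>A missing x(k) is present as - x(k) and is flipped. No earlier x(i) equals - x(k), so
  those already collected are untouched.\<close>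

lemma moves_collect:
  fixes x :: "nat \<Rightarrow> 'a::ab_group_add"
  assumes "\<And>i j. i < k \<Longrightarrow> j < k \<Longrightarrow> x i \<noteq> - x j" and "\<And>i. i < k \<Longrightarrow> count (symm A) (x i) > 0"
  shows "\<exists>A'. move\<^sup>*\<^sup>* A A' \<and> symm A' = symm A \<and> (\<forall>i<k. x i \<in># A')"
  using assms
proof (induction k)
  case (Suc k)
  then obtain A' where A': "move\<^sup>*\<^sup>* A A'" "symm A' = symm A" "\<And>i. i < k \<Longrightarrow> x i \<in># A'" by auto
  show ?case
  proof (cases "x k \<in># A'")
    case True
    then show ?thesis using A' less_Suc_eq by metis
  next
    case False
    then have "count A' (x k) = 0" by (simp add: not_in_iff)
    moreover have "count (symm A') (x k) > 0" unfolding A'(2) by (rule Suc.prems(2)) simp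
    ultimately have "count A' (- x k) > 0" unfolding count_symm by linarith
    then have m: "- x k \<in># A'" by (simp add: count_greater_zero_iff[symmetric] del: count_greater_zero_iff)
    define A'' where "A'' = A' - {#- x k#} + {#- (- x k)#}"
    have "move A' A''" unfolding move_def move_neg_def A''_def using m by blast
    then have "move\<^sup>*\<^sup>* A A''" using A'(1) by simp
    moreover have "symm A'' = symm A" using symm_flip[OF m] A'(2) by (simp add: A''_def)
    moreover have "x i \<in># A''" if "i < Suc k" for i
    proof (cases "i = k")
      case False
      then have "x i \<in># A'" "x i \<noteq> - x k" using A'(3) that Suc.prems(1)[of i k] by auto
      then show ?thesis by (simp add: A''_def in_diff_count)
    qed (simp add: A''_def)
    ultimately show ?thesis by blast
  qed
qed auto

text \<open>An excess of x in A over B is matched by a deficit of - x, so flipping one x lowers the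
  number of surplus elements.\<close>

lemma moves_of_symm_eq:
  assumes "symm A = symm B"
  shows "move\<^sup>*\<^sup>* A B"
  using assms
proof (induction "size (A - B)" arbitrary: A rule: less_induct)
  case less
  have c: "count A x + count A (- x) = count B x + count B (- x)" for x
    using less.prems count_symm by metis
  show ?case
  proof (cases "A - B = {#}")
    case True
    then have le: "count A x \<le> count B x" for x by (metis Diff_eq_empty_iff_mset mset_subset_eq_count)
    have "A = B" using c le by (intro multiset_eqI) (metis add_le_cancel_left add_mono_thms_linordered_semiring(1) le_antisym add_le_imp_le_right)
    then show ?thesis by simp
  next
    case False
    then obtain x where "x \<in># A - B" by auto
    then have x: "count A x > count B x" by (simp add: in_diff_count)
    then have mx: "count A (- x) < count B (- x)" using c[of x] by simp
    have ne: "x \<noteq> - x" using x mx by (metis less_asym)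
    have xA: "x \<in># A" using x by (metis count_inI less_nat_zero_code)
    define A' where "A' = A - {#x#} + {#- x#}"
    have "move A A'" unfolding move_def move_neg_def A'_def using xA by blast
    have "A' - B = A - B - {#x#}"
      using ne x mx by (intro multiset_eqI) (auto simp: A'_def)
    then have "size (A' - B) < size (A - B)"
      using size_Diff1_less[OF \<open>x \<in># A - B\<close>] by simp
    moreover have "symm A' = symm B" using symm_flip[OF xA] less.prems by (simp add: A'_def)
    ultimately have "move\<^sup>*\<^sup>* A' B" by (rule less.hyps)
    then show ?thesis using \<open>move A A'\<close> by (rule converse_rtranclp_into_rtranclp[rotated])
  qed
qed

lemma V_add:
  assumes "f \<in> V" "g \<in> V"
  shows "(\<lambda>x. f x + g x) \<in> V"
proof -
  have fin: "finite {x. f x \<noteq> 0}" "finite {x. g x \<noteq> 0}" using assms by (auto simp: V_def)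
  have fin': "finite {x. f x + g x \<noteq> 0}"
    by (rule finite_subset[OF _ finite_UnI[OF fin]]) auto
  have "(\<Sum>x | x \<in> H \<and> f x + g x \<noteq> 0. f x + g x) = 0" if H: "subgroup H add_grp" for H
  proof -
    let ?X = "H \<inter> ({x. f x \<noteq> 0} \<union> {x. g x \<noteq> 0})"
    have X: "finite ?X" using fin by simp
    have "(\<Sum>x | x \<in> H \<and> f x + g x \<noteq> 0. f x + g x) = (\<Sum>x\<in>?X. f x + g x)"
      using X by (intro sum.mono_neutral_left) auto
    also have "\<dots> = (\<Sum>x\<in>?X. f x) + (\<Sum>x\<in>?X. g x)" by (rule sum.distrib)
    also have "(\<Sum>x\<in>?X. f x) = (\<Sum>x | x \<in> H \<and> f x \<noteq> 0. f x)"
      using X by (intro sum.mono_neutral_right) auto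
    also have "(\<Sum>x\<in>?X. g x) = (\<Sum>x | x \<in> H \<and> g x \<noteq> 0. g x)"
      using X by (intro sum.mono_neutral_right) auto
    finally show ?thesis using assms H by (simp add: V_def)
  qed
  moreover have "f x + g x + (f (- x) + g (- x)) = f (x + x) + g (x + x) + (f (- (x + x)) + g (- (x + x)))" for x
  proof -
    have "f x + f (- x) = f (x + x) + f (- (x + x))" using assms(1) unfolding V_def by blast
    moreover have "g x + g (- x) = g (x + x) + g (- (x + x))" using assms(2) unfolding V_def by blast
    ultimately show ?thesis by linarith
  qed
  ultimately show ?thesis unfolding V_def using fin' by blast
qed

lemma has_order_exists:
  assumes "k > 0" "int k \<odot> g = 0"
  shows "\<exists>n. has_order g n"
proof -
  define n where "n = (LEAST n. n > 0 \<and> int n \<odot> g = 0)"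
  have "n > 0 \<and> int n \<odot> g = 0" unfolding n_def by (rule LeastI[of _ k]) (use assms in simp)
  then have n: "n > 0" "int n \<odot> g = 0" by auto
  have least: "\<not> (m > 0 \<and> int m \<odot> g = 0)" if "m < n" for m
    using not_less_Least[OF that[unfolded n_def]] .
  have "m \<odot> g = 0 \<longleftrightarrow> int n dvd m" for m
  proof -
    have "m \<odot> g = ((m div int n) * int n + m mod int n) \<odot> g" by simp
    also have "\<dots> = (m div int n) \<odot> int n \<odot> g + (m mod int n) \<odot> g" by (simp only: imul_add_left imul_imul)
    finally have e: "m \<odot> g = (m mod int n) \<odot> g" using n by simp
    have "m mod int n = 0" if "(m mod int n) \<odot> g = 0"
    proof -
      have r: "0 \<le> m mod int n" "m mod int n < int n" using n by simp_all
      then have "\<not> (nat (m mod int n) > 0 \<and> int (nat (m mod int n)) \<odot> g = 0)" by (intro least) (simp add: nat_less_iff)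
      then show ?thesis using r that by simp
    qed
    then have "(m mod int n) \<odot> g = 0 \<longleftrightarrow> m mod int n = 0" by auto
    then show ?thesis unfolding e dvd_eq_mod_eq_0 .
  qed
  then show ?thesis using n by (auto simp: has_order_def)
qed

lemma subgroup_multiples: "subgroup (range (\<lambda>m. m \<odot> y)) (add_grp :: 'a::ab_group_add monoid)"
proof (rule group.subgroupI[OF group_add_grp])
  show "inv\<^bsub>add_grp\<^esub> x \<in> range (\<lambda>m. m \<odot> y)" if "x \<in> range (\<lambda>m. m \<odot> y)" for x
    using that by (auto simp: imul_minus_left[symmetric])
  show "x \<otimes>\<^bsub>add_grp\<^esub> z \<in> range (\<lambda>m. m \<odot> y)" if "x \<in> range (\<lambda>m. m \<odot> y)" "z \<in> range (\<lambda>m. m \<odot> y)" for x z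
    using that by (auto simp: imul_add_left[symmetric])
qed auto

text \<open>Only the generators of the cyclic group remain: for d dividing n, the multiples of d g
  form a subgroup, on which \<mu> has sum 0, and \<open>coprime_sum_zero\<close> isolates the
  units.\<close>

lemma V_coprime_sum_zero:
  fixes g :: "'a::ab_group_add"
  assumes \<mu>: "\<mu> \<in> V" and g: "has_order g n"
  shows "(\<Sum>j | j < n \<and> coprime j n. \<mu> (int j \<odot> g) + \<mu> (- (int j \<odot> g))) = 0"
proof (rule coprime_sum_zero)
  show "n > 0" using g by (simp add: has_order_def)
  fix d assume "d dvd n"
  then obtain e where e: "n = d * e" by auto
  have de: "d > 0" "e > 0" using e g by (auto simp: has_order_def)
  define y where "y = int d \<odot> g"
  have y: "has_order y e"
    using g de by (auto simp: has_order_def y_def imul_imul e mult.commute[of _ "int d"])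
  define H where "H = range (\<lambda>m. m \<odot> y)"
  have H: "(\<lambda>j. int j \<odot> y) ` {..<e} = H" unfolding H_def by (rule has_order_cyclic(2)[OF y])
  then have finH: "finite H" by (metis finite_imageI finite_lessThan)
  have neg: "- x \<in> H" if "x \<in> H" for x using that by (auto simp: H_def imul_minus_left[symmetric])
  have bij: "bij_betw uminus H H" using neg by (intro bij_betwI[of _ _ _ uminus]) auto
  have "(\<Sum>x | x \<in> H \<and> \<mu> x \<noteq> 0. \<mu> x) = 0" using \<mu> subgroup_multiples[of y] by (simp add: V_def H_def)
  moreover have "(\<Sum>x | x \<in> H \<and> \<mu> x \<noteq> 0. \<mu> x) = (\<Sum>x\<in>H. \<mu> x)"
    using finH by (intro sum.mono_neutral_left) auto
  ultimately have z: "(\<Sum>x\<in>H. \<mu> x) = 0" by simp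
  have "(\<Sum>j<n div d. \<mu> (int (d * j) \<odot> g) + \<mu> (- (int (d * j) \<odot> g))) = (\<Sum>j<e. \<mu> (int j \<odot> y) + \<mu> (- (int j \<odot> y)))"
    using de by (simp add: e y_def imul_imul mult.commute)
  also have "\<dots> = (\<Sum>x\<in>H. \<mu> x + \<mu> (- x))"
    unfolding H[symmetric] by (subst sum.reindex[OF has_order_cyclic(1)[OF y]]) simp
  also have "\<dots> = 0" using sum.reindex_bij_betw[OF bij, of \<mu>] z by (simp add: sum.distrib)
  finally show "(\<Sum>j<n div d. \<mu> (int (d * j) \<odot> g) + \<mu> (- (int (d * j) \<odot> g))) = 0" .
qed

lemma imul_hom:
  assumes "has_order g n" "n \<ge> 3"
  shows "(\<lambda>x. x \<odot> g) \<in> hom (add_monoid (residue_ring (int n))) add_grp"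
    "inj_on (\<lambda>x. x \<odot> g) (carrier (residue_ring (int n)))"
proof -
  have "((x + y) mod int n) \<odot> g = x \<odot> g + y \<odot> g" for x y
    unfolding imul_add_left[symmetric] has_order_eq_iff[OF assms(1)] by simp
  then show "(\<lambda>x. x \<odot> g) \<in> hom (add_monoid (residue_ring (int n))) add_grp"
    by (intro homI) (auto simp: residue_ring_def)
  show "inj_on (\<lambda>x. x \<odot> g) (carrier (residue_ring (int n)))"
    by (rule inj_onI) (simp add: has_order_eq_iff[OF assms(1)] residue_ring_def)
qed

lemma count_doubling_orbit:
  assumes y: "has_order y n" and n: "odd n" "3 \<le> n"
  shows "doubling_orbit n y = mset_set ((\<lambda>i. (2 ^ i) \<odot> y) ` {..<U_exp (int n)})"
    "count (doubling_orbit n y) x + count (doubling_orbit n y) (- x) \<le> 1"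
    "y \<in># doubling_orbit n y"
proof -
  let ?O = "(\<lambda>i. (2 ^ i) \<odot> y) ` {..<U_exp (int n)}"
  show e: "doubling_orbit n y = mset_set ?O"
    unfolding doubling_orbit_def using doubling_orbit_distinct(2)[OF y n]
    by (intro image_mset_mset_set inj_onI) auto
  have "\<not> (x \<in> ?O \<and> - x \<in> ?O)"
  proof
    assume "x \<in> ?O \<and> - x \<in> ?O"
    then obtain i j where "i < U_exp (int n)" "j < U_exp (int n)" "x = (2 ^ i) \<odot> y" "- x = (2 ^ j) \<odot> y" by auto
    then show False using doubling_orbit_distinct(1)[OF y n, of i j] by (metis minus_minus)
  qed
  then show "count (doubling_orbit n y) x + count (doubling_orbit n y) (- x) \<le> 1"
    unfolding e by (auto simp: count_mset_set' simp del: count_mset_set)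
  have "0 < U_exp (int n)" using U_exp_props(1)[of "int n"] n by simp
  then show "y \<in># doubling_orbit n y" unfolding e by (auto intro!: image_eqI[of _ _ 0])
qed

text \<open>On the orbit of y = j1 g0 the function \<nu> is constant and positive, so A contains
  each of its elements up to sign and flips collect the whole orbit. It is then replaced by the
  orbit of z = j2 g0, on which \<nu> is negative.\<close>

lemma exchange_step:
  fixes A B :: "'a::ab_group_add multiset"
  assumes \<mu>: "(\<lambda>g. int (count A g) - int (count B g)) \<in> V" and g0: "has_order g0 n" and n: "odd n" "3 \<le> n"
    and j: "coprime j1 n" "coprime j2 n" "j1 < n" "j2 < n"
    and pos: "count (symm A) (int j1 \<odot> g0) > count (symm B) (int j1 \<odot> g0)"
    and neg: "count (symm A) (int j2 \<odot> g0) < count (symm B) (int j2 \<odot> g0)"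
  shows "\<exists>A'. move\<^sup>*\<^sup>* A A' \<and> size (symm A' - symm B) < size (symm A - symm B)"
proof -
  define \<nu> where "\<nu> = (\<lambda>x. int (count (symm A) x) - int (count (symm B) x))"
  have double: "\<nu> (x + x) = \<nu> x" for x
  proof -
    have "int (count A x) - int (count B x) + (int (count A (- x)) - int (count B (- x)))
       = int (count A (x + x)) - int (count B (x + x)) + (int (count A (- (x + x))) - int (count B (- (x + x))))"
      using \<mu> unfolding V_def by blast
    then show ?thesis by (simp add: \<nu>_def count_symm)
  qed
  have pow: "\<nu> ((2 ^ i) \<odot> x) = \<nu> x" for i and x :: 'a
    using double by (rule double_invariant_pow2)
  have nu_minus: "\<nu> (- x) = \<nu> x" for x by (simp add: \<nu>_def count_symm)
  have c: "coprime (int j1) (int n)" "coprime (int j2) (int n)" using j by simp_all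
  define y z where "y = int j1 \<odot> g0" and "z = int j2 \<odot> g0"
  note oy = has_order_imul_coprime(1)[OF g0 c(1), folded y_def]
  note oz = has_order_imul_coprime(1)[OF g0 c(2), folded z_def]
  note Oy = count_doubling_orbit[OF oy n]
  note Oz = count_doubling_orbit[OF oz n]
  have y: "\<nu> y > 0" and z: "\<nu> z < 0" using pos neg by (simp_all add: \<nu>_def y_def z_def)
  let ?k = "U_exp (int n)"
  have "\<exists>A'. move\<^sup>*\<^sup>* A A' \<and> symm A' = symm A \<and> (\<forall>i<?k. (2 ^ i) \<odot> y \<in># A')"
  proof (rule moves_collect)
    fix i
    have "\<nu> ((2 ^ i) \<odot> y) > 0" using pow[of y i] y by simp
    then show "count (symm A) ((2 ^ i) \<odot> y) > 0" unfolding \<nu>_def by linarith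
  qed (use doubling_orbit_distinct(1)[OF oy n] in blast)
  then obtain A1 where A1: "move\<^sup>*\<^sup>* A A1" "symm A1 = symm A" "\<And>i. i < ?k \<Longrightarrow> (2 ^ i) \<odot> y \<in># A1" by blast
  have sub: "doubling_orbit n y \<subseteq># A1"
  proof -
    have "doubling_orbit n y \<subseteq># mset_set (set_mset A1)"
      unfolding Oy(1) by (rule subset_imp_msubset_mset_set) (use A1(3) in auto)
    also have "\<dots> \<subseteq># A1" by (rule mset_set_set_mset_msubset)
    finally show ?thesis .
  qed
  define A2 where "A2 = (A1 - doubling_orbit n y) + doubling_orbit n z"
  have U1: "mset_set ((\<lambda>x. x \<odot> g0) ` unit_U (int n) (int j1)) = doubling_orbit n y"
    unfolding y_def by (rule unit_U_image[OF g0 _ n c(1)]) simp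
  have U2: "mset_set ((\<lambda>x. x \<odot> g0) ` unit_U (int n) (int j2)) = doubling_orbit n z"
    unfolding z_def by (rule unit_U_image[OF g0 _ n c(2)]) simp
  have jpos: "0 < j1" "0 < j2" using j n by (auto intro!: Nat.gr0I)
  have "int j1 \<in> Units (residue_ring (int n))" "int j2 \<in> Units (residue_ring (int n))"
    using n jpos j c by (auto intro!: Units_of_coprime)
  moreover have "odd (int n)" "3 \<le> int n" using n by auto
  ultimately have "move_U A1 A2"
    unfolding move_U_def A2_def using imul_hom[OF g0 n(2)] sub U1 U2
    by - (rule exI[of _ "int n"], rule exI[of _ "int j1"], rule exI[of _ "int j2"],
        rule exI[of _ "\<lambda>x. x \<odot> g0"], simp)
  then have "move A1 A2" by (simp add: move_def)
  with A1(1) have "move\<^sup>*\<^sup>* A A2" by (rule rtranclp.rtrancl_into_rtrancl)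
  moreover have "size (symm A2 - symm B) < size (symm A - symm B)"
  proof (rule mset_subset_size)
    \<comment> \<open>The multiplicities of the two orbits closed up under negation, that is, their
      effect on \<open>symm\<close>.\<close>
    define cy cz where "cy = (\<lambda>x. count (doubling_orbit n y) x + count (doubling_orbit n y) (- x))"
      and "cz = (\<lambda>x. count (doubling_orbit n z) x + count (doubling_orbit n z) (- x))"
    have s2: "count (symm A2) x = count (symm A) x - cy x + cz x" for x
    proof -
      have "count (doubling_orbit n y) w \<le> count A1 w" for w
        using sub by (rule mset_subset_eq_count)
      from this[of x] this[of "- x"] show ?thesis unfolding A1(2)[symmetric] by (simp add: count_symm A2_def cy_def cz_def)
    qed
    have orb: "\<nu> x = \<nu> w" if "count (doubling_orbit n w) x + count (doubling_orbit n w) (- x) > 0" for x w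
    proof -
      have "x \<in># doubling_orbit n w \<or> - x \<in># doubling_orbit n w" using that by (metis add_is_0 less_irrefl not_in_iff)
      then obtain i where "x = (2 ^ i) \<odot> w \<or> - x = (2 ^ i) \<odot> w" by (auto simp: doubling_orbit_def)
      then show ?thesis using pow[of w i] nu_minus[of x] by auto
    qed
    have cy: "cy x \<le> 1" "cy x > 0 \<Longrightarrow> \<nu> x > 0" for x using Oy(2) orb[of y x] y by (auto simp: cy_def)
    have cz: "cz x \<le> 1" "cz x > 0 \<Longrightarrow> \<nu> x < 0" for x using Oz(2) orb[of z x] z by (auto simp: cz_def)
    \<comment> \<open>Where \<open>cz\<close> is 1, \<nu> is negative, so one more element still
      does not exceed \<open>symm B\<close> and the truncated difference stays 0.\<close>
    have le: "count (symm A2 - symm B) x \<le> count (symm A - symm B) x" for x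
      using cy[of x] cz[of x] unfolding \<nu>_def count_diff s2
      by (cases "cy x = 0"; cases "cz x = 0") auto
    have cyy: "cy y > 0" using Oy(3) by (simp add: cy_def)
    have "cz y = 0" using cz(2)[of y] y by force
    then have lt: "count (symm A2 - symm B) y < count (symm A - symm B) y"
      using cy(1)[of y] cyy y by (auto simp: s2 \<nu>_def)
    show "symm A2 - symm B \<subset># symm A - symm B"
      using le lt by (metis mset_subset_eqI subset_mset.le_less less_irrefl)
  qed
  ultimately show ?thesis by blast
qed

lemma V_imp_moves:
  fixes A B :: "'a::ab_group_add multiset"
  assumes no_order_two: "\<And>g::'a. g + g = 0 \<Longrightarrow> g = 0"
    and "(\<lambda>g. int (count A g) - int (count B g)) \<in> V"
  shows "move\<^sup>*\<^sup>* A B"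
  using assms(2)
proof (induction "size (symm A - symm B)" arbitrary: A rule: less_induct)
  case less
  define \<mu> where "\<mu> = (\<lambda>g. int (count A g) - int (count B g))"
  define \<nu> where "\<nu> = (\<lambda>x. \<mu> x + \<mu> (- x))"
  have \<mu>: "\<mu> \<in> V" using less.prems by (simp add: \<mu>_def)
  have \<nu>_symm: "\<nu> x = int (count (symm A) x) - int (count (symm B) x)" for x
    by (simp add: \<nu>_def \<mu>_def count_symm)
  show ?case
  proof (cases "\<forall>x. \<nu> x = 0")
    case True
    then have "symm A = symm B" by (intro multiset_eqI) (simp add: \<nu>_symm)
    then show ?thesis by (rule moves_of_symm_eq)
  next
    case False
    then obtain g0 where g0: "\<nu> g0 \<noteq> 0" by blast
    have double: "\<nu> (x + x) = \<nu> x" for x using \<mu> unfolding V_def \<nu>_def by auto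
    have fin: "finite {x. \<nu> x \<noteq> 0}"
    proof (rule finite_subset)
      show "{x. \<nu> x \<noteq> 0} \<subseteq> set_mset (symm A) \<union> set_mset (symm B)"
        by (auto simp: \<nu>_symm not_in_iff)
    qed simp
    obtain k where k: "odd k" "int k \<odot> g0 = 0"
      using double_invariant_torsion[of \<nu> g0, OF no_order_two fin double g0] by blast
    obtain n where n: "has_order g0 n" using has_order_exists[of k g0] k odd_pos by blast
    then have "int n dvd int k" using k by (simp add: has_order_def)
    then have "odd n" using k(1) by (auto dest: dvd_trans)
    \<comment> \<open>The trivial subgroup in the definition of \<open>V\<close> gives \<mu>(0) = 0,
      so g0 is not 0.\<close>
    have "n \<noteq> 1"
    proof
      assume "n = 1"
      then have "1 \<odot> g0 = 0" using n unfolding has_order_def by (metis of_nat_1 dvd_refl)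
      then have "g0 = 0" by simp
      have "subgroup {0} (add_grp :: 'a monoid)"
        using subgroup_multiples[of "0::'a"] by simp
      then have "(\<Sum>g | g \<in> {0} \<and> \<mu> g \<noteq> 0. \<mu> g) = 0" using \<mu> unfolding V_def by blast
      moreover have "{g. g \<in> {0} \<and> \<mu> g \<noteq> 0} = (if \<mu> 0 = 0 then {} else {0})" by auto
      ultimately have "\<mu> 0 = 0" by (simp split: if_splits)
      then show False using g0 \<open>g0 = 0\<close> by (simp add: \<nu>_def)
    qed
    then have n3: "3 \<le> n" using \<open>odd n\<close> by (metis One_nat_def Suc_leI le_neq_implies_less numeral_3_eq_3 odd_pos even_numeral numeral_2_eq_2)
    let ?J = "{j. j < n \<and> coprime j n}"
    have J: "finite ?J" "1 \<in> ?J" using n3 by auto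
    \<comment> \<open>The term j = 1 is \<nu>(g0), which is not 0; a vanishing sum therefore has
      terms of both signs.\<close>
    have sum0: "(\<Sum>j\<in>?J. \<nu> (int j \<odot> g0)) = 0" using V_coprime_sum_zero[OF \<mu> n] by (simp add: \<nu>_def)
    have "\<exists>j\<in>?J. \<nu> (int j \<odot> g0) > 0"
    proof (rule ccontr)
      assume "\<not> (\<exists>j\<in>?J. \<nu> (int j \<odot> g0) > 0)"
      then have "\<forall>j\<in>?J. - \<nu> (int j \<odot> g0) = 0"
        using sum0 J(1) by (subst sum_nonneg_eq_0_iff[symmetric]) (auto simp: not_less sum_negf)
      then have "\<forall>j\<in>?J. \<nu> (int j \<odot> g0) = 0" by simp
      then show False using J(2) g0 by (metis imul_1_left of_nat_1)
    qed
    then obtain j1 where j1: "j1 < n" "coprime j1 n" "\<nu> (int j1 \<odot> g0) > 0" by auto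
    have "\<exists>j\<in>?J. \<nu> (int j \<odot> g0) < 0"
    proof (rule ccontr)
      assume "\<not> (\<exists>j\<in>?J. \<nu> (int j \<odot> g0) < 0)"
      then have "\<forall>j\<in>?J. \<nu> (int j \<odot> g0) = 0" using sum0 J(1) by (subst sum_nonneg_eq_0_iff[symmetric]) (auto simp: not_less)
      then show False using J(2) g0 by (metis imul_1_left of_nat_1)
    qed
    then obtain j2 where j2: "j2 < n" "coprime j2 n" "\<nu> (int j2 \<odot> g0) < 0" by auto
    have "\<exists>A'. move\<^sup>*\<^sup>* A A' \<and> size (symm A' - symm B) < size (symm A - symm B)"
      by (rule exchange_step[OF less.prems n \<open>odd n\<close> n3 j1(2) j2(2) j1(1) j2(1)])
         (use j1(3) j2(3) in \<open>simp_all add: \<nu>_symm\<close>)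
    then obtain A' where A': "move\<^sup>*\<^sup>* A A'" "size (symm A' - symm B) < size (symm A - symm B)" by blast
    \<comment> \<open>Membership in \<open>V\<close> for the new difference comes from the necessity
      direction, applied to A' and A.\<close>
    obtain s where "FS A' = translate (FS A) s" using moves_FS[OF A'(1)] by blast
    from V_add[OF FS_translate_imp_V[OF no_order_two this] \<mu>]
    have "(\<lambda>g. int (count A' g) - int (count B g)) \<in> V" by (simp add: \<mu>_def)
    from less.hyps[OF A'(2) this] show ?thesis using A'(1) by simp
  qed
qed

section \<open>Sums of multisets and the total translation\<close>

lemma sum_count_imul:
  assumes "finite S" "set_mset A \<subseteq> S"
  shows "(\<Sum>x\<in>S. int (count A x) \<odot> x) = sum_mset A"
  using assms(2)
proof (induction A)
  case (add a A)
  then have "(\<Sum>x\<in>S. int (count (add_mset a A) x) \<odot> x) = (\<Sum>x\<in>S. int (count A x) \<odot> x + (if x = a then x else 0))"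
    by (intro sum.cong) (auto simp: imul_Suc simp del: of_nat_Suc)
  also have "\<dots> = (\<Sum>x\<in>S. int (count A x) \<odot> x) + a"
    using add.prems assms(1) by (simp add: sum.distrib)
  finally show ?case using add by (simp add: add.commute)
qed simp

lemma sum_diff_imul:
  "(\<Sum>g | int (count A g) - int (count B g) \<noteq> 0. (int (count A g) - int (count B g)) \<odot> g) = sum_mset A - sum_mset B"
proof -
  let ?S = "set_mset A \<union> set_mset B"
  have "(\<Sum>g | int (count A g) - int (count B g) \<noteq> 0. (int (count A g) - int (count B g)) \<odot> g)
      = (\<Sum>g\<in>?S. (int (count A g) - int (count B g)) \<odot> g)"
    by (intro sum.mono_neutral_left) (auto simp: not_in_iff)
  also have "\<dots> = (\<Sum>g\<in>?S. int (count A g) \<odot> g) - (\<Sum>g\<in>?S. int (count B g) \<odot> g)"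
    by (simp add: imul_diff_left sum_subtractf)
  also have "\<dots> = sum_mset A - sum_mset B" by (simp add: sum_count_imul)
  finally show ?thesis .
qed

text \<open>Sizes agree because \<open>FS\<close> has 2^|A| elements. Twice the sum over
  \<open>FS\<close> is 2^|A| times the sum of A, and multiplication by 2^|A| is injective.\<close>

lemma FS_eq_imp_sum_eq:
  fixes A B :: "'a::ab_group_add multiset"
  assumes no_order_two: "\<And>g::'a. g + g = 0 \<Longrightarrow> g = 0" and "FS A = FS B"
  shows "sum_mset A = sum_mset B"
proof -
  have "(2::nat) ^ size A = 2 ^ size B" using size_FS[of A] size_FS[of B] assms(2) by simp
  then have "size A = size B" by simp
  then have "(2 ^ size A) \<odot> sum_mset A = (2 ^ size A) \<odot> sum_mset B"
    using sum_FS[of A] sum_FS[of B] assms(2) by simp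
  then have "(2 ^ size A) \<odot> (sum_mset A + - sum_mset B) = 0" by (simp only: imul_add_right imul_minus_right) simp
  then have "sum_mset A + - sum_mset B = 0" by (rule imul_pow2_zero[rotated]) (erule no_order_two)
  then show ?thesis by simp
qed

text \<open>A translation by s changes the sum over \<open>FS\<close> by 2^|A| s, while equal sums
  of A and B give equal doubled sums over \<open>FS\<close>; hence 2^(|A|+1) s = 0.\<close>

lemma FS_translate_shift_zero:
  fixes A B :: "'a::ab_group_add multiset"
  assumes no_order_two: "\<And>g::'a. g + g = 0 \<Longrightarrow> g = 0" and FS: "FS B = translate (FS A) s" and sum: "sum_mset A = sum_mset B"
  shows "s = 0"
proof -
  have "(2::nat) ^ size A = 2 ^ size B" using size_FS[of A] size_FS[of B] FS by simp
  then have sz: "size A = size B" by simp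
  have "sum_mset (FS B) = sum_mset (FS A) + (2 ^ size A) \<odot> s"
    using FS sum_translate[of "FS A" s] by (simp add: size_FS)
  then have "(2 ^ size B) \<odot> sum_mset B = (2 ^ size A) \<odot> sum_mset A + 2 \<odot> (2 ^ size A) \<odot> s"
    unfolding sum_FS[symmetric] imul_2 by simp
  then have "(2 ^ Suc (size A)) \<odot> s = 0" using sz sum by (simp add: imul_imul)
  then show ?thesis by (rule imul_pow2_zero[rotated]) (erule no_order_two)
qed

lemma FS_translate_sequence:
  assumes "\<And>i. i < m \<Longrightarrow> FS (E (Suc i)) = translate (FS (E i)) (s i)"
  shows "FS (E m) = translate (FS (E 0)) (\<Sum>i<m. s i)"
  using assms by (induction m) (simp_all add: translate_translate)

theorem theorem1p6:
  fixes A B :: "'a::ab_group_add multiset" and \<mu> :: "'a \<Rightarrow> int"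
  assumes no_order_two: "\<And>g::'a. g + g = 0 \<Longrightarrow> g = 0"
    and mu: "\<mu> = (\<lambda>g. int (count A g) - int (count B g))"
  shows "(FS A = FS B \<longleftrightarrow>
            \<mu> \<in> V \<and> (\<Sum>g | \<mu> g \<noteq> 0. g [^]\<^bsub>add_grp\<^esub> \<mu> g) = 0) \<and>
         (FS A = FS B \<longleftrightarrow>
            (\<exists>(m::nat) (E :: nat \<Rightarrow> 'a multiset) (s :: nat \<Rightarrow> 'a).
               E 0 = A \<and> E m = B \<and>
               (\<forall>i<m. move_neg (E i) (E (Suc i)) \<or> move_U (E i) (E (Suc i))) \<and>
               (\<forall>i<m. FS (E (Suc i)) = translate (FS (E i)) (s i)) \<and>
               (\<Sum>i<m. s i) = 0))"
    (is "(?i \<longleftrightarrow> ?ii) \<and> (?i \<longleftrightarrow> ?iii)")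
proof -
  have sum: "(\<Sum>g | \<mu> g \<noteq> 0. g [^]\<^bsub>add_grp\<^esub> \<mu> g) = sum_mset A - sum_mset B"
    unfolding mu by (rule sum_diff_imul)
  have i_ii: ?ii if ?i
  proof -
    have "FS A = translate (FS B) 0" using that by simp
    then have "\<mu> \<in> V" unfolding mu by (rule FS_translate_imp_V[rotated]) (erule no_order_two)
    then show ?ii using sum FS_eq_imp_sum_eq[OF no_order_two that] by simp
  qed
  have ii_iii: ?iii if ?ii
  proof -
    have "move\<^sup>*\<^sup>* A B" using V_imp_moves[OF no_order_two] that mu by blast
    then obtain m where "(move ^^ m) A B" by (metis rtranclp_imp_relpowp)
    then obtain E where E: "E 0 = A" "E m = B" "\<And>i. i < m \<Longrightarrow> move (E i) (E (Suc i))"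
      unfolding relpowp_fun_conv by blast
    have "\<exists>t. i < m \<longrightarrow> FS (E (Suc i)) = translate (FS (E i)) t" for i using move_FS[OF E(3)] by blast
    then obtain s where s: "\<And>i. i < m \<Longrightarrow> FS (E (Suc i)) = translate (FS (E i)) (s i)" by metis
    \<comment> \<open>The individual shifts are arbitrary choices; only their total is determined,
      and equality of the two sums makes it 0.\<close>
    have "FS B = translate (FS A) (\<Sum>i<m. s i)" using FS_translate_sequence[of m E s, OF s] E by simp
    moreover have "sum_mset A = sum_mset B" using that sum by simp
    ultimately have "(\<Sum>i<m. s i) = 0" by (rule FS_translate_shift_zero[rotated]) (erule no_order_two)
    then show ?iii using E s unfolding move_def by blast
  qed
  have iii_i: ?i if iii: ?iii
  proof -
    obtain m and E :: "nat \<Rightarrow> 'a multiset" and s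
      where E: "E 0 = A" "E m = B" "\<forall>i<m. FS (E (Suc i)) = translate (FS (E i)) (s i)" "(\<Sum>i<m. s i) = 0"
      using iii by blast
    then show ?i using FS_translate_sequence[of m E s] by simp
  qed
  show ?thesis using i_ii ii_iii iii_i by blast
qed

end
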